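(* Let $k$ be a field of characteristic zero, $R = k[x_1,\ldots,x_n]$ with its standard grading, and $\mathscr{D} = \mathscr{D}(R,k)$ the ring of $k$-linear differential operators on $R$. Let $M$ be a graded $\mathscr{D}$-module such that $H^n_{dR}(M)$ is a finite-dimensional $k$-space. Then $$\dim_k(H^n_{dR}(M))=\max\{s\in\mathbb{N}\mid \text{there exists a surjective } \varphi\in\mathrm{Hom}_{\mathscr{D}}(M,E^s)\},$$ where $E = H^n_{(x_1,\ldots,x_n)}(R)$ is the top local cohomology module. (The maps $\varphi$ are $\mathscr{D}$-linear but not required to respect gradings.)
   Context: $\mathscr{D} = R\langle\partial_1,\ldots,\partial_n\rangle$ with $\partial_i = \partial/\partial x_i$; $\mathscr{D}$-modules are left modules. All gradings are $\mathbb{Z}$-gradings, with $\deg x_i = 1$ and $\deg c=0$ for $c\in k$. A graded $\mathscr{D}$-module is a left $\mathscr{D}$-module $M$ whose underlying $R$-module is graded, $M=\bigoplus_{l\in\mathbb{Z}}M_l$, with $\partial_i(M_l)\subseteq M_{l-1}$ for all $l$ and all $1\le i\le n$. $\mathbb{N}$ includes $0$. $E$ has $k$-basis the inverse monomials $x_1^{i_1}\cdots x_n^{i_n}$ with all $i_j\le -1$. Multiplication by $x_j$ raises the exponent $i_j$ by one (giving $0$ if the exponent becomes $0$), and $\partial_j$ acts by formal differentiation. The de Rham complex $M\otimes\Omega_R^\bullet$ of a $\mathscr{D}$-module $M$ has $M\otimes\Omega_R^i=\bigoplus_{1\le j_1<\cdots<j_i\le n} M\,dx_{j_1}\wedge\cdots\wedge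 dx_{j_i}$ for $0\le i\le n$, with $d^i(m\,dx_{j_1}\wedge\cdots\wedge dx_{j_i})=\sum_{s=1}^n\partial_s(m)\,dx_s\wedge dx_{j_1}\wedge\cdots\wedge dx_{j_i}$; $H^i_{dR}(M)$ is its $i$-th cohomology. In particular $H^n_{dR}(M)=M/(\partial_1(M)+\cdots+\partial_n(M))$. *)

theory Defs
  imports
    "HOL-Library.Poly_Mapping"
    "HOL-Library.FuncSet"
    "HOL-Algebra.Generated_Rings"
    "HOL-Algebra.Chinese_Remainder"
    "HOL-Algebra.AbelCoset"
    "Jordan_Normal_Form.VS_Connect"
begin

section \<open>The polynomial ring and its differential operators\<close>

text \<open>
  The variables are \<open>x\<^sub>0, \<dots>, x\<^bsub>n-1\<^esub>\<close>. Polynomials and Laurent polynomials are finitely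
  supported functions on exponents, with product inherited from \<^theory>\<open>HOL-Library.Poly_Mapping\<close>.
\<close>

type_synonym 'k mpoly = "(nat \<Rightarrow>\<^sub>0 nat) \<Rightarrow>\<^sub>0 'k"
type_synonym 'k laurent = "(nat \<Rightarrow>\<^sub>0 int) \<Rightarrow>\<^sub>0 'k"
type_synonym 'k operator = "'k mpoly \<Rightarrow> 'k mpoly"

definition polys :: "nat \<Rightarrow> 'k::field mpoly set" where
  "polys n = {p. \<forall>a \<in> Poly_Mapping.keys p. Poly_Mapping.keys a \<subseteq> {..<n}}"

definition scale :: "'k::field \<Rightarrow> ('a \<Rightarrow>\<^sub>0 'k) \<Rightarrow> ('a \<Rightarrow>\<^sub>0 'k)" where
  "scale c p = Poly_Mapping.map ((*) c) p"

text \<open>The ring of \<open>k\<close>-linear endomorphisms of a subspace \<open>S\<close>.\<close>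

definition End_k :: "('a \<Rightarrow>\<^sub>0 'k::field) set \<Rightarrow> (('a \<Rightarrow>\<^sub>0 'k) \<Rightarrow> ('a \<Rightarrow>\<^sub>0 'k)) ring" where
  "End_k S = \<lparr>
     carrier = {P \<in> S \<rightarrow>\<^sub>E S. (\<forall>p\<in>S. \<forall>q\<in>S. P (p + q) = P p + P q) \<and>
                            (\<forall>c. \<forall>p\<in>S. P (scale c p) = scale c (P p))},
     mult = compose S,
     one = (\<lambda>p\<in>S. p),
     zero = (\<lambda>p\<in>S. 0),
     add = (\<lambda>P Q. \<lambda>p\<in>S. P p + Q p)\<rparr>"

definition mult_op :: "nat \<Rightarrow> 'k::field mpoly \<Rightarrow> 'k operator" where
  "mult_op n r = (\<lambda>p\<in>polys n. r * p)"

definition const_op :: "nat \<Rightarrow> 'k::field \<Rightarrow> 'k operator" where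
  "const_op n c = mult_op n (Poly_Mapping.single 0 c)"

definition var_op :: "nat \<Rightarrow> nat \<Rightarrow> 'k::field operator" where
  "var_op n j = mult_op n (Poly_Mapping.single (Poly_Mapping.single j 1) 1)"

text \<open>When the exponent of \<open>x\<^sub>j\<close> is \<open>0\<close>, subtraction truncates but the coefficient vanishes.\<close>

definition partial_op :: "nat \<Rightarrow> nat \<Rightarrow> 'k::field operator" where
  "partial_op n j = (\<lambda>p\<in>polys n. \<Sum>a\<in>Poly_Mapping.keys p.
     Poly_Mapping.single (a - Poly_Mapping.single j 1)
       (of_nat (Poly_Mapping.lookup a j) * Poly_Mapping.lookup p a))"

text \<open>\<open>\<D> = R\<langle>\<partial>\<^sub>0, \<dots>, \<partial>\<^bsub>n-1\<^esub>\<rangle>\<close>, as a subring of \<open>End\<^sub>k(R)\<close>.\<close>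

definition diff_ops :: "nat \<Rightarrow> 'k::field operator ring" where
  "diff_ops n = (End_k (polys n))\<lparr>carrier :=
     generate_ring (End_k (polys n)) (mult_op n ` polys n \<union> partial_op n ` {..<n})\<rparr>"

section \<open>Left modules\<close>

text \<open>The library's \<^locale>\<open>module\<close> is restricted to commutative rings.\<close>

locale left_module = R?: ring R + M?: abelian_group M
  for R :: "('r, 'a) ring_scheme" and M :: "('r, 'm, 'b) module_scheme" +
  assumes smult_closed [simp, intro]:
      "\<lbrakk>a \<in> carrier R; x \<in> carrier M\<rbrakk> \<Longrightarrow> a \<odot>\<^bsub>M\<^esub> x \<in> carrier M"
    and smult_l_distr:
      "\<lbrakk>a \<in> carrier R; b \<in> carrier R; x \<in> carrier M\<rbrakk> \<Longrightarrow>
       (a \<oplus>\<^bsub>R\<^esub> b) \<odot>\<^bsub>M\<^esub> x = a \<odot>\<^bsub>M\<^esub> x \<oplus>\<^bsub>M\<^esub> b \<odot>\<^bsub>M\<^esub> x"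
    and smult_r_distr:
      "\<lbrakk>a \<in> carrier R; x \<in> carrier M; y \<in> carrier M\<rbrakk> \<Longrightarrow>
       a \<odot>\<^bsub>M\<^esub> (x \<oplus>\<^bsub>M\<^esub> y) = a \<odot>\<^bsub>M\<^esub> x \<oplus>\<^bsub>M\<^esub> a \<odot>\<^bsub>M\<^esub> y"
    and smult_assoc1:
      "\<lbrakk>a \<in> carrier R; b \<in> carrier R; x \<in> carrier M\<rbrakk> \<Longrightarrow>
       (a \<otimes>\<^bsub>R\<^esub> b) \<odot>\<^bsub>M\<^esub> x = a \<odot>\<^bsub>M\<^esub> (b \<odot>\<^bsub>M\<^esub> x)"
    and smult_one [simp]:
      "x \<in> carrier M \<Longrightarrow> \<one>\<^bsub>R\<^esub> \<odot>\<^bsub>M\<^esub> x = x"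

text \<open>
  The \<open>mult\<close> and \<open>one\<close> fields of a module record carry no information; as in the library they
  are filled with zeros below.
\<close>

definition module_power :: "nat \<Rightarrow> ('r, 'm) module \<Rightarrow> ('r, nat \<Rightarrow> 'm) module" where
  "module_power s M = \<lparr>
     carrier = {..<s} \<rightarrow>\<^sub>E carrier M,
     mult = (\<lambda>_ _. \<lambda>i\<in>{..<s}. \<zero>\<^bsub>M\<^esub>),
     one = (\<lambda>i\<in>{..<s}. \<zero>\<^bsub>M\<^esub>),
     zero = (\<lambda>i\<in>{..<s}. \<zero>\<^bsub>M\<^esub>),
     add = (\<lambda>u v. \<lambda>i\<in>{..<s}. u i \<oplus>\<^bsub>M\<^esub> v i),
     smult = (\<lambda>r u. \<lambda>i\<in>{..<s}. r \<odot>\<^bsub>M\<^esub> u i)\<rparr>"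

definition quotient_module :: "('r, 'm) module \<Rightarrow> 'm set \<Rightarrow> ('r, 'm set) module" where
  "quotient_module M N = \<lparr>
     carrier = a_rcosets\<^bsub>M\<^esub> N,
     mult = (\<lambda>_ _. N),
     one = N,
     zero = N,
     add = set_add M,
     smult = (\<lambda>r A. \<Union>x\<in>A. N +>\<^bsub>M\<^esub> (r \<odot>\<^bsub>M\<^esub> x))\<rparr>"

locale graded_D_module = left_module "diff_ops n" M
  for n :: nat and M :: "('k::field operator, 'm) module" +
  fixes gr :: "int \<Rightarrow> 'm set"
  assumes gr_subgroup: "additive_subgroup (gr l) M"
    and gr_decomp: "x \<in> carrier M \<Longrightarrow>
          \<exists>!f. (\<forall>l. f l \<in> gr l) \<and> finite {l. f l \<noteq> \<zero>\<^bsub>M\<^esub>} \<and>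
               x = (\<Oplus>\<^bsub>M\<^esub>l\<in>{l. f l \<noteq> \<zero>\<^bsub>M\<^esub>}. f l)"
    and gr_poly: "\<lbrakk>r \<in> polys n;
          \<forall>a \<in> Poly_Mapping.keys r. (\<Sum>j<n. Poly_Mapping.lookup a j) = d; x \<in> gr l\<rbrakk> \<Longrightarrow>
          mult_op n r \<odot>\<^bsub>M\<^esub> x \<in> gr (l + int d)"
    and gr_partial: "\<lbrakk>j < n; x \<in> gr l\<rbrakk> \<Longrightarrow> partial_op n j \<odot>\<^bsub>M\<^esub> x \<in> gr (l - 1)"

section \<open>De Rham cohomology\<close>

text \<open>
  A form of degree \<open>i\<close> is given by its coefficients on
  \<open>dx\<^sub>J = dx\<^bsub>j\<^sub>1\<^esub> \<and> \<dots> \<and> dx\<^bsub>j\<^sub>i\<^esub>\<close> for \<open>J = {j\<^sub>1 < \<dots> < j\<^sub>i}\<close>.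
\<close>

definition form_index :: "nat \<Rightarrow> nat \<Rightarrow> nat set set" where
  "form_index n i = {J. J \<subseteq> {..<n} \<and> card J = i}"

definition dR_forms ::
    "nat \<Rightarrow> ('k::field operator, 'm) module \<Rightarrow> nat \<Rightarrow> ('k, nat set \<Rightarrow> 'm) module" where
  "dR_forms n M i = \<lparr>
     carrier = form_index n i \<rightarrow>\<^sub>E carrier M,
     mult = (\<lambda>_ _. \<lambda>J\<in>form_index n i. \<zero>\<^bsub>M\<^esub>),
     one = (\<lambda>J\<in>form_index n i. \<zero>\<^bsub>M\<^esub>),
     zero = (\<lambda>J\<in>form_index n i. \<zero>\<^bsub>M\<^esub>),
     add = (\<lambda>\<omega> \<eta>. \<lambda>J\<in>form_index n i. \<omega> J \<oplus>\<^bsub>M\<^esub> \<eta> J),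
     smult = (\<lambda>c \<omega>. \<lambda>J\<in>form_index n i. const_op n c \<odot>\<^bsub>M\<^esub> \<omega> J)\<rparr>"

text \<open>
  The sign is that of \<open>dx\<^sub>s \<and> dx\<^bsub>J - {s}\<^esub> = (-1)\<^bsup>#{j \<in> J. j < s}\<^esup> dx\<^sub>J\<close>.
\<close>

definition dR_diff ::
    "nat \<Rightarrow> ('k::field operator, 'm) module \<Rightarrow> nat \<Rightarrow> (nat set \<Rightarrow> 'm) \<Rightarrow> (nat set \<Rightarrow> 'm)" where
  "dR_diff n M i \<omega> = (\<lambda>J\<in>form_index n (Suc i).
     \<Oplus>\<^bsub>M\<^esub>s\<in>J. const_op n ((-1) ^ card {j \<in> J. j < s}) \<odot>\<^bsub>M\<^esub> (partial_op n s \<odot>\<^bsub>M\<^esub> \<omega> (J - {s})))"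

definition dR_cocycles ::
    "nat \<Rightarrow> ('k::field operator, 'm) module \<Rightarrow> nat \<Rightarrow> (nat set \<Rightarrow> 'm) set" where
  "dR_cocycles n M i = a_kernel (dR_forms n M i) (dR_forms n M (Suc i)) (dR_diff n M i)"

definition dR_coboundaries ::
    "nat \<Rightarrow> ('k::field operator, 'm) module \<Rightarrow> nat \<Rightarrow> (nat set \<Rightarrow> 'm) set" where
  "dR_coboundaries n M i = (case i of
     0 \<Rightarrow> {\<zero>\<^bsub>dR_forms n M 0\<^esub>}
   | Suc i' \<Rightarrow> dR_diff n M i' ` carrier (dR_forms n M i'))"

definition dR_cohomology ::
    "nat \<Rightarrow> ('k::field operator, 'm) module \<Rightarrow> nat \<Rightarrow> ('k, (nat set \<Rightarrow> 'm) set) module" where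
  "dR_cohomology n M i =
     quotient_module ((dR_forms n M i)\<lparr>carrier := dR_cocycles n M i\<rparr>) (dR_coboundaries n M i)"

section \<open>The module of inverse polynomials\<close>

text \<open>
  \<open>E = H\<^sup>n\<^sub>\<mm>(R)\<close> with \<open>\<mm> = (x\<^sub>0, \<dots>, x\<^bsub>n-1\<^esub>)\<close>, in its description by inverse monomials:
  the cokernel of \<open>\<Oplus>\<^sub>j R[1/y\<^sub>j] \<rightarrow> R[1/y]\<close>, where \<open>y\<close> is the product of all variables and \<open>y\<^sub>j\<close>
  the product of all but \<open>x\<^sub>j\<close>, is spanned by the
  Laurent monomials all of whose exponents are negative, the others becoming \<open>0\<close>.
\<close>

definition inv_exps :: "nat \<Rightarrow> (nat \<Rightarrow>\<^sub>0 int) set" where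
  "inv_exps n = {a. Poly_Mapping.keys a \<subseteq> {..<n} \<and> (\<forall>j<n. Poly_Mapping.lookup a j \<le> -1)}"

definition inv_polys :: "nat \<Rightarrow> 'k::field laurent set" where
  "inv_polys n = {e. Poly_Mapping.keys e \<subseteq> inv_exps n}"

definition trunc :: "nat \<Rightarrow> 'k::field laurent \<Rightarrow> 'k laurent" where
  "trunc n f = (\<Sum>a\<in>Poly_Mapping.keys f \<inter> inv_exps n.
     Poly_Mapping.single a (Poly_Mapping.lookup f a))"

definition inv_const :: "nat \<Rightarrow> 'k::field \<Rightarrow> 'k laurent \<Rightarrow> 'k laurent" where
  "inv_const n c = (\<lambda>e\<in>inv_polys n. scale c e)"

definition inv_var :: "nat \<Rightarrow> nat \<Rightarrow> 'k::field laurent \<Rightarrow> 'k laurent" where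
  "inv_var n j = (\<lambda>e\<in>inv_polys n.
     trunc n (Poly_Mapping.single (Poly_Mapping.single j 1) 1 * e))"

definition inv_partial :: "nat \<Rightarrow> nat \<Rightarrow> 'k::field laurent \<Rightarrow> 'k laurent" where
  "inv_partial n j = (\<lambda>e\<in>inv_polys n. \<Sum>a\<in>Poly_Mapping.keys e.
     Poly_Mapping.single (a - Poly_Mapping.single j 1)
       (of_int (Poly_Mapping.lookup a j) * Poly_Mapping.lookup e a))"

text \<open>
  The action of \<open>\<D>\<close> on \<open>E\<close> is the ring homomorphism \<open>\<D> \<rightarrow> End\<^sub>k(E)\<close> that takes the prescribed
  values on \<open>k\<close>, the \<open>x\<^sub>j\<close> and the \<open>\<partial>\<^sub>j\<close>; its graph is the subring of the product generated by the
  graph on these generators. Lemma \<open>E_graph_ex1\<close> below shows that this subring is indeed the graph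
  of a function, and \<open>E_mod_left_module\<close> that \<open>E\<close> is a left \<open>\<D>\<close>-module.
\<close>

definition E_graph :: "nat \<Rightarrow> ('k::field operator \<times> ('k laurent \<Rightarrow> 'k laurent)) set" where
  "E_graph n = generate_ring (RDirProd (End_k (polys n)) (End_k (inv_polys n)))
     (range (\<lambda>c. (const_op n c, inv_const n c)) \<union>
      (\<lambda>j. (var_op n j, inv_var n j)) ` {..<n} \<union>
      (\<lambda>j. (partial_op n j, inv_partial n j)) ` {..<n})"

definition E_mod :: "nat \<Rightarrow> ('k::field operator, 'k laurent) module" where
  "E_mod n = \<lparr>
     carrier = inv_polys n,
     mult = (\<lambda>_ _. 0),
     one = 0,
     zero = 0,
     add = (+),
     smult = (\<lambda>P e. (THE Q. (P, Q) \<in> E_graph n) e)\<rparr>"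

section \<open>Well-definedness of the action on inverse polynomials\<close>

text \<open>
  An operator in \<open>\<D>\<close> extends to Laurent polynomials. The extension has finite order, in the sense
  that iterated commutators with the variables eventually vanish, and an operator of finite order
  on Laurent polynomials that kills \<open>R\<close> is zero. Hence the induced map on \<open>E\<close> is unique.
\<close>

subsection \<open>Endomorphism rings\<close>

lemma lookup_scale [simp]: "Poly_Mapping.lookup (scale c p) a = c * Poly_Mapping.lookup p a"
  by (simp add: scale_def Poly_Mapping.map.rep_eq when_def)

lemma scale_simps: "scale c (p + q) = scale c p + scale c q" "scale c 0 = 0"
  "scale (-1) p = - p"
  by (rule poly_mapping_eqI; simp add: lookup_add algebra_simps)+

lemma keys_scale: "Poly_Mapping.keys (scale c p) \<subseteq> Poly_Mapping.keys p"
  by (auto simp: in_keys_iff)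

definition k_subspace :: "('a \<Rightarrow>\<^sub>0 'k::field) set \<Rightarrow> bool" where
  "k_subspace S \<longleftrightarrow> 0 \<in> S \<and> (\<forall>p\<in>S. \<forall>q\<in>S. p + q \<in> S) \<and> (\<forall>c. \<forall>p\<in>S. scale c p \<in> S)"

lemma k_subspace_minus: "k_subspace S \<Longrightarrow> p \<in> S \<Longrightarrow> - p \<in> S"
  by (metis k_subspace_def scale_simps(3))

lemma k_subspace_keys: "k_subspace {p. Poly_Mapping.keys p \<subseteq> A}"
  unfolding k_subspace_def
proof (intro conjI ballI allI)
  fix p q :: "'a \<Rightarrow>\<^sub>0 'b"
  assume "p \<in> {p. Poly_Mapping.keys p \<subseteq> A}" "q \<in> {p. Poly_Mapping.keys p \<subseteq> A}"
  then have "Poly_Mapping.keys p \<union> Poly_Mapping.keys q \<subseteq> A" by simp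
  then show "p + q \<in> {p. Poly_Mapping.keys p \<subseteq> A}"
    using order_trans[OF keys_add] by simp
next
  fix c and p :: "'a \<Rightarrow>\<^sub>0 'b"
  assume "p \<in> {p. Poly_Mapping.keys p \<subseteq> A}"
  then show "scale c p \<in> {p. Poly_Mapping.keys p \<subseteq> A}"
    using order_trans[OF keys_scale] by simp
qed simp

lemma polys_eq: "polys n = {p. Poly_Mapping.keys p \<subseteq> {a. Poly_Mapping.keys a \<subseteq> {..<n}}}"
  by (auto simp: polys_def)

lemma k_subspace_polys: "k_subspace (polys n)"
  unfolding polys_eq by (rule k_subspace_keys)

lemma k_subspace_inv_polys: "k_subspace (inv_polys n)"
  unfolding inv_polys_def by (rule k_subspace_keys)

lemma End_k_simps:
  "carrier (End_k S) = {P \<in> S \<rightarrow>\<^sub>E S. (\<forall>p\<in>S. \<forall>q\<in>S. P (p + q) = P p + P q) \<and>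
                            (\<forall>c. \<forall>p\<in>S. P (scale c p) = scale c (P p))}"
  "P \<otimes>\<^bsub>End_k S\<^esub> Q = compose S P Q"
  "\<one>\<^bsub>End_k S\<^esub> = (\<lambda>p\<in>S. p)"
  "\<zero>\<^bsub>End_k S\<^esub> = (\<lambda>p\<in>S. 0)"
  "P \<oplus>\<^bsub>End_k S\<^esub> Q = (\<lambda>p\<in>S. P p + Q p)"
  by (simp_all add: End_k_def)

lemma End_k_ring:
  assumes S: "k_subspace S"
  shows "ring (End_k S)"
proof (rule ringI)
  have S0: "0 \<in> S" and Sa: "\<And>p q. p \<in> S \<Longrightarrow> q \<in> S \<Longrightarrow> p + q \<in> S"
    and Ss: "\<And>c p. p \<in> S \<Longrightarrow> scale c p \<in> S"
    using S by (auto simp: k_subspace_def)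
  have Sm: "- p \<in> S" if "p \<in> S" for p using k_subspace_minus[OF S that] .
  have scm: "scale c (- p) = - scale c p" for c and p :: "'a \<Rightarrow>\<^sub>0 'b"
    by (rule poly_mapping_eqI) simp
  have mem: "P \<in> carrier (End_k S) \<Longrightarrow> p \<in> S \<Longrightarrow> P p \<in> S" for P p
    by (auto simp: End_k_simps)
  have ext: "P = Q" if "P \<in> carrier (End_k S)" "Q \<in> carrier (End_k S)" "\<And>p. p \<in> S \<Longrightarrow> P p = Q p" for P Q
    using that by (auto simp: End_k_simps intro: PiE_ext)
  show "abelian_group (End_k S)"
  proof (rule abelian_groupI)
    fix x assume x: "x \<in> carrier (End_k S)"
    have "(\<lambda>p\<in>S. - x p) \<in> carrier (End_k S)"
      using mem[OF x] x by (auto simp: End_k_simps Sm Sa Ss scm)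
    moreover have "(\<lambda>p\<in>S. - x p) \<oplus>\<^bsub>End_k S\<^esub> x = \<zero>\<^bsub>End_k S\<^esub>"
      by (auto simp: End_k_simps)
    ultimately show "\<exists>y\<in>carrier (End_k S). y \<oplus>\<^bsub>End_k S\<^esub> x = \<zero>\<^bsub>End_k S\<^esub>" by blast
  next
    fix x assume x: "x \<in> carrier (End_k S)"
    then have "(\<lambda>p\<in>S. (\<lambda>p\<in>S. 0) p + x p) = x"
      by (intro ext) (auto simp: End_k_simps Sa Ss)
    then show "\<zero>\<^bsub>End_k S\<^esub> \<oplus>\<^bsub>End_k S\<^esub> x = x" by (simp add: End_k_simps)
  qed (auto simp: End_k_simps PiE_iff S0 Sa Ss scale_simps algebra_simps intro!: restrict_ext)
  show "monoid (End_k S)"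
  proof (rule monoidI)
    fix x y z assume "x \<in> carrier (End_k S)" "y \<in> carrier (End_k S)" "z \<in> carrier (End_k S)"
    then show "x \<otimes>\<^bsub>End_k S\<^esub> y \<otimes>\<^bsub>End_k S\<^esub> z = x \<otimes>\<^bsub>End_k S\<^esub> (y \<otimes>\<^bsub>End_k S\<^esub> z)"
      by (auto simp: End_k_simps compose_def fun_eq_iff restrict_def Pi_iff PiE_iff)
  next
    fix x assume x: "x \<in> carrier (End_k S)"
    then show "\<one>\<^bsub>End_k S\<^esub> \<otimes>\<^bsub>End_k S\<^esub> x = x" "x \<otimes>\<^bsub>End_k S\<^esub> \<one>\<^bsub>End_k S\<^esub> = x"
      using mem[OF x]
      by (auto simp: End_k_simps compose_def fun_eq_iff restrict_def PiE_iff extensional_def)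
  qed (auto simp: End_k_simps Sa Ss compose_def PiE_iff)
  fix x y z assume xyz: "x \<in> carrier (End_k S)" "y \<in> carrier (End_k S)" "z \<in> carrier (End_k S)"
  show "(x \<oplus>\<^bsub>End_k S\<^esub> y) \<otimes>\<^bsub>End_k S\<^esub> z = x \<otimes>\<^bsub>End_k S\<^esub> z \<oplus>\<^bsub>End_k S\<^esub> y \<otimes>\<^bsub>End_k S\<^esub> z"
    using mem[OF xyz(3)] by (auto simp: End_k_simps compose_def fun_eq_iff restrict_def)
  show "z \<otimes>\<^bsub>End_k S\<^esub> (x \<oplus>\<^bsub>End_k S\<^esub> y) = z \<otimes>\<^bsub>End_k S\<^esub> x \<oplus>\<^bsub>End_k S\<^esub> z \<otimes>\<^bsub>End_k S\<^esub> y"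
    using xyz by (auto simp: End_k_simps compose_def fun_eq_iff restrict_def PiE_iff)
qed

subsection \<open>Formal derivatives\<close>

definition msum :: "('a \<Rightarrow> 'b) \<Rightarrow> ('a \<Rightarrow> 'k) \<Rightarrow> ('a \<Rightarrow>\<^sub>0 'k::field) \<Rightarrow> ('b \<Rightarrow>\<^sub>0 'k)" where
  "msum g h p = (\<Sum>a\<in>Poly_Mapping.keys p. Poly_Mapping.single (g a) (h a * Poly_Mapping.lookup p a))"

lemma msum_superset:
  assumes "finite A" "Poly_Mapping.keys p \<subseteq> A"
  shows "msum g h p = (\<Sum>a\<in>A. Poly_Mapping.single (g a) (h a * Poly_Mapping.lookup p a))"
  unfolding msum_def by (rule sum.mono_neutral_left) (use assms in \<open>auto simp: in_keys_iff\<close>)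

lemma msum_0 [simp]: "msum g h 0 = 0"
  by (simp add: msum_def)

lemma msum_add: "msum g h (p + q) = msum g h p + msum g h q"
proof -
  let ?A = "Poly_Mapping.keys p \<union> Poly_Mapping.keys q"
  have A: "finite ?A" by simp
  have 1: "Poly_Mapping.keys (p + q) \<subseteq> ?A" "Poly_Mapping.keys p \<subseteq> ?A" "Poly_Mapping.keys q \<subseteq> ?A"
    by (rule keys_add) auto
  show ?thesis
    unfolding msum_superset[OF A 1(1)] msum_superset[OF A 1(2)] msum_superset[OF A 1(3)]
      lookup_add distrib_left single_add sum.distrib ..
qed

lemma scale_sum: "scale c (sum f A) = (\<Sum>a\<in>A. scale c (f a))"
  by (induction A rule: infinite_finite_induct) (auto simp: scale_simps)

lemma scale_single: "scale c (Poly_Mapping.single a b) = Poly_Mapping.single a (c * b)"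
  by (rule poly_mapping_eqI) (simp add: lookup_single when_def)

lemma msum_scale: "msum g h (scale c p) = scale c (msum g h p)"
proof -
  have "msum g h (scale c p) = (\<Sum>a\<in>Poly_Mapping.keys p. Poly_Mapping.single (g a) (h a * Poly_Mapping.lookup (scale c p) a))"
    by (intro msum_superset keys_scale) auto
  also have "\<dots> = scale c (msum g h p)"
    by (auto simp: msum_def scale_sum scale_single mult_ac)
  finally show ?thesis .
qed

lemma msum_single: "msum g h (Poly_Mapping.single a c) = Poly_Mapping.single (g a) (h a * c)"
  by (cases "c = 0") (auto simp: msum_def)

lemma keys_msum: "Poly_Mapping.keys (msum g h p) \<subseteq> g ` {a \<in> Poly_Mapping.keys p. h a \<noteq> 0}"
proof
  fix b assume "b \<in> Poly_Mapping.keys (msum g h p)"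
  then have "(\<Sum>a\<in>Poly_Mapping.keys p. Poly_Mapping.lookup (Poly_Mapping.single (g a) (h a * Poly_Mapping.lookup p a)) b) \<noteq> 0"
    by (simp add: msum_def in_keys_iff lookup_sum)
  then obtain a where a: "a \<in> Poly_Mapping.keys p"
      "Poly_Mapping.lookup (Poly_Mapping.single (g a) (h a * Poly_Mapping.lookup p a)) b \<noteq> 0"
    by (rule sum.not_neutral_contains_not_neutral)
  then have "b = g a" "h a \<noteq> 0"
    by (simp_all add: lookup_single when_def split: if_splits)
  with a(1) show "b \<in> g ` {a \<in> Poly_Mapping.keys p. h a \<noteq> 0}" by simp
qed

lemma additive_eqI:
  fixes F G :: "('a \<Rightarrow>\<^sub>0 'k::field) \<Rightarrow> 'b::cancel_comm_monoid_add"
  assumes F: "\<And>p q. F (p + q) = F p + F q" and G: "\<And>p q. G (p + q) = G p + G q"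
    and eq: "\<And>a c. a \<in> Poly_Mapping.keys f \<Longrightarrow> F (Poly_Mapping.single a c) = G (Poly_Mapping.single a c)"
  shows "F f = G f"
proof -
  have F0: "F 0 = 0" using F[of 0 0] by simp
  have G0: "G 0 = 0" using G[of 0 0] by simp
  have *: "H (sum h A) = (\<Sum>a\<in>A. H (h a))" if "H 0 = 0" "\<And>p q. H (p + q) = H p + H q"
    for H :: "('a \<Rightarrow>\<^sub>0 'k) \<Rightarrow> 'b" and h and A :: "'a set"
    by (induction A rule: infinite_finite_induct) (auto simp: that)
  let ?s = "\<Sum>a\<in>Poly_Mapping.keys f. Poly_Mapping.single a (Poly_Mapping.lookup f a)"
  have f: "?s = f"
    by (rule poly_mapping_eqI) (simp add: lookup_sum lookup_single when_def in_keys_iff)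
  have "F ?s = G ?s" unfolding *[OF F0 F] *[OF G0 G] by (intro sum.cong refl eq)
  then show ?thesis unfolding f .
qed

lemma sum_singles:
  "(\<Sum>a\<in>Poly_Mapping.keys f. Poly_Mapping.single a (Poly_Mapping.lookup f a)) = f"
  by (rule poly_mapping_eqI) (simp add: lookup_sum lookup_single when_def in_keys_iff)

definition dP :: "nat \<Rightarrow> 'k::field mpoly \<Rightarrow> 'k mpoly" where
  "dP j = msum (\<lambda>a. a - Poly_Mapping.single j 1) (\<lambda>a. of_nat (Poly_Mapping.lookup a j))"

definition dL :: "nat \<Rightarrow> 'k::field laurent \<Rightarrow> 'k laurent" where
  "dL j = msum (\<lambda>a. a - Poly_Mapping.single j 1) (\<lambda>a. of_int (Poly_Mapping.lookup a j))"

definition xL :: "nat \<Rightarrow> 'k::field laurent" where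
  "xL j = Poly_Mapping.single (Poly_Mapping.single j 1) 1"

definition emb :: "'k::field mpoly \<Rightarrow> 'k laurent" where
  "emb = msum (Poly_Mapping.map int) (\<lambda>_. 1)"

definition laurents :: "nat \<Rightarrow> 'k::field laurent set" where
  "laurents n = {f. Poly_Mapping.keys f \<subseteq> {a. Poly_Mapping.keys a \<subseteq> {..<n}}}"

lemma partial_op_eq: "partial_op n j = (\<lambda>p\<in>polys n. dP j p)"
  by (simp add: partial_op_def dP_def msum_def)

lemma inv_var_eq: "inv_var n j = (\<lambda>e\<in>inv_polys n. trunc n (xL j * e))"
  by (simp add: inv_var_def xL_def)

lemma inv_partial_eq: "inv_partial n j = (\<lambda>e\<in>inv_polys n. dL j e)"
  by (simp add: inv_partial_def dL_def msum_def)

lemma trunc_eq: "trunc n = msum id (\<lambda>a. if a \<in> inv_exps n then 1 else 0)"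
proof (rule ext)
  fix f :: "'a laurent"
  have "trunc n f = (\<Sum>a\<in>Poly_Mapping.keys f. if a \<in> inv_exps n then Poly_Mapping.single a (Poly_Mapping.lookup f a) else 0)"
    unfolding trunc_def by (rule sum.inter_restrict) simp
  also have "\<dots> = msum id (\<lambda>a. if a \<in> inv_exps n then 1 else 0) f"
    unfolding msum_def by (rule sum.cong) auto
  finally show "trunc n f = \<dots>" .
qed

lemma trunc_add: "trunc n (f + g) = trunc n f + trunc n g"
  by (simp add: trunc_eq msum_add)

lemma trunc_0 [simp]: "trunc n 0 = 0"
  by (simp add: trunc_eq)

lemma trunc_single: "trunc n (Poly_Mapping.single a c) = (if a \<in> inv_exps n then Poly_Mapping.single a c else 0)"
  by (auto simp: trunc_eq msum_single)

lemma trunc_in: "trunc n f \<in> inv_polys n"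
proof -
  have "Poly_Mapping.keys (trunc n f) \<subseteq> {a. a \<in> inv_exps n}"
    unfolding trunc_eq by (rule order_trans[OF keys_msum]) auto
  then show ?thesis by (simp add: inv_polys_def)
qed

lemma trunc_id: "e \<in> inv_polys n \<Longrightarrow> trunc n e = e"
  by (rule additive_eqI[of "trunc n" "\<lambda>x. x"]) (auto simp: trunc_add trunc_single inv_polys_def)

lemma inv_polys_laurents: "e \<in> inv_polys n \<Longrightarrow> e \<in> laurents n"
  by (auto simp: inv_polys_def laurents_def inv_exps_def)

lemma dL_leibniz_x: "dL i (xL j * f) = xL j * dL i f + (if i = j then f else 0)"
proof (rule additive_eqI[of "\<lambda>f. dL i (xL j * f)" "\<lambda>f. xL j * dL i f + (if i = j then f else 0)"])
  fix a and c :: 'a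
  have 1: "Poly_Mapping.single j (1::int) + a - Poly_Mapping.single i 1 =
      Poly_Mapping.single j 1 + (a - Poly_Mapping.single i 1)"
    by (rule add_diff_eq[symmetric])
  have "dL i (xL j * Poly_Mapping.single a c) =
      Poly_Mapping.single (Poly_Mapping.single j 1 + (a - Poly_Mapping.single i 1))
        (of_int (Poly_Mapping.lookup (Poly_Mapping.single j 1 + a) i) * c)"
    by (simp only: dL_def xL_def mult_single msum_single 1 mult_1)
  also have "\<dots> = xL j * dL i (Poly_Mapping.single a c) + (if i = j then Poly_Mapping.single a c else 0)"
  proof (cases "i = j")
    case True
    have 2: "Poly_Mapping.single j (1::int) + (a - Poly_Mapping.single j 1) = a" by simp
    have 3: "(of_int (Poly_Mapping.lookup (Poly_Mapping.single j 1 + a) j) * c) =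
      of_int (Poly_Mapping.lookup a j) * c + c"
      by (simp add: lookup_add algebra_simps)
    show ?thesis
      by (simp only: True dL_def xL_def mult_single msum_single 2 3 single_add mult_1 refl if_True)
  next
    case False
    then show ?thesis
      by (simp add: dL_def xL_def mult_single msum_single lookup_add lookup_single_not_eq)
  qed
  finally show "dL i (xL j * Poly_Mapping.single a c) =
      xL j * dL i (Poly_Mapping.single a c) + (if i = j then Poly_Mapping.single a c else 0)" .
qed (auto simp: dL_def msum_add algebra_simps)

lemma emb_add: "emb (p + q) = emb p + emb q" by (simp add: emb_def msum_add)

lemma map_int_single: "Poly_Mapping.map int (Poly_Mapping.single j m) = Poly_Mapping.single j (int m)"
  by (rule poly_mapping_eqI) (simp add: Poly_Mapping.map.rep_eq lookup_single when_def)

lemma map_int_add: "Poly_Mapping.map int (a + b) = Poly_Mapping.map int a + Poly_Mapping.map int b"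
  by (rule poly_mapping_eqI) (simp add: Poly_Mapping.map.rep_eq lookup_add when_def)

lemma emb_0 [simp]: "emb 0 = 0" by (simp add: emb_def)

lemma emb_single: "emb (Poly_Mapping.single a c) = Poly_Mapping.single (Poly_Mapping.map int a) c"
  by (simp add: emb_def msum_single)

lemma emb_scale: "emb (scale c p) = scale c (emb p)" by (simp add: emb_def msum_scale)

lemma emb_x: "emb (Poly_Mapping.single (Poly_Mapping.single j 1) 1 * p) = xL j * emb p"
  by (rule additive_eqI[of "\<lambda>p. emb (_ * p)" "\<lambda>p. xL j * emb p"])
     (auto simp: algebra_simps emb_add emb_single mult_single xL_def map_int_add map_int_single)

lemma emb_d: "emb (dP j p) = dL j (emb p)"
proof (rule additive_eqI[of "\<lambda>p. emb (dP j p)" "\<lambda>p. dL j (emb p)"])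
  fix a :: "nat \<Rightarrow>\<^sub>0 nat" and c :: 'a
  have "Poly_Mapping.map int (a - Poly_Mapping.single j 1) = Poly_Mapping.map int a - Poly_Mapping.single j 1"
    if "Poly_Mapping.lookup a j \<noteq> 0"
    using that by (intro poly_mapping_eqI)
      (auto simp: Poly_Mapping.map.rep_eq lookup_minus lookup_single when_def of_nat_diff)
  then show "emb (dP j (Poly_Mapping.single a c)) = dL j (emb (Poly_Mapping.single a c))"
    by (cases "Poly_Mapping.lookup a j = 0")
       (auto simp: emb_single dP_def dL_def msum_single Poly_Mapping.map.rep_eq when_def)
qed (auto simp: dP_def dL_def msum_add emb_add)

lemma k_subspace_laurents: "k_subspace (laurents n)"
  unfolding laurents_def by (rule k_subspace_keys)

lemma laurents_closed:
  "f \<in> laurents n \<Longrightarrow> scale c f \<in> laurents n"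
  "f \<in> laurents n \<Longrightarrow> g \<in> laurents n \<Longrightarrow> f + g \<in> laurents n"
  "f \<in> laurents n \<Longrightarrow> - f \<in> laurents n"
proof -
  note S = k_subspace_laurents[of n, where ?'a = 'a]
  show "f \<in> laurents n \<Longrightarrow> - f \<in> laurents n" using k_subspace_minus[OF S] .
  show "f \<in> laurents n \<Longrightarrow> scale c f \<in> laurents n"
    "f \<in> laurents n \<Longrightarrow> g \<in> laurents n \<Longrightarrow> f + g \<in> laurents n"
    using S by (simp_all add: k_subspace_def)
qed

lemma scale_conv_mult: "scale c p = Poly_Mapping.single 0 c * (p :: 'a::comm_monoid_add \<Rightarrow>\<^sub>0 'k::field)"
  by (simp add: scale_def mult_map_scale_conv_mult)

lemma mult_mem:
  assumes "r \<in> {p. Poly_Mapping.keys p \<subseteq> {a. Poly_Mapping.keys a \<subseteq> {..<n}}}"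
    "p \<in> {p. Poly_Mapping.keys p \<subseteq> {a. Poly_Mapping.keys a \<subseteq> {..<n}}}"
  shows "(r :: (nat \<Rightarrow>\<^sub>0 'e::comm_monoid_add) \<Rightarrow>\<^sub>0 'k::field) * p \<in> {p. Poly_Mapping.keys p \<subseteq> {a. Poly_Mapping.keys a \<subseteq> {..<n}}}"
proof -
  have "Poly_Mapping.keys c \<subseteq> {..<n}" if "c \<in> Poly_Mapping.keys (r * p)" for c
  proof -
    from that have "c \<in> {a + b | a b. a \<in> Poly_Mapping.keys r \<and> b \<in> Poly_Mapping.keys p}"
      using keys_mult[of r p] by (rule rev_subsetD)
    then obtain a b where ab: "a \<in> Poly_Mapping.keys r" "b \<in> Poly_Mapping.keys p" "c = a + b"
      by (elim CollectE exE conjE)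
    have "Poly_Mapping.keys a \<union> Poly_Mapping.keys b \<subseteq> {..<n}"
      using ab(1,2) assms by (simp add: subset_iff)
    then show ?thesis unfolding ab(3) by (rule order_trans[OF keys_add])
  qed
  then show ?thesis by blast
qed

lemma polys_mult: "r \<in> polys n \<Longrightarrow> p \<in> polys n \<Longrightarrow> r * p \<in> polys n"
  unfolding polys_eq by (rule mult_mem)

lemma laurents_mult: "r \<in> laurents n \<Longrightarrow> p \<in> laurents n \<Longrightarrow> r * p \<in> laurents n"
  unfolding laurents_def by (rule mult_mem)

lemma keys_nat_minus: "Poly_Mapping.keys (a - b) \<subseteq> Poly_Mapping.keys (a :: nat \<Rightarrow>\<^sub>0 nat)"
  by (auto simp: in_keys_iff lookup_minus)

lemma keys_dP:
  assumes "b \<in> Poly_Mapping.keys (dP j f)"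
  shows "\<exists>a\<in>Poly_Mapping.keys f. b = a - Poly_Mapping.single j 1"
  using subsetD[OF keys_msum assms[unfolded dP_def]] by (elim imageE CollectE conjE) (rule bexI)

lemma polys_d: "p \<in> polys n \<Longrightarrow> dP j p \<in> polys n"
  unfolding polys_def using keys_dP keys_nat_minus by blast

lemma keys_dL:
  assumes "b \<in> Poly_Mapping.keys (dL j f)"
  shows "\<exists>a\<in>Poly_Mapping.keys f. Poly_Mapping.lookup a j \<noteq> 0 \<and> b = a - Poly_Mapping.single j 1"
proof -
  obtain a where a: "a \<in> Poly_Mapping.keys f" "of_int (Poly_Mapping.lookup a j) \<noteq> (0::'a)"
      "b = a - Poly_Mapping.single j 1"
    using subsetD[OF keys_msum assms[unfolded dL_def]] by (elim imageE CollectE conjE)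
  then have "Poly_Mapping.lookup a j \<noteq> 0" by (metis of_int_0)
  with a show ?thesis by (intro bexI[of _ a] conjI)
qed

lemma keys_int_minus:
  "Poly_Mapping.keys (a - Poly_Mapping.single j (1::int)) \<subseteq> insert j (Poly_Mapping.keys a)"
  by (auto simp: in_keys_iff lookup_minus lookup_single when_def split: if_splits)

lemma laurents_d:
  assumes "f \<in> laurents n"
  shows "dL j f \<in> laurents n"
proof -
  have "Poly_Mapping.keys b \<subseteq> {..<n}" if b: "b \<in> Poly_Mapping.keys (dL j f)" for b
  proof -
    obtain a where a: "a \<in> Poly_Mapping.keys f" "Poly_Mapping.lookup a j \<noteq> 0"
        "b = a - Poly_Mapping.single j 1"
      using keys_dL[OF b] by blast
    have "j \<in> Poly_Mapping.keys a" using a(2) by (simp add: in_keys_iff)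
    then have "Poly_Mapping.keys b \<subseteq> Poly_Mapping.keys a" using keys_int_minus[of a j] a(3) by blast
    then show ?thesis using a(1) assms by (auto simp: laurents_def)
  qed
  then show ?thesis by (auto simp: laurents_def)
qed

lemma inv_polys_d:
  assumes j: "j < n" and f: "f \<in> inv_polys n"
  shows "dL j f \<in> inv_polys n"
proof -
  have "b \<in> inv_exps n" if b: "b \<in> Poly_Mapping.keys (dL j f)" for b
  proof -
    obtain a where a: "a \<in> inv_exps n" "b = a - Poly_Mapping.single j 1"
      using keys_dL[OF b] f by (auto simp: inv_polys_def)
    have 1: "Poly_Mapping.keys b \<subseteq> {..<n}"
      using keys_int_minus[of a j] a j by (auto simp: inv_exps_def)
    have 2: "Poly_Mapping.lookup b i \<le> Poly_Mapping.lookup a i" for i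
      unfolding a(2) lookup_minus lookup_single when_def by simp
    have "Poly_Mapping.lookup b i \<le> -1" if "i < n" for i
      using 2[of i] a(1) that unfolding inv_exps_def by force
    with 1 show ?thesis by (simp add: inv_exps_def)
  qed
  then show ?thesis by (auto simp: inv_polys_def)
qed

subsection \<open>Laurent operators of finite order\<close>

definition add_op :: "('k::field laurent \<Rightarrow> 'k laurent) \<Rightarrow> bool" where
  "add_op T \<longleftrightarrow> (\<forall>f g. T (f + g) = T f + T g)"

lemma add_opD: "add_op T \<Longrightarrow> T (f + g) = T f + T g"
  by (simp add: add_op_def)

lemma add_op_0: "add_op T \<Longrightarrow> T 0 = 0"
  using add_opD[of T 0 0] by (metis add.right_neutral add_left_imp_eq)

lemma add_op_diff: "add_op T \<Longrightarrow> T (f - g) = T f - T g"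
  using add_opD[of T "f - g" g] by simp

primrec ord_lt :: "nat \<Rightarrow> nat \<Rightarrow> ('k::field laurent \<Rightarrow> 'k laurent) \<Rightarrow> bool" where
  "ord_lt n 0 T \<longleftrightarrow> (\<forall>f. T f = 0)"
| "ord_lt n (Suc m) T \<longleftrightarrow> (\<forall>j<n. ord_lt n m (\<lambda>f. T (xL j * f) - xL j * T f))"

lemma ord_lt_Suc: "ord_lt n m T \<Longrightarrow> ord_lt n (Suc m) T"
proof (induction m arbitrary: T)
  case (Suc m)
  have "ord_lt n (Suc m) (\<lambda>f. T (xL j * f) - xL j * T f)" if "j < n" for j
    by (rule Suc.IH) (use Suc.prems that in simp)
  then show ?case by (subst ord_lt.simps(2)) blast
qed simp

lemma ord_lt_mono: "ord_lt n m T \<Longrightarrow> m \<le> m' \<Longrightarrow> ord_lt n m' T"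
proof (induction m' rule: nat_induct)
  case (Suc m')
  then show ?case by (cases "m = Suc m'") (auto simp del: ord_lt.simps intro: ord_lt_Suc)
qed auto

lemma ord_lt_add: "ord_lt n m T \<Longrightarrow> ord_lt n m U \<Longrightarrow> ord_lt n m (\<lambda>f. T f + U f)"
proof (induction m arbitrary: T U)
  case (Suc m)
  have eq: "(\<lambda>f. T (xL j * f) + U (xL j * f) - xL j * (T f + U f)) =
      (\<lambda>f. (T (xL j * f) - xL j * T f) + (U (xL j * f) - xL j * U f))" for j
    by (rule ext) (simp add: algebra_simps)
  show ?case using Suc by (simp add: eq)
qed simp

lemma ord_lt_uminus: "ord_lt n m T \<Longrightarrow> ord_lt n m (\<lambda>f. - T f)"
proof (induction m arbitrary: T)
  case (Suc m)
  have eq: "(\<lambda>f. - T (xL j * f) - xL j * (- T f)) = (\<lambda>f. - (T (xL j * f) - xL j * T f))" for j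
    by (rule ext) simp
  show ?case using Suc.IH Suc.prems unfolding ord_lt.simps eq by blast
qed simp

lemma add_op_comm: "add_op T \<Longrightarrow> add_op (\<lambda>f. T (xL j * f) - xL j * T f)"
  by (simp add: add_op_def algebra_simps)

lemma ord_lt_comp:
  "add_op T \<Longrightarrow> add_op U \<Longrightarrow> ord_lt n m T \<Longrightarrow> ord_lt n l U \<Longrightarrow> ord_lt n (m + l) (\<lambda>f. T (U f))"
proof (induction "m + l" arbitrary: m l T U)
  case 0
  then show ?case by simp
next
  case (Suc N)
  show ?case
  proof (cases "m = 0 \<or> l = 0")
    case True
    then have "\<forall>f. T (U f) = 0" using Suc.prems add_op_0[of T] by auto
    then have "ord_lt n 0 (\<lambda>f. T (U f))" by simp
    then show ?thesis by (rule ord_lt_mono) simp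
  next
    case False
    then obtain m' l' where ml: "m = Suc m'" "l = Suc l'"
      by (metis not0_implies_Suc)
    have "ord_lt n N (\<lambda>f. T (U (xL j * f)) - xL j * T (U f))" if j: "j < n" for j
    proof -
      let ?U = "\<lambda>f. U (xL j * f) - xL j * U f" and ?T = "\<lambda>f. T (xL j * f) - xL j * T f"
      have 1: "ord_lt n (m + l') (\<lambda>f. T (?U f))"
        by (rule Suc.hyps(1)) (use Suc.prems Suc.hyps(2) ml j in \<open>auto intro: add_op_comm\<close>)
      have 2: "ord_lt n (m' + l) (\<lambda>f. ?T (U f))"
        by (rule Suc.hyps(1)) (use Suc.prems Suc.hyps(2) ml j in \<open>auto intro: add_op_comm\<close>)
      have N: "m + l' = N" "m' + l = N" using Suc.hyps(2) ml by auto
      have eq: "(\<lambda>f. T (U (xL j * f)) - xL j * T (U f)) = (\<lambda>f. T (?U f) + ?T (U f))"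
        by (rule ext) (simp add: add_op_diff[OF Suc.prems(1)])
      show ?thesis unfolding eq using ord_lt_add 1 2 unfolding N by blast
    qed
    then have "ord_lt n (Suc N) (\<lambda>f. T (U f))" by simp
    then show ?thesis using Suc.hyps(2) by simp
  qed
qed

lemma xL_cancel: "xL j * g = 0 \<Longrightarrow> g = 0"
proof -
  assume "xL j * g = 0"
  then have "Poly_Mapping.single (- Poly_Mapping.single j 1) 1 * (xL j * g) = 0" by simp
  also have "Poly_Mapping.single (- Poly_Mapping.single j 1) 1 * (xL j * g) = g"
    by (simp add: xL_def mult.assoc[symmetric] mult_single)
  finally show "g = 0" .
qed

lemma vanish_on_emb:
  assumes T: "add_op T" and e: "\<And>p. p \<in> polys n \<Longrightarrow> T (emb p) = 0"
    and comm: "\<And>j f. j < n \<Longrightarrow> f \<in> laurents n \<Longrightarrow> T (xL j * f) = xL j * T f"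
    and f: "f \<in> laurents n"
  shows "T f = 0"
proof -
  have s: "T (Poly_Mapping.single a c) = 0" if "Poly_Mapping.keys a \<subseteq> {..<n}" for a :: "nat \<Rightarrow>\<^sub>0 int" and c
    using that
  proof (induction "\<Sum>j<n. nat (- Poly_Mapping.lookup a j)" arbitrary: a rule: less_induct)
    case less
    show ?case
    proof (cases "\<forall>j<n. Poly_Mapping.lookup a j \<ge> 0")
      case True
      have nn: "Poly_Mapping.lookup a j \<ge> 0" for j
        using True less.prems by (cases "Poly_Mapping.lookup a j = 0") (auto simp: in_keys_iff subset_iff)
      let ?b = "Poly_Mapping.map nat a"
      have "Poly_Mapping.keys ?b \<subseteq> Poly_Mapping.keys a"
        by (auto simp: in_keys_iff Poly_Mapping.map.rep_eq when_def)
      then have "Poly_Mapping.single ?b c \<in> polys n"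
        using less.prems by (auto simp: polys_def split: if_splits)
      moreover have "Poly_Mapping.map int ?b = a"
        by (rule poly_mapping_eqI)
           (use nn in \<open>auto simp: Poly_Mapping.map.rep_eq when_def intro: antisym\<close>)
      ultimately show ?thesis using e[of "Poly_Mapping.single ?b c"] by (simp add: emb_single)
    next
      case False
      then obtain j where j: "j < n" "Poly_Mapping.lookup a j < 0" by force
      let ?a = "Poly_Mapping.single j 1 + a"
      have lk: "Poly_Mapping.lookup ?a i = (if i = j then Poly_Mapping.lookup a i + 1 else Poly_Mapping.lookup a i)" for i
        by (auto simp: lookup_add lookup_single when_def)
      have k: "Poly_Mapping.keys ?a \<subseteq> {..<n}"
        using less.prems j by (auto simp: in_keys_iff lk subset_iff split: if_splits)
      have "(\<Sum>i<n. nat (- Poly_Mapping.lookup ?a i)) < (\<Sum>i<n. nat (- Poly_Mapping.lookup a i))"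
        by (rule sum_strict_mono_ex1) (use j in \<open>auto simp: lk intro!: bexI[of _ j]\<close>)
      then have "T (Poly_Mapping.single ?a c) = 0" using less.hyps k by blast
      moreover have "Poly_Mapping.single ?a c = xL j * Poly_Mapping.single a c"
        by (simp add: xL_def mult_single)
      moreover have "Poly_Mapping.single a c \<in> laurents n"
        using less.prems by (auto simp: laurents_def split: if_splits)
      ultimately have "xL j * T (Poly_Mapping.single a c) = 0"
        using comm j(1) by metis
      then show ?thesis by (rule xL_cancel)
    qed
  qed
  show ?thesis
    by (rule additive_eqI[of T "\<lambda>_. 0"]) (use f s in \<open>auto simp: add_opD[OF T] laurents_def\<close>)
qed

lemma x_polys: "j < n \<Longrightarrow> Poly_Mapping.single (Poly_Mapping.single j 1) 1 \<in> polys n"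
  by (auto simp: polys_def)

lemma rigidity:
  assumes "add_op T" "ord_lt n m T" "\<And>p. p \<in> polys n \<Longrightarrow> T (emb p) = 0" "f \<in> laurents n"
  shows "T f = 0"
  using assms
proof (induction m arbitrary: T f)
  case (Suc m)
  have "T (xL j * g) - xL j * T g = 0" if j: "j < n" and g: "g \<in> laurents n" for j g
  proof (rule Suc.IH[of "\<lambda>g. T (xL j * g) - xL j * T g"])
    show "add_op (\<lambda>g. T (xL j * g) - xL j * T g)" using Suc.prems(1) by (rule add_op_comm)
    show "ord_lt n m (\<lambda>g. T (xL j * g) - xL j * T g)" using Suc.prems(2) j by simp
    show "T (xL j * emb p) - xL j * T (emb p) = 0" if "p \<in> polys n" for p
      unfolding emb_x[symmetric]
      using Suc.prems(3)[OF polys_mult[OF x_polys[OF j] that]] Suc.prems(3)[OF that] by simp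
  qed (rule g)
  then show ?case using vanish_on_emb[OF Suc.prems(1,3) _ Suc.prems(4)] by simp
qed simp

subsection \<open>The graph of the action\<close>

definition extends :: "nat \<Rightarrow> 'k::field operator \<Rightarrow> ('k laurent \<Rightarrow> 'k laurent) \<Rightarrow> bool" where
  "extends n P Q \<longleftrightarrow> (\<exists>T. add_op T \<and> (\<exists>m. ord_lt n m T) \<and>
     (\<forall>p\<in>polys n. emb (P p) = T (emb p)) \<and>
     (\<forall>f\<in>laurents n. T f \<in> laurents n \<and> Q (trunc n f) = trunc n (T f)))"

lemma extends_zero:
  assumes "extends n P Q" "\<And>p. p \<in> polys n \<Longrightarrow> P p = 0" "e \<in> inv_polys n"
  shows "Q e = 0"
proof -
  obtain T m where T: "add_op T" "ord_lt n m T" "\<forall>p\<in>polys n. emb (P p) = T (emb p)"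
     "\<forall>f\<in>laurents n. T f \<in> laurents n \<and> Q (trunc n f) = trunc n (T f)"
    using assms(1) unfolding extends_def by blast
  have "T e = 0"
    by (rule rigidity[OF T(1,2)]) (use T(3) assms in \<open>auto simp: inv_polys_laurents\<close>)
  moreover have "Q (trunc n e) = trunc n (T e)" using T(4) inv_polys_laurents[OF assms(3)] by blast
  ultimately show ?thesis by (simp add: trunc_id[OF assms(3)])
qed

lemma extends_const: "extends n (const_op n c) (inv_const n c)"
proof -
  let ?T = "scale c :: 'a laurent \<Rightarrow> 'a laurent"
  have 1: "add_op ?T" by (simp add: add_op_def scale_simps)
  have "xL j * scale c f = scale c (xL j * f)" for j f
    by (simp add: scale_conv_mult mult_ac)
  then have 2: "ord_lt n 1 ?T" by simp
  have 3: "emb (const_op n c p) = ?T (emb p)" if "p \<in> polys n" for p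
    using that by (simp add: const_op_def mult_op_def scale_conv_mult[symmetric] emb_scale)
  have 4: "?T f \<in> laurents n" if "f \<in> laurents n" for f
    using that by (rule laurents_closed)
  have 5: "inv_const n c (trunc n f) = trunc n (?T f)" for f
    using trunc_in[of n f] by (simp add: inv_const_def trunc_eq msum_scale)
  show ?thesis unfolding extends_def using 1 2 3 4 5 by blast
qed

lemma trunc_x: "j < n \<Longrightarrow> f \<in> laurents n \<Longrightarrow> trunc n (xL j * trunc n f) = trunc n (xL j * f)"
proof (rule additive_eqI[of "\<lambda>f. trunc n (xL j * trunc n f)" "\<lambda>f. trunc n (xL j * f)"])
  fix a and c :: 'a
  assume j: "j < n" and "f \<in> laurents n" "a \<in> Poly_Mapping.keys f"
  then have a: "Poly_Mapping.keys a \<subseteq> {..<n}" by (auto simp: laurents_def)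
  have "Poly_Mapping.single j 1 + a \<notin> inv_exps n" if na: "a \<notin> inv_exps n"
  proof -
    obtain i where i: "i < n" "Poly_Mapping.lookup a i \<ge> 0"
      using na a unfolding inv_exps_def by force
    have "Poly_Mapping.lookup (Poly_Mapping.single j 1 + a) i \<ge> 0"
      using i(2) by (simp add: lookup_add lookup_single when_def)
    then show ?thesis using i(1) unfolding inv_exps_def by force
  qed
  then show "trunc n (xL j * trunc n (Poly_Mapping.single a c)) = trunc n (xL j * Poly_Mapping.single a c)"
    by (simp add: trunc_single xL_def mult_single)
qed (simp_all add: trunc_add distrib_left)

lemma trunc_d: "j < n \<Longrightarrow> f \<in> laurents n \<Longrightarrow> dL j (trunc n f) = trunc n (dL j f)"
proof (rule additive_eqI[of "\<lambda>f. dL j (trunc n f)" "\<lambda>f. trunc n (dL j f)"])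
  fix a and c :: 'a
  assume j: "j < n" and "f \<in> laurents n" "a \<in> Poly_Mapping.keys f"
  then have a: "Poly_Mapping.keys a \<subseteq> {..<n}" by (auto simp: laurents_def)
  show "dL j (trunc n (Poly_Mapping.single a c)) = trunc n (dL j (Poly_Mapping.single a c))"
  proof (cases "a \<in> inv_exps n")
    case True
    then have "Poly_Mapping.single a c \<in> inv_polys n" by (auto simp: inv_polys_def)
    then show ?thesis by (simp add: trunc_id inv_polys_d j)
  next
    case False
    then obtain i where i: "i < n" "Poly_Mapping.lookup a i \<ge> 0"
      using a unfolding inv_exps_def by force
    have "a - Poly_Mapping.single j 1 \<notin> inv_exps n" if nz: "Poly_Mapping.lookup a j \<noteq> 0"
    proof -
      have "Poly_Mapping.lookup (a - Poly_Mapping.single j 1) i \<ge> 0"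
        using i(2) nz by (auto simp: lookup_minus lookup_single when_def)
      then show ?thesis using i(1) unfolding inv_exps_def by force
    qed
    then show ?thesis using False
      by (cases "Poly_Mapping.lookup a j = 0") (auto simp: trunc_single dL_def msum_single)
  qed
qed (simp_all add: trunc_add dL_def msum_add)

lemma xL_laurents: "j < n \<Longrightarrow> xL j \<in> laurents n"
  by (auto simp: xL_def laurents_def)

lemma extends_var: "j < n \<Longrightarrow> extends n (var_op n j) (inv_var n j)"
proof -
  assume j: "j < n"
  let ?T = "(*) (xL j) :: 'a laurent \<Rightarrow> 'a laurent"
  have 1: "add_op ?T" by (simp add: add_op_def distrib_left)
  have 2: "ord_lt n 1 ?T" by (simp add: mult.left_commute)
  have 3: "emb (var_op n j p) = ?T (emb p)" if "p \<in> polys n" for p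
    using that by (simp add: var_op_def mult_op_def emb_x[simplified])
  have 4: "?T f \<in> laurents n" if "f \<in> laurents n" for f
    using that xL_laurents[OF j] by (rule laurents_mult[rotated])
  have 5: "inv_var n j (trunc n f) = trunc n (?T f)" if "f \<in> laurents n" for f
    using trunc_in[of n f] trunc_x[OF j that] by (simp add: inv_var_eq)
  show ?thesis unfolding extends_def using 1 2 3 4 5 by blast
qed

lemma extends_partial: "j < n \<Longrightarrow> extends n (partial_op n j) (inv_partial n j)"
proof -
  assume j: "j < n"
  let ?T = "dL j :: 'a laurent \<Rightarrow> 'a laurent"
  have 1: "add_op ?T" by (simp add: add_op_def dL_def msum_add)
  have 2: "ord_lt n 2 ?T" by (simp add: numeral_2_eq_2 dL_leibniz_x)
  have 3: "emb (partial_op n j p) = ?T (emb p)" if "p \<in> polys n" for p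
    using that by (simp add: partial_op_eq emb_d)
  have 5: "inv_partial n j (trunc n f) = trunc n (?T f)" if "f \<in> laurents n" for f
    using trunc_in[of n f] trunc_d[OF j that] by (simp add: inv_partial_eq)
  show ?thesis unfolding extends_def using 1 2 3 laurents_d 5 by blast
qed

lemma extends_one: "extends n (\<lambda>p\<in>polys n. p) (\<lambda>e\<in>inv_polys n. e)"
proof -
  have "add_op (\<lambda>f. f :: 'a laurent)" "ord_lt n 1 (\<lambda>f. f :: 'a laurent)"
    by (simp_all add: add_op_def)
  then show ?thesis unfolding extends_def using trunc_in
    by (intro exI[of _ "\<lambda>f. f"] conjI exI[of _ 1]) auto
qed

lemma extends_add:
  assumes "extends n P Q" "extends n P' Q'"
  shows "extends n (\<lambda>p\<in>polys n. P p + P' p) (\<lambda>e\<in>inv_polys n. Q e + Q' e)"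
proof -
  obtain T m where T: "add_op T" "ord_lt n m T" "\<And>p. p\<in>polys n \<Longrightarrow> emb (P p) = T (emb p)"
     "\<And>f. f\<in>laurents n \<Longrightarrow> T f \<in> laurents n" "\<And>f. f\<in>laurents n \<Longrightarrow> Q (trunc n f) = trunc n (T f)"
    using assms(1) unfolding extends_def by blast
  obtain T' m' where T': "add_op T'" "ord_lt n m' T'" "\<And>p. p\<in>polys n \<Longrightarrow> emb (P' p) = T' (emb p)"
     "\<And>f. f\<in>laurents n \<Longrightarrow> T' f \<in> laurents n" "\<And>f. f\<in>laurents n \<Longrightarrow> Q' (trunc n f) = trunc n (T' f)"
    using assms(2) unfolding extends_def by blast
  have "ord_lt n (max m m') (\<lambda>f. T f + T' f)"
    by (intro ord_lt_add) (rule ord_lt_mono, rule T T', simp)+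
  moreover have "add_op (\<lambda>f. T f + T' f)"
    using T(1) T'(1) by (simp add: add_op_def algebra_simps)
  ultimately show ?thesis unfolding extends_def
    using T(3-) T'(3-)
    by (intro exI[of _ "\<lambda>f. T f + T' f"] conjI exI[of _ "max m m'"])
       (simp_all add: emb_add trunc_add laurents_closed trunc_in)
qed

lemma extends_comp:
  assumes "extends n P Q" "extends n P' Q'" "P' \<in> polys n \<rightarrow> polys n"
  shows "extends n (compose (polys n) P P') (compose (inv_polys n) Q Q')"
proof -
  obtain T m where T: "add_op T" "ord_lt n m T" "\<And>p. p\<in>polys n \<Longrightarrow> emb (P p) = T (emb p)"
     "\<And>f. f\<in>laurents n \<Longrightarrow> T f \<in> laurents n" "\<And>f. f\<in>laurents n \<Longrightarrow> Q (trunc n f) = trunc n (T f)"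
    using assms(1) unfolding extends_def by blast
  obtain T' m' where T': "add_op T'" "ord_lt n m' T'" "\<And>p. p\<in>polys n \<Longrightarrow> emb (P' p) = T' (emb p)"
     "\<And>f. f\<in>laurents n \<Longrightarrow> T' f \<in> laurents n" "\<And>f. f\<in>laurents n \<Longrightarrow> Q' (trunc n f) = trunc n (T' f)"
    using assms(2) unfolding extends_def by blast
  have "add_op (\<lambda>f. T (T' f))"
    using T(1) T'(1) by (simp add: add_op_def)
  then show ?thesis unfolding extends_def
    using T(3-) T'(3-) assms(3) ord_lt_comp[OF T(1) T'(1) T(2) T'(2)]
    by (intro exI[of _ "\<lambda>f. T (T' f)"] conjI exI[of _ "m + m'"])
       (simp_all add: compose_def Pi_iff trunc_in)
qed

lemma extends_uminus:
  assumes "extends n P Q" "\<And>p. p \<in> polys n \<Longrightarrow> P' p = - P p" "\<And>e. e \<in> inv_polys n \<Longrightarrow> Q' e = - Q e"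
  shows "extends n P' Q'"
proof -
  obtain T m where T: "add_op T" "ord_lt n m T" "\<And>p. p\<in>polys n \<Longrightarrow> emb (P p) = T (emb p)"
     "\<And>f. f\<in>laurents n \<Longrightarrow> T f \<in> laurents n" "\<And>f. f\<in>laurents n \<Longrightarrow> Q (trunc n f) = trunc n (T f)"
    using assms(1) unfolding extends_def by blast
  have e: "emb (- p) = - emb p" for p :: "'a mpoly" by (metis emb_scale scale_simps(3))
  have t: "trunc n (- f) = - trunc n f" for f :: "'a laurent"
    unfolding scale_simps(3)[symmetric] trunc_eq by (rule msum_scale)
  have "add_op (\<lambda>f. - T f)" using T(1) by (simp add: add_op_def)
  then show ?thesis unfolding extends_def
    using T(3-) assms(2,3) ord_lt_uminus[OF T(2)]
    by (intro exI[of _ "\<lambda>f. - T f"] conjI exI[of _ m]) (simp_all add: e t laurents_closed trunc_in)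
qed

lemma RDirProd_simps:
  "carrier (RDirProd A B) = carrier A \<times> carrier B"
  "x \<otimes>\<^bsub>RDirProd A B\<^esub> y = (fst x \<otimes>\<^bsub>A\<^esub> fst y, snd x \<otimes>\<^bsub>B\<^esub> snd y)"
  "x \<oplus>\<^bsub>RDirProd A B\<^esub> y = (fst x \<oplus>\<^bsub>A\<^esub> fst y, snd x \<oplus>\<^bsub>B\<^esub> snd y)"
  "\<one>\<^bsub>RDirProd A B\<^esub> = (\<one>\<^bsub>A\<^esub>, \<one>\<^bsub>B\<^esub>)"
  "\<zero>\<^bsub>RDirProd A B\<^esub> = (\<zero>\<^bsub>A\<^esub>, \<zero>\<^bsub>B\<^esub>)"
  by (simp_all add: RDirProd_def DirProd_def monoid.defs split: prod.split)

lemmas ring_polys = End_k_ring[OF k_subspace_polys]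
lemmas ring_inv = End_k_ring[OF k_subspace_inv_polys]
lemmas ring_prod = RDirProd_ring[OF ring_polys ring_inv]

lemma End_k_closed: "P \<in> carrier (End_k S) \<Longrightarrow> p \<in> S \<Longrightarrow> P p \<in> S"
  by (auto simp: End_k_simps)

lemma End_k_ext: "P \<in> carrier (End_k S) \<Longrightarrow> Q \<in> carrier (End_k S) \<Longrightarrow> (\<And>p. p \<in> S \<Longrightarrow> P p = Q p) \<Longrightarrow> P = Q"
  by (auto simp: End_k_simps intro: PiE_ext)

lemma End_k_uminus:
  assumes "k_subspace S" "P \<in> carrier (End_k S)" "p \<in> S"
  shows "(\<ominus>\<^bsub>End_k S\<^esub> P) p = - P p"
proof -
  interpret E: ring "End_k S" by (rule End_k_ring[OF assms(1)])
  have "P \<oplus>\<^bsub>End_k S\<^esub> (\<ominus>\<^bsub>End_k S\<^esub> P) = \<zero>\<^bsub>End_k S\<^esub>" using assms(2) by (rule E.r_neg)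
  then have "(P \<oplus>\<^bsub>End_k S\<^esub> (\<ominus>\<^bsub>End_k S\<^esub> P)) p = \<zero>\<^bsub>End_k S\<^esub> p" by simp
  then have "P p + (\<ominus>\<^bsub>End_k S\<^esub> P) p = 0" using assms(3) by (simp add: End_k_simps)
  then show ?thesis by (simp add: eq_neg_iff_add_eq_0 add.commute)
qed

lemma RDirProd_uminus:
  assumes "ring A" "ring B" "x \<in> carrier A" "y \<in> carrier B"
  shows "\<ominus>\<^bsub>RDirProd A B\<^esub> (x, y) = (\<ominus>\<^bsub>A\<^esub> x, \<ominus>\<^bsub>B\<^esub> y)"
proof -
  interpret A: ring A by fact
  interpret B: ring B by fact
  interpret P: ring "RDirProd A B" by (rule RDirProd_ring) fact+
  show ?thesis
    by (rule P.minus_equality) (use assms in \<open>auto simp: RDirProd_simps A.l_neg B.l_neg\<close>)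
qed

lemma polys_closed:
  "p \<in> polys n \<Longrightarrow> scale c p \<in> polys n"
  "p \<in> polys n \<Longrightarrow> q \<in> polys n \<Longrightarrow> p + q \<in> polys n"
  using k_subspace_polys[of n, where ?'a = 'a] by (simp_all add: k_subspace_def)

lemma inv_polys_closed:
  fixes e f :: "'a::field laurent"
  shows "0 \<in> (inv_polys n :: 'a laurent set)"
  "e \<in> inv_polys n \<Longrightarrow> scale c e \<in> inv_polys n"
  "e \<in> inv_polys n \<Longrightarrow> f \<in> inv_polys n \<Longrightarrow> e + f \<in> inv_polys n"
  "e \<in> inv_polys n \<Longrightarrow> - e \<in> inv_polys n"
  using k_subspace_inv_polys[of n, where ?'a = 'a] k_subspace_minus[OF k_subspace_inv_polys[of n, where ?'a = 'a]]
  by (simp_all add: k_subspace_def)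

lemma mult_scale: "r * scale c p = scale c (r * (p :: 'a::comm_monoid_add \<Rightarrow>\<^sub>0 'k::field))"
  by (simp add: scale_conv_mult mult_ac)

lemma scale_scale: "scale c (scale d p) = scale d (scale c p)"
  by (rule poly_mapping_eqI) simp

lemma dP_linear: "dP j (p + q) = dP j p + dP j q" "dP j (scale c p) = scale c (dP j p)"
  by (simp_all add: dP_def msum_add msum_scale)

lemma dL_linear: "dL j (p + q) = dL j p + dL j q" "dL j (scale c p) = scale c (dL j p)"
  by (simp_all add: dL_def msum_add msum_scale)

lemma trunc_scale: "trunc n (scale c f) = scale c (trunc n f)"
  by (simp add: trunc_eq msum_scale)

lemma mult_op_carrier: "r \<in> polys n \<Longrightarrow> mult_op n r \<in> carrier (End_k (polys n))"
  by (simp add: End_k_simps mult_op_def polys_mult distrib_left mult_scale polys_closed)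

lemma partial_op_carrier: "partial_op n j \<in> carrier (End_k (polys n))"
  by (simp add: End_k_simps partial_op_eq polys_d dP_linear polys_closed)

lemma inv_const_carrier: "inv_const n c \<in> carrier (End_k (inv_polys n))"
  by (simp add: End_k_simps inv_const_def scale_simps scale_scale[of c] inv_polys_closed)

lemma inv_var_carrier: "inv_var n j \<in> carrier (End_k (inv_polys n))"
  by (simp add: End_k_simps inv_var_eq trunc_in distrib_left trunc_add mult_scale trunc_scale inv_polys_closed)

lemma inv_partial_carrier: "j < n \<Longrightarrow> inv_partial n j \<in> carrier (End_k (inv_polys n))"
  by (simp add: End_k_simps inv_partial_eq inv_polys_d dL_linear inv_polys_closed)

lemma const_polys: "Poly_Mapping.single 0 c \<in> polys n"
  by (auto simp: polys_def)

abbreviation E_gens :: "nat \<Rightarrow> ('k::field operator \<times> ('k laurent \<Rightarrow> 'k laurent)) set" where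
  "E_gens n \<equiv> range (\<lambda>c. (const_op n c, inv_const n c)) \<union>
      (\<lambda>j. (var_op n j, inv_var n j)) ` {..<n} \<union>
      (\<lambda>j. (partial_op n j, inv_partial n j)) ` {..<n}"

lemma E_gens_carrier:
  "E_gens n \<subseteq> carrier (RDirProd (End_k (polys n)) (End_k (inv_polys n)))"
  by (auto simp: RDirProd_simps const_op_def var_op_def intro!: mult_op_carrier const_polys x_polys[simplified]
      inv_const_carrier inv_var_carrier inv_partial_carrier partial_op_carrier)

lemma E_graph_carrier:
  "(P, Q) \<in> E_graph n \<Longrightarrow> P \<in> carrier (End_k (polys n)) \<and> Q \<in> carrier (End_k (inv_polys n))"
  using ring.generate_ring_in_carrier[OF ring_prod E_gens_carrier]
  unfolding E_graph_def by (fastforce simp: RDirProd_simps)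

lemma E_graph_extends:
  assumes "(P, Q) \<in> E_graph n"
  shows "extends n P Q"
proof -
  let ?R = "RDirProd (End_k (polys n)) (End_k (inv_polys n)) :: ('a operator \<times> ('a laurent \<Rightarrow> 'a laurent)) ring"
  have "z \<in> carrier ?R \<and> extends n (fst z) (snd z)" if "z \<in> generate_ring ?R (E_gens n)" for z
    using that
  proof (induction rule: generate_ring.induct)
    case one
    show ?case using extends_one[of n, folded End_k_simps(3)]
      by (simp add: RDirProd_simps ring.ring_simprules(6)[OF ring_polys] ring.ring_simprules(6)[OF ring_inv])
  next
    case (incl h)
    then have "extends n (fst h) (snd h)"
      by (elim UnE imageE) (simp_all add: extends_const extends_var extends_partial)
    then show ?case using subsetD[OF E_gens_carrier incl] by blast
  next
    case (a_inv h)
    then have c: "fst h \<in> carrier (End_k (polys n))" "snd h \<in> carrier (End_k (inv_polys n))"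
      by (auto simp: RDirProd_simps)
    have "\<ominus>\<^bsub>?R\<^esub> h = (\<ominus>\<^bsub>End_k (polys n)\<^esub> fst h, \<ominus>\<^bsub>End_k (inv_polys n)\<^esub> snd h)"
      using RDirProd_uminus[OF ring_polys ring_inv c] by simp
    moreover have "extends n (\<ominus>\<^bsub>End_k (polys n)\<^esub> fst h) (\<ominus>\<^bsub>End_k (inv_polys n)\<^esub> snd h)"
      by (rule extends_uminus[OF _ End_k_uminus[OF k_subspace_polys c(1)]
            End_k_uminus[OF k_subspace_inv_polys c(2)]]) (use a_inv.IH in blast)
    moreover have "\<ominus>\<^bsub>?R\<^esub> h \<in> carrier ?R"
      using a_inv.IH ring.ring_simprules(3)[OF ring_prod] by blast
    ultimately show ?case by (simp only: fst_conv snd_conv)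
  next
    case (eng_add h1 h2)
    then show ?case using extends_add[of n "fst h1" "snd h1" "fst h2" "snd h2", folded End_k_simps(5)]
      by (auto simp: RDirProd_simps intro: ring.ring_simprules(1)[OF ring_polys] ring.ring_simprules(1)[OF ring_inv])
  next
    case (eng_mult h1 h2)
    then have "fst h2 \<in> polys n \<rightarrow> polys n" by (auto simp: RDirProd_simps End_k_simps)
    then show ?case
      using eng_mult extends_comp[of n "fst h1" "snd h1" "fst h2" "snd h2", folded End_k_simps(2)]
      by (auto simp: RDirProd_simps intro: ring.ring_simprules(5)[OF ring_polys] ring.ring_simprules(5)[OF ring_inv])
  qed
  from this[OF assms[unfolded E_graph_def]] show ?thesis by simp
qed

lemma E_graph_ops:
  assumes "(P, Q) \<in> E_graph n" "(P', Q') \<in> E_graph n"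
  shows "(P \<oplus>\<^bsub>End_k (polys n)\<^esub> P', Q \<oplus>\<^bsub>End_k (inv_polys n)\<^esub> Q') \<in> E_graph n"
    "(P \<otimes>\<^bsub>End_k (polys n)\<^esub> P', Q \<otimes>\<^bsub>End_k (inv_polys n)\<^esub> Q') \<in> E_graph n"
    "(\<ominus>\<^bsub>End_k (polys n)\<^esub> P, \<ominus>\<^bsub>End_k (inv_polys n)\<^esub> Q) \<in> E_graph n"
  using generate_ring.eng_add[OF assms[unfolded E_graph_def]]
    generate_ring.eng_mult[OF assms[unfolded E_graph_def]]
    generate_ring.a_inv[OF assms(1)[unfolded E_graph_def]]
    RDirProd_uminus[OF ring_polys ring_inv conjunct1[OF E_graph_carrier[OF assms(1)]]
      conjunct2[OF E_graph_carrier[OF assms(1)]]]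
  unfolding E_graph_def by (simp_all add: RDirProd_simps)

lemma E_graph_one: "(\<one>\<^bsub>End_k (polys n)\<^esub>, \<one>\<^bsub>End_k (inv_polys n)\<^esub>) \<in> E_graph n"
  using generate_ring.one[of "RDirProd (End_k (polys n)) (End_k (inv_polys n))" "E_gens n"]
  unfolding E_graph_def by (simp add: RDirProd_simps)

lemma E_graph_unique:
  assumes "(P, Q) \<in> E_graph n" "(P, Q') \<in> E_graph n"
  shows "Q = Q'"
proof -
  let ?A = "End_k (polys n) :: 'a operator ring" and ?B = "End_k (inv_polys n) :: ('a laurent \<Rightarrow> 'a laurent) ring"
  note c = E_graph_carrier[OF assms(1)] E_graph_carrier[OF assms(2)]
  have "(P \<oplus>\<^bsub>?A\<^esub> \<ominus>\<^bsub>?A\<^esub> P, Q \<oplus>\<^bsub>?B\<^esub> \<ominus>\<^bsub>?B\<^esub> Q') \<in> E_graph n"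
    by (rule E_graph_ops(1)[OF assms(1) E_graph_ops(3)[OF assms(2) assms(2)]])
  then have "extends n (P \<oplus>\<^bsub>?A\<^esub> \<ominus>\<^bsub>?A\<^esub> P) (Q \<oplus>\<^bsub>?B\<^esub> \<ominus>\<^bsub>?B\<^esub> Q')" by (rule E_graph_extends)
  then have "(Q \<oplus>\<^bsub>?B\<^esub> \<ominus>\<^bsub>?B\<^esub> Q') e = 0" if "e \<in> inv_polys n" for e
    by (rule extends_zero)
       (use that c in \<open>simp_all add: End_k_simps(5) End_k_uminus k_subspace_polys\<close>)
  then have "Q e = Q' e" if "e \<in> inv_polys n" for e
    using that c by (simp add: End_k_simps(5) End_k_uminus k_subspace_inv_polys)
  then show ?thesis using c by (intro End_k_ext[of Q _ Q']) auto
qed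

lemma E_graph_gens:
  "(const_op n c, inv_const n c) \<in> E_graph n"
  "j < n \<Longrightarrow> (var_op n j, inv_var n j) \<in> E_graph n"
  "j < n \<Longrightarrow> (partial_op n j, inv_partial n j) \<in> E_graph n"
  unfolding E_graph_def by (rule generate_ring.incl, blast)+

lemma mult_op_mult:
  "r \<in> polys n \<Longrightarrow> s \<in> polys n \<Longrightarrow> mult_op n (r * s) = mult_op n r \<otimes>\<^bsub>End_k (polys n)\<^esub> mult_op n s"
  by (auto simp: mult_op_def End_k_simps compose_def polys_mult mult.assoc intro!: restrict_ext)

lemma mult_op_add: "mult_op n (r + s) = mult_op n r \<oplus>\<^bsub>End_k (polys n)\<^esub> mult_op n s"
  by (auto simp: mult_op_def End_k_simps distrib_right intro!: restrict_ext)

lemma E_graph_monomial: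
  "Poly_Mapping.keys a \<subseteq> {..<n} \<Longrightarrow> \<exists>Q. (mult_op n (Poly_Mapping.single a c), Q) \<in> E_graph n"
proof (induction "\<Sum>j<n. Poly_Mapping.lookup a j" arbitrary: a rule: less_induct)
  case less
  show ?case
  proof (cases "a = 0")
    case True
    then show ?thesis using E_graph_gens(1)[of n c] by (auto simp: const_op_def)
  next
    case False
    then obtain j where j: "j \<in> Poly_Mapping.keys a" by (metis all_not_in_conv keys_eq_empty)
    then have jn: "j < n" using less.prems by blast
    have nz: "Poly_Mapping.lookup a j \<noteq> 0" using j by (simp add: in_keys_iff)
    define b where "b = a - Poly_Mapping.single j 1"
    have lb: "Poly_Mapping.lookup b i = (if i = j then Poly_Mapping.lookup a i - 1 else Poly_Mapping.lookup a i)" for i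
      by (auto simp: b_def lookup_minus lookup_single when_def)
    have "(\<Sum>i<n. Poly_Mapping.lookup b i) < (\<Sum>i<n. Poly_Mapping.lookup a i)"
      by (rule sum_strict_mono_ex1) (use jn nz in \<open>auto simp: lb intro!: bexI[of _ j]\<close>)
    moreover have kb: "Poly_Mapping.keys b \<subseteq> {..<n}"
      unfolding b_def by (rule order_trans[OF keys_nat_minus less.prems])
    ultimately obtain Q where Q: "(mult_op n (Poly_Mapping.single b c), Q) \<in> E_graph n"
      using less.hyps by blast
    have "a = Poly_Mapping.single j 1 + b"
      by (rule poly_mapping_eqI) (use nz in \<open>auto simp: lookup_add lb lookup_single when_def\<close>)
    then have "Poly_Mapping.single a c = Poly_Mapping.single (Poly_Mapping.single j 1) 1 * Poly_Mapping.single b c"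
      by (metis mult_single mult_1)
    moreover have "Poly_Mapping.single b c \<in> polys n" using kb by (auto simp: polys_def split: if_splits)
    ultimately have "mult_op n (Poly_Mapping.single a c) =
        var_op n j \<otimes>\<^bsub>End_k (polys n)\<^esub> mult_op n (Poly_Mapping.single b c)"
      unfolding var_op_def using mult_op_mult[OF x_polys[OF jn]] by metis
    then show ?thesis using E_graph_ops(2)[OF E_graph_gens(2)[OF jn] Q] by metis
  qed
qed

lemma E_graph_mult_op:
  assumes r: "r \<in> polys n"
  shows "\<exists>Q. (mult_op n r, Q) \<in> E_graph n"
proof -
  have "\<exists>Q. (mult_op n (\<Sum>a\<in>A. Poly_Mapping.single a (Poly_Mapping.lookup r a)), Q) \<in> E_graph n"
    if "finite A" "A \<subseteq> Poly_Mapping.keys r" for A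
    using that
  proof (induction A rule: finite_induct)
    case empty
    then show ?case using E_graph_gens(1)[of n "0::'a"] by (auto simp: const_op_def)
  next
    case (insert a A)
    then obtain Q where Q: "(mult_op n (\<Sum>a\<in>A. Poly_Mapping.single a (Poly_Mapping.lookup r a)), Q) \<in> E_graph n"
      by auto
    have "Poly_Mapping.keys a \<subseteq> {..<n}" using insert.prems r by (auto simp: polys_def)
    then obtain Q' where "(mult_op n (Poly_Mapping.single a (Poly_Mapping.lookup r a)), Q') \<in> E_graph n"
      using E_graph_monomial by blast
    from E_graph_ops(1)[OF this Q] show ?case
      using insert.hyps by (auto simp: mult_op_add)
  qed
  from this[OF finite_keys subset_refl] show ?thesis
    using sum_singles[of r] by simp
qed

lemma diff_ops_simps:
  "P \<otimes>\<^bsub>diff_ops n\<^esub> Q = P \<otimes>\<^bsub>End_k (polys n)\<^esub> Q"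
  "P \<oplus>\<^bsub>diff_ops n\<^esub> Q = P \<oplus>\<^bsub>End_k (polys n)\<^esub> Q"
  "\<one>\<^bsub>diff_ops n\<^esub> = \<one>\<^bsub>End_k (polys n)\<^esub>"
  "\<zero>\<^bsub>diff_ops n\<^esub> = \<zero>\<^bsub>End_k (polys n)\<^esub>"
  by (simp_all add: diff_ops_def)

lemma diff_ops_ring: "ring (diff_ops n)"
  unfolding diff_ops_def
  by (rule ring.generate_ring_is_ring[OF ring_polys]) (auto intro: mult_op_carrier partial_op_carrier)

lemma E_graph_ex:
  assumes "P \<in> carrier (diff_ops n)"
  shows "\<exists>Q. (P, Q) \<in> E_graph n"
proof -
  have "P \<in> generate_ring (End_k (polys n)) (mult_op n ` polys n \<union> partial_op n ` {..<n})"
    using assms by (simp add: diff_ops_def)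
  then show ?thesis
  proof (induction rule: generate_ring.induct)
    case one
    then show ?case using E_graph_one by blast
  next
    case (incl h)
    then show ?case using E_graph_mult_op E_graph_gens(3) by blast
  next
    case (a_inv h)
    then show ?case using E_graph_ops(3) by blast
  next
    case (eng_add h1 h2)
    then show ?case using E_graph_ops(1) by blast
  next
    case (eng_mult h1 h2)
    then show ?case using E_graph_ops(2) by blast
  qed
qed

lemma E_graph_ex1:
  assumes "P \<in> carrier (diff_ops n)"
  shows "\<exists>!Q. (P, Q) \<in> E_graph n"
  using E_graph_ex[OF assms] E_graph_unique by blast

lemma E_mod_smult: "(P, Q) \<in> E_graph n \<Longrightarrow> P \<odot>\<^bsub>E_mod n\<^esub> e = Q e"
proof -
  assume PQ: "(P, Q) \<in> E_graph n"
  then have "(THE Q. (P, Q) \<in> E_graph n) = Q" using E_graph_unique by (intro the_equality) blast+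
  then show ?thesis by (simp add: E_mod_def)
qed

lemma E_mod_const: "e \<in> inv_polys n \<Longrightarrow> const_op n c \<odot>\<^bsub>E_mod n\<^esub> e = scale c e"
  by (subst E_mod_smult[OF E_graph_gens(1)]) (simp add: inv_const_def)

lemma E_mod_var: "j < n \<Longrightarrow> var_op n j \<odot>\<^bsub>E_mod n\<^esub> e = inv_var n j e"
  by (rule E_mod_smult[OF E_graph_gens(2)])

lemma E_mod_partial: "j < n \<Longrightarrow> partial_op n j \<odot>\<^bsub>E_mod n\<^esub> e = inv_partial n j e"
  by (rule E_mod_smult[OF E_graph_gens(3)])

lemma E_mod_left_module: "left_module (diff_ops n) (E_mod n)"
proof -
  interpret D: ring "diff_ops n" by (rule diff_ops_ring)
  have "abelian_group (E_mod n :: ('a operator, 'a laurent) module)"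
  proof (rule abelian_groupI)
    fix x :: "'a laurent" assume "x \<in> carrier (E_mod n)"
    then show "\<exists>y\<in>carrier (E_mod n). y \<oplus>\<^bsub>E_mod n\<^esub> x = \<zero>\<^bsub>E_mod n\<^esub>"
      by (intro bexI[of _ "- x"]) (simp_all add: E_mod_def inv_polys_closed)
  qed (simp_all add: E_mod_def inv_polys_closed add_ac)
  then interpret M: abelian_group "E_mod n :: ('a operator, 'a laurent) module" .
  have EM: "carrier (E_mod n) = inv_polys n" "x \<oplus>\<^bsub>E_mod n\<^esub> y = x + y" for x y :: "'a laurent"
    by (simp_all add: E_mod_def)
  show ?thesis
  proof unfold_locales
    fix a :: "'a operator" and x :: "'a laurent" assume a: "a \<in> carrier (diff_ops n)" and x: "x \<in> carrier (E_mod n)"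
    obtain Q where Q: "(a, Q) \<in> E_graph n" using E_graph_ex[OF a] by blast
    note Qc = conjunct2[OF E_graph_carrier[OF Q]]
    show "a \<odot>\<^bsub>E_mod n\<^esub> x \<in> carrier (E_mod n)"
      using End_k_closed[OF Qc] x by (simp add: E_mod_smult[OF Q] EM)
    show "a \<odot>\<^bsub>E_mod n\<^esub> (x \<oplus>\<^bsub>E_mod n\<^esub> y) = a \<odot>\<^bsub>E_mod n\<^esub> x \<oplus>\<^bsub>E_mod n\<^esub> a \<odot>\<^bsub>E_mod n\<^esub> y"
      if y: "y \<in> carrier (E_mod n)" for y
      using Qc x y by (simp add: E_mod_smult[OF Q] EM End_k_simps(1))
    fix b :: "'a operator" assume b: "b \<in> carrier (diff_ops n)"
    obtain Q' where Q': "(b, Q') \<in> E_graph n" using E_graph_ex[OF b] by blast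
    show "(a \<oplus>\<^bsub>diff_ops n\<^esub> b) \<odot>\<^bsub>E_mod n\<^esub> x = a \<odot>\<^bsub>E_mod n\<^esub> x \<oplus>\<^bsub>E_mod n\<^esub> b \<odot>\<^bsub>E_mod n\<^esub> x"
      unfolding diff_ops_simps E_mod_smult[OF E_graph_ops(1)[OF Q Q']]
        E_mod_smult[OF Q] E_mod_smult[OF Q'] using x by (simp add: EM End_k_simps(5))
    show "(a \<otimes>\<^bsub>diff_ops n\<^esub> b) \<odot>\<^bsub>E_mod n\<^esub> x = a \<odot>\<^bsub>E_mod n\<^esub> (b \<odot>\<^bsub>E_mod n\<^esub> x)"
      unfolding diff_ops_simps E_mod_smult[OF E_graph_ops(2)[OF Q Q']]
        E_mod_smult[OF Q] E_mod_smult[OF Q'] using x by (simp add: EM End_k_simps(2) compose_eq)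
  next
    fix x :: "'a laurent" assume "x \<in> carrier (E_mod n)"
    then show "\<one>\<^bsub>diff_ops n\<^esub> \<odot>\<^bsub>E_mod n\<^esub> x = x"
      unfolding diff_ops_simps E_mod_smult[OF E_graph_one] by (simp add: EM End_k_simps(3))
  qed
qed

end

theory Submission
  imports Defs
begin

text \<open>
  Call a \<open>k\<close>-linear form on \<open>M\<close> horizontal if it kills all \<open>\<partial>\<^sub>j M\<close>; these are the linear forms on
  \<open>H\<^sup>n\<^sub>d\<^sub>R(M)\<close>. Composing a \<open>\<D>\<close>-linear map \<open>M \<rightarrow> E\<close> with the residue (the coefficient of
  \<open>(x\<^sub>0 \<cdots> x\<^bsub>n-1\<^esub>)\<^sup>-\<^sup>1\<close>) gives a horizontal form, and a surjection onto \<open>E\<^sup>s\<close> gives \<open>s\<close> independent ones.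
  Conversely a horizontal form \<open>f\<close> yields the \<open>\<D>\<close>-linear map \<open>m \<mapsto> \<Sum>\<^sub>a f(x\<^sup>a m) x\<^sup>-\<^sup>a\<^sup>-\<^sup>1\<close>. The sum is finite
  because \<open>M\<close> is graded and \<open>f\<close> vanishes in almost all degrees: otherwise its homogeneous
  components would be infinitely many independent horizontal forms. The maps obtained from a basis
  of horizontal forms are jointly surjective, since a submodule of \<open>E\<^sup>s\<close> contains the residue parts
  of its elements and these generate \<open>E\<^sup>s\<close> when they span \<open>k\<^sup>s\<close>.
\<close>

section \<open>Linear forms and quotients\<close>

text \<open>The formula for the map attached to \<open>f\<close> is forced. If a
  \<open>diff_ops n\<close>-linear map to E has residue \<open>f\<close>, then the coefficient of
  x^(-a-1) in the image of m is the residue of x^a times that image, hence the residue of the image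
  of x^a m, which is f(x^a m). Without any finiteness the same formula gives a linear map into
  inverse power series, so the obstacle is finite support for each m. Neither \<open>f\<close> nor
  the map need be homogeneous; the grading serves to cut \<open>f\<close> into homogeneous pieces
  that are horizontal again. Finite dimension is thus used twice, to limit the degrees that
  \<open>f\<close> meets and to have a finite dual basis. Independence is always expressed by a dual
  system, elements \<open>v i\<close> and forms \<open>f j\<close> with \<open>f j (v i)\<close>
  equal to 1 or 0: this gives the lower bound for the dimension, and it also makes the residues of
  the image of \<open>v k\<close> a unit vector. Characteristic zero enters in the joint
  surjectivity, where nonzero integers e_j + 1 are inverted.\<close>

lemma submodule_additive_subgroup:
  assumes "submodule R N M"
  shows "additive_subgroup N M"
proof -
  interpret N: submodule R N M by fact
  interpret Module.module R M by (rule N.module)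
  have "\<ominus>\<^bsub>M\<^esub> a \<in> N" if "a \<in> N" for a
  proof -
    have a: "a \<in> carrier M" using that N.subset by blast
    have "(\<ominus>\<^bsub>R\<^esub> \<one>\<^bsub>R\<^esub>) \<odot>\<^bsub>M\<^esub> a \<in> N" using that by (intro N.smult_closed) auto
    then show ?thesis using a by (simp add: smult_l_minus)
  qed
  then show ?thesis
    using N.subset N.m_closed N.zero_closed
    by (intro additive_subgroupI subgroup.intro) (simp_all add: a_inv_def)
qed

section \<open>Quotients by a submodule\<close>

context
  fixes R :: "('r, 'a) ring_scheme" and M :: "('r, 'm) module" and N
  assumes sub: "submodule R N M"
begin

interpretation N: submodule R N M by (rule sub)
interpretation Module.module R M by (rule N.module)
interpretation abelian_subgroup N M
  by (rule abelian_subgroupI3[OF submodule_additive_subgroup[OF sub] abelian_group_axioms])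

lemma quotient_module_coset_eq_iff:
  assumes "x \<in> carrier M" "y \<in> carrier M"
  shows "N +>\<^bsub>M\<^esub> x = N +>\<^bsub>M\<^esub> y \<longleftrightarrow> x \<ominus>\<^bsub>M\<^esub> y \<in> N"
proof
  assume "N +>\<^bsub>M\<^esub> x = N +>\<^bsub>M\<^esub> y"
  then have "x \<in> N +>\<^bsub>M\<^esub> y" using a_rcos_self[OF assms(1)] by simp
  then show "x \<ominus>\<^bsub>M\<^esub> y \<in> N" using a_rcos_module[OF assms(2,1)] by (simp only: minus_eq)
next
  assume "x \<ominus>\<^bsub>M\<^esub> y \<in> N"
  then have "x \<in> N +>\<^bsub>M\<^esub> y" using a_rcos_module[OF assms(2,1)] by (simp only: minus_eq)
  then show "N +>\<^bsub>M\<^esub> x = N +>\<^bsub>M\<^esub> y" using a_repr_independence[OF _ assms(2) a_subgroup] by blast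
qed

text \<open>The scalar \<open>c\<close> maps \<open>N\<close> into itself, so all representatives of
  the coset give the same result and the union in the definition collapses to one coset.\<close>

lemma quotient_module_smult:
  assumes c: "c \<in> carrier R" and x: "x \<in> carrier M"
  shows "c \<odot>\<^bsub>quotient_module M N\<^esub> (N +>\<^bsub>M\<^esub> x) = N +>\<^bsub>M\<^esub> (c \<odot>\<^bsub>M\<^esub> x)"
proof -
  have eq: "N +>\<^bsub>M\<^esub> (c \<odot>\<^bsub>M\<^esub> y) = N +>\<^bsub>M\<^esub> (c \<odot>\<^bsub>M\<^esub> x)" if y: "y \<in> N +>\<^bsub>M\<^esub> x" for y
  proof -
    obtain h where h: "h \<in> N" "y = h \<oplus>\<^bsub>M\<^esub> x" using y unfolding a_r_coset_def' by blast
    have hM: "h \<in> carrier M" using h a_subset by blast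
    have "c \<odot>\<^bsub>M\<^esub> y = c \<odot>\<^bsub>M\<^esub> h \<oplus>\<^bsub>M\<^esub> c \<odot>\<^bsub>M\<^esub> x"
      unfolding h(2) by (rule smult_r_distr[OF c hM x])
    moreover have "\<dots> \<in> N +>\<^bsub>M\<^esub> (c \<odot>\<^bsub>M\<^esub> x)"
      using N.smult_closed[OF c h(1)] a_subset c x by (intro a_rcosI) simp_all
    ultimately show ?thesis using a_repr_independence[OF _ _ a_subgroup] c x by simp
  qed
  have "N +>\<^bsub>M\<^esub> x \<noteq> {}" using a_rcos_self[OF x] by blast
  then have "(\<Union>y\<in>N +>\<^bsub>M\<^esub> x. N +>\<^bsub>M\<^esub> (c \<odot>\<^bsub>M\<^esub> y)) = N +>\<^bsub>M\<^esub> (c \<odot>\<^bsub>M\<^esub> x)"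
    by (rule SUP_eq_const) (rule eq)
  then show ?thesis by (simp add: quotient_module_def)
qed

lemma quotient_module_simps:
  "carrier (quotient_module M N) = (\<lambda>x. N +>\<^bsub>M\<^esub> x) ` carrier M"
  "\<zero>\<^bsub>quotient_module M N\<^esub> = N +>\<^bsub>M\<^esub> \<zero>\<^bsub>M\<^esub>"
  "\<lbrakk>x \<in> carrier M; y \<in> carrier M\<rbrakk> \<Longrightarrow>
     (N +>\<^bsub>M\<^esub> x) \<oplus>\<^bsub>quotient_module M N\<^esub> (N +>\<^bsub>M\<^esub> y) = N +>\<^bsub>M\<^esub> (x \<oplus>\<^bsub>M\<^esub> y)"
  using a_subset by (simp_all add: quotient_module_def A_RCOSETS_def' a_rcos_sum UNION_singleton_eq_range)

lemma quotient_module_is_module: "Module.module R (quotient_module M N)"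
proof -
  let ?Q = "quotient_module M N"
  have ex: "\<exists>x\<in>carrier M. v = N +>\<^bsub>M\<^esub> x" if "v \<in> carrier ?Q" for v
    using that by (auto simp: quotient_module_simps(1))
  note simps = quotient_module_simps quotient_module_smult
  show ?thesis
  proof (rule module_criteria; (intro allI impI ballI)?)
    fix v assume "v \<in> carrier ?Q"
    then obtain x where x: "x \<in> carrier M" "v = N +>\<^bsub>M\<^esub> x" using ex by blast
    have "v \<oplus>\<^bsub>?Q\<^esub> (N +>\<^bsub>M\<^esub> (\<ominus>\<^bsub>M\<^esub> x)) = \<zero>\<^bsub>?Q\<^esub>"
      using x by (simp add: simps M.r_neg)
    then show "\<exists>w\<in>carrier ?Q. v \<oplus>\<^bsub>?Q\<^esub> w = \<zero>\<^bsub>?Q\<^esub>"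
      using x by (auto simp: quotient_module_simps(1))
  next
    fix u v w assume "u \<in> carrier ?Q \<and> v \<in> carrier ?Q \<and> w \<in> carrier ?Q"
    then obtain x y z where "x \<in> carrier M" "u = N +>\<^bsub>M\<^esub> x" "y \<in> carrier M" "v = N +>\<^bsub>M\<^esub> y"
      "z \<in> carrier M" "w = N +>\<^bsub>M\<^esub> z" using ex by meson
    then show "u \<oplus>\<^bsub>?Q\<^esub> v \<oplus>\<^bsub>?Q\<^esub> w = u \<oplus>\<^bsub>?Q\<^esub> (v \<oplus>\<^bsub>?Q\<^esub> w)"
      by (simp add: simps M.a_assoc)
  next
    fix v w assume "v \<in> carrier ?Q \<and> w \<in> carrier ?Q"
    then obtain x y where *: "x \<in> carrier M" "v = N +>\<^bsub>M\<^esub> x" "y \<in> carrier M" "w = N +>\<^bsub>M\<^esub> y"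
      using ex by meson
    then show "v \<oplus>\<^bsub>?Q\<^esub> w = w \<oplus>\<^bsub>?Q\<^esub> v" by (simp add: simps M.a_comm)
    show "v \<oplus>\<^bsub>?Q\<^esub> w \<in> carrier ?Q" using * by (simp add: simps)
  next
    fix a v w assume "a \<in> carrier R \<and> v \<in> carrier ?Q \<and> w \<in> carrier ?Q"
    moreover then obtain x y where "x \<in> carrier M" "v = N +>\<^bsub>M\<^esub> x" "y \<in> carrier M" "w = N +>\<^bsub>M\<^esub> y"
      using ex by meson
    ultimately show "a \<odot>\<^bsub>?Q\<^esub> (v \<oplus>\<^bsub>?Q\<^esub> w) = a \<odot>\<^bsub>?Q\<^esub> v \<oplus>\<^bsub>?Q\<^esub> a \<odot>\<^bsub>?Q\<^esub> w"
      by (simp add: simps smult_r_distr)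
  next
    fix a b v assume *: "a \<in> carrier R \<and> b \<in> carrier R \<and> v \<in> carrier ?Q"
    then obtain x where x: "x \<in> carrier M" "v = N +>\<^bsub>M\<^esub> x" using ex by meson
    show "(a \<otimes>\<^bsub>R\<^esub> b) \<odot>\<^bsub>?Q\<^esub> v = a \<odot>\<^bsub>?Q\<^esub> (b \<odot>\<^bsub>?Q\<^esub> v)"
      using * x by (simp add: simps smult_assoc1)
    show "(a \<oplus>\<^bsub>R\<^esub> b) \<odot>\<^bsub>?Q\<^esub> v = a \<odot>\<^bsub>?Q\<^esub> v \<oplus>\<^bsub>?Q\<^esub> b \<odot>\<^bsub>?Q\<^esub> v"
      using * x by (simp add: simps smult_l_distr)
  next
    fix c v assume *: "c \<in> carrier R \<and> v \<in> carrier ?Q"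
    then obtain x where x: "x \<in> carrier M" "v = N +>\<^bsub>M\<^esub> x" using ex by meson
    show "c \<odot>\<^bsub>?Q\<^esub> v \<in> carrier ?Q" using * x by (simp add: simps)
  next
    fix v assume "v \<in> carrier ?Q"
    then obtain x where x: "x \<in> carrier M" "v = N +>\<^bsub>M\<^esub> x" using ex by meson
    show "v \<oplus>\<^bsub>?Q\<^esub> \<zero>\<^bsub>?Q\<^esub> = v" "\<one>\<^bsub>R\<^esub> \<odot>\<^bsub>?Q\<^esub> v = v" using x by (simp_all add: simps)
  qed (simp_all add: R.is_cring quotient_module_simps)
qed

end

section \<open>Linear forms, dual systems and dimension\<close>

definition linear_form :: "('k::field, 'v) module \<Rightarrow> ('v \<Rightarrow> 'k) \<Rightarrow> bool" where
  "linear_form V f \<longleftrightarrow>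
     (\<forall>x\<in>carrier V. \<forall>y\<in>carrier V. f (x \<oplus>\<^bsub>V\<^esub> y) = f x + f y) \<and>
     (\<forall>c. \<forall>x\<in>carrier V. f (c \<odot>\<^bsub>V\<^esub> x) = c * f x)"

context
  fixes V :: "('k::field, 'v) module"
  assumes V: "vectorspace class_ring V"
begin

interpretation vectorspace "class_ring :: 'k ring" V by (rule V)

lemma linear_form_lincomb:
  assumes f: "linear_form V f" and A: "finite A" "A \<subseteq> carrier V"
  shows "f (lincomb a A) = (\<Sum>v\<in>A. a v * f v)"
  using A
proof (induction A rule: finite_induct)
  case empty
  have "f (\<zero>\<^bsub>V\<^esub> \<oplus>\<^bsub>V\<^esub> \<zero>\<^bsub>V\<^esub>) = f \<zero>\<^bsub>V\<^esub> + f \<zero>\<^bsub>V\<^esub>"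
    using f unfolding linear_form_def by blast
  then have "f \<zero>\<^bsub>V\<^esub> = f \<zero>\<^bsub>V\<^esub> + f \<zero>\<^bsub>V\<^esub>" by simp
  then have "f \<zero>\<^bsub>V\<^esub> = 0" by (simp only: add_cancel_right_right)
  then show ?case by (simp add: lincomb_def)
next
  case (insert v A)
  then have "lincomb a (insert v A) = a v \<odot>\<^bsub>V\<^esub> v \<oplus>\<^bsub>V\<^esub> lincomb a A"
    using lincomb_insert[of A a v] by simp
  moreover have "f (a v \<odot>\<^bsub>V\<^esub> v \<oplus>\<^bsub>V\<^esub> lincomb a A) = a v * f v + f (lincomb a A)"
    using f insert.prems unfolding linear_form_def by (simp add: lincomb_closed)
  ultimately show ?case using insert by simp
qed

text \<open>Evaluating \<open>f j\<close> on a vanishing combination of the \<open>v i\<close>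
  leaves the coefficient of \<open>v j\<close>, so the \<open>v i\<close> are independent.\<close>

lemma dual_system_card_le_dim:
  assumes fd: "fin_dim"
    and v: "\<And>i. i < s \<Longrightarrow> v i \<in> carrier V"
    and f: "\<And>j. j < s \<Longrightarrow> linear_form V (f j)"
    and dual: "\<And>i j. i < s \<Longrightarrow> j < s \<Longrightarrow> f j (v i) = (if i = j then 1 else 0)"
  shows "s \<le> dim"
proof -
  \<comment> \<open>Needed for the count: \<open>v i = v j\<close> with \<open>i \<noteq> j\<close>
    would give 0 = 1.\<close>
  have inj: "inj_on v {..<s}"
    by (rule inj_onI) (metis dual lessThan_iff zero_neq_one)
  have sub: "v ` {..<s} \<subseteq> carrier V" using v by blast
  have "\<not> lin_dep (v ` {..<s})"
  proof
    assume "lin_dep (v ` {..<s})"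
    then obtain A a w where A: "finite A" "A \<subseteq> v ` {..<s}" "lincomb a A = \<zero>\<^bsub>V\<^esub>" "w \<in> A" "a w \<noteq> 0"
      by (auto simp: lin_dep_def)
    obtain j where j: "j < s" "w = v j" using A by blast
    have "f j (lincomb a A) = (\<Sum>u\<in>A. a u * f j u)"
      using linear_form_lincomb[OF f[OF j(1)] A(1)] A(2) sub by blast
    also have "\<dots> = (\<Sum>u\<in>A. if u = w then a w else 0)"
      using A(2) j inj by (intro sum.cong) (auto simp: dual inj_on_eq_iff)
    also have "\<dots> = a w" using A by simp
    moreover have "f j (\<zero>\<^bsub>V\<^esub>) = 0"
      using linear_form_lincomb[OF f[OF j(1)], of "{}"] by (simp add: lincomb_def)
    ultimately show False using A by simp
  qed
  from li_le_dim(2)[OF fd sub this] show ?thesis using inj by (simp add: card_image)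
qed

text \<open>The forms are the coordinate functions of a finite basis \<open>B\<close>, enumerated by
  \<open>v\<close>.\<close>

lemma dual_basis_exists:
  assumes fd: "fin_dim"
  obtains v f where "\<And>i. i < dim \<Longrightarrow> v i \<in> carrier V" "\<And>j. j < dim \<Longrightarrow> linear_form V (f j)"
    "\<And>i j. i < dim \<Longrightarrow> j < dim \<Longrightarrow> f j (v i) = (if i = j then 1 else 0)"
proof -
  obtain B where B: "finite B" "basis B" using finite_basis_exists[OF fd] by blast
  have BV: "B \<subseteq> carrier V" using B by (simp add: basis_def)
  obtain v where v: "bij_betw v {..<dim} B"
    using ex_bij_betw_nat_finite[OF B(1)] dim_basis[OF B] by (auto simp: atLeast0LessThan)
  have ex: "\<exists>!a. a \<in> B \<rightarrow>\<^sub>E UNIV \<and> lincomb a B = x" if "x \<in> carrier V" for x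
    using basis_criterion[OF B(1) BV] B(2) that by auto
  \<comment> \<open>Coefficients are unique only up to their values off \<open>B\<close>.
    Extensional ones are definite, and \<open>coI\<close> compares arbitrary ones with them on
    \<open>B\<close>.\<close>
  define co where "co x = (THE a. a \<in> B \<rightarrow>\<^sub>E UNIV \<and> lincomb a B = x)" for x
  have co: "lincomb (co x) B = x" if "x \<in> carrier V" for x
    using theI'[OF ex[OF that]] by (simp add: co_def)
  have coI: "a w = co x w" if "lincomb a B = x" "w \<in> B" for a x w
  proof -
    have "lincomb (restrict a B) B = x"
      using that(1) BV by (subst lincomb_cong[of B B _ a]) auto
    moreover have "x \<in> carrier V" using that(1) BV by auto
    ultimately have "co x = restrict a B" unfolding co_def by (intro the1_equality ex) auto
    then show ?thesis using that(2) by simp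
  qed
  show thesis
  proof (rule that[of v "\<lambda>j x. co x (v j)"])
    show "v i \<in> carrier V" if "i < dim" for i
      using that v BV by (auto simp: bij_betw_def)
    fix j assume j: "j < dim"
    then have vj: "v j \<in> B" using v by (auto simp: bij_betw_def)
    show "linear_form V (\<lambda>x. co x (v j))"
      unfolding linear_form_def
    proof (intro conjI ballI allI)
      fix x y assume xy: "x \<in> carrier V" "y \<in> carrier V"
      have "lincomb (\<lambda>w. co x w + co y w) B = x \<oplus>\<^bsub>V\<^esub> y"
        using lincomb_sum[OF B(1) BV, of "co x" "co y"] co xy by simp
      then show "co (x \<oplus>\<^bsub>V\<^esub> y) (v j) = co x (v j) + co y (v j)" using coI[OF _ vj] by metis
    next
      fix c x assume x: "x \<in> carrier V"
      have "lincomb (\<lambda>w. c * co x w) B = c \<odot>\<^bsub>V\<^esub> x"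
        using lincomb_smult[OF BV, of "co x" c] co x by simp
      then show "co (c \<odot>\<^bsub>V\<^esub> x) (v j) = c * co x (v j)" using coI[OF _ vj] by metis
    qed
    fix i assume i: "i < dim"
    have vi: "v i \<in> B" using i v by (auto simp: bij_betw_def)
    have "lincomb (\<lambda>w. if w = v i then 1 else 0) B = v i"
    proof -
      have "lincomb (\<lambda>w. if w = v i then 1 else 0) B = (\<Oplus>\<^bsub>V\<^esub>w\<in>B. if v i = w then w else \<zero>\<^bsub>V\<^esub>)"
        unfolding lincomb_def using BV smult_one smult_l_null by (intro finsum_cong') auto
      also have "\<dots> = v i"
        using M.add.finprod_singleton[OF vi B(1), of "\<lambda>w. w"] BV by auto
      finally show ?thesis .
    qed
    from coI[OF this vj] show "co (v i) (v j) = (if i = j then 1 else 0)"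
      using v i j by (auto simp: bij_betw_def inj_on_eq_iff)
  qed
qed

end

section \<open>Modules over the ring of differential operators\<close>

lemma mult_op_diff_ops: "r \<in> polys n \<Longrightarrow> mult_op n r \<in> carrier (diff_ops n)"
  by (auto simp: diff_ops_def intro!: generate_ring.incl)

lemma const_op_diff_ops: "const_op n c \<in> carrier (diff_ops n)"
  unfolding const_op_def by (intro mult_op_diff_ops const_polys)

lemma var_op_diff_ops: "j < n \<Longrightarrow> var_op n j \<in> carrier (diff_ops n)"
  unfolding var_op_def by (intro mult_op_diff_ops x_polys)

lemma partial_op_diff_ops: "j < n \<Longrightarrow> partial_op n j \<in> carrier (diff_ops n)"
  by (auto simp: diff_ops_def intro!: generate_ring.incl)

lemmas diff_ops_generators = mult_op_diff_ops const_op_diff_ops var_op_diff_ops partial_op_diff_ops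

lemma const_op_eq: "const_op n c = (\<lambda>p\<in>polys n. scale c p)"
  by (simp add: const_op_def mult_op_def scale_conv_mult)

lemma const_op_ring:
  "const_op n (c + d) = const_op n c \<oplus>\<^bsub>diff_ops n\<^esub> const_op n d"
  "const_op n (c * d) = const_op n c \<otimes>\<^bsub>diff_ops n\<^esub> const_op n d"
  "const_op n 1 = \<one>\<^bsub>diff_ops n\<^esub>"
proof -
  show "const_op n (c + d) = const_op n c \<oplus>\<^bsub>diff_ops n\<^esub> const_op n d"
    by (simp add: const_op_def diff_ops_simps single_add mult_op_add)
  show "const_op n (c * d) = const_op n c \<otimes>\<^bsub>diff_ops n\<^esub> const_op n d"
    unfolding const_op_def diff_ops_simps
    by (subst mult_op_mult[symmetric]) (auto simp: mult_single const_polys)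
  show "const_op n 1 = \<one>\<^bsub>diff_ops n\<^esub>"
    by (auto simp: const_op_eq diff_ops_simps End_k_simps scale_conv_mult intro!: restrict_ext)
qed

lemma const_op_commute:
  assumes "P \<in> carrier (diff_ops n)"
  shows "const_op n c \<otimes>\<^bsub>diff_ops n\<^esub> P = P \<otimes>\<^bsub>diff_ops n\<^esub> const_op n c"
proof -
  \<comment> \<open>The graph serves only to place \<open>P\<close> in
    \<open>End_k (polys n)\<close>; commutation is then the \<open>k\<close>-linearity of
    \<open>P\<close>.\<close>
  obtain Q where "(P, Q) \<in> E_graph n" using E_graph_ex[OF assms] by blast
  then have P: "P \<in> carrier (End_k (polys n))" using E_graph_carrier by blast
  then show ?thesis
    by (auto simp: diff_ops_simps End_k_simps const_op_eq compose_def polys_closed intro!: restrict_ext)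
qed

context left_module
begin

lemma smult_l_null: "x \<in> carrier M \<Longrightarrow> \<zero>\<^bsub>R\<^esub> \<odot>\<^bsub>M\<^esub> x = \<zero>\<^bsub>M\<^esub>"
  using smult_l_distr[of "\<zero>\<^bsub>R\<^esub>" "\<zero>\<^bsub>R\<^esub>" x] by simp

lemma smult_r_null: "a \<in> carrier R \<Longrightarrow> a \<odot>\<^bsub>M\<^esub> \<zero>\<^bsub>M\<^esub> = \<zero>\<^bsub>M\<^esub>"
  using smult_r_distr[of a "\<zero>\<^bsub>M\<^esub>" "\<zero>\<^bsub>M\<^esub>"] by simp

lemma smult_l_minus: "a \<in> carrier R \<Longrightarrow> x \<in> carrier M \<Longrightarrow> (\<ominus>\<^bsub>R\<^esub> a) \<odot>\<^bsub>M\<^esub> x = \<ominus>\<^bsub>M\<^esub> (a \<odot>\<^bsub>M\<^esub> x)"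
  using smult_l_distr[of "\<ominus>\<^bsub>R\<^esub> a" a x] M.minus_equality[of "(\<ominus>\<^bsub>R\<^esub> a) \<odot>\<^bsub>M\<^esub> x" "a \<odot>\<^bsub>M\<^esub> x"]
  by (simp add: R.l_neg smult_l_null)

end

locale D_module = left_module "diff_ops n" M
  for n :: nat and M :: "('k::field operator, 'm) module"
begin

lemmas ops_closed [simp] = diff_ops_generators

lemma const_smult_simps:
  assumes "x \<in> carrier M"
  shows "const_op n (c + d) \<odot>\<^bsub>M\<^esub> x = const_op n c \<odot>\<^bsub>M\<^esub> x \<oplus>\<^bsub>M\<^esub> const_op n d \<odot>\<^bsub>M\<^esub> x"
    "const_op n (c * d) \<odot>\<^bsub>M\<^esub> x = const_op n c \<odot>\<^bsub>M\<^esub> (const_op n d \<odot>\<^bsub>M\<^esub> x)"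
    "const_op n 1 \<odot>\<^bsub>M\<^esub> x = x"
  unfolding const_op_ring using assms
  by (simp_all add: smult_l_distr smult_assoc1)

lemma const_smult_commute:
  assumes "x \<in> carrier M" "P \<in> carrier (diff_ops n)"
  shows "const_op n c \<odot>\<^bsub>M\<^esub> (P \<odot>\<^bsub>M\<^esub> x) = P \<odot>\<^bsub>M\<^esub> (const_op n c \<odot>\<^bsub>M\<^esub> x)"
  using assms const_op_commute[OF assms(2), of c] by (simp flip: smult_assoc1)

text \<open>Kept as functions on \<open>M\<close>, so that later arguments never meet cosets;
  \<open>horizontal_form_descends\<close> and \<open>horizontal_form_of_class\<close> translate to
  cohomology.\<close>

definition horizontal_form :: "('m \<Rightarrow> 'k) \<Rightarrow> bool" where
  "horizontal_form f \<longleftrightarrow>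
     (\<forall>x\<in>carrier M. \<forall>y\<in>carrier M. f (x \<oplus>\<^bsub>M\<^esub> y) = f x + f y) \<and>
     (\<forall>c. \<forall>x\<in>carrier M. f (const_op n c \<odot>\<^bsub>M\<^esub> x) = c * f x) \<and>
     (\<forall>j<n. \<forall>x\<in>carrier M. f (partial_op n j \<odot>\<^bsub>M\<^esub> x) = 0)"

section \<open>The top de Rham cohomology and its linear forms\<close>

lemma form_index_top: "form_index n n = {{..<n}}"
  using card_subset_eq[of "{..<n}"] by (auto simp: form_index_def)

text \<open>Makes every top form a cocycle.\<close>

lemma form_index_beyond: "form_index n (Suc n) = {}"
proof -
  have "card J \<noteq> Suc n" if "J \<subseteq> {..<n}" for J
    using card_mono[OF _ that] by simp
  then show ?thesis unfolding form_index_def by blast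
qed

text \<open>The form m dx_0 ... dx_(n-1). As \<open>form_index n n\<close> has the single element
  \<open>{..<n}\<close>, this identifies \<open>M\<close> with the top forms.\<close>

definition top_form :: "'m \<Rightarrow> nat set \<Rightarrow> 'm" where
  "top_form m = (\<lambda>J\<in>form_index n n. m)"

abbreviation top_forms :: "('k, nat set \<Rightarrow> 'm) module" where
  "top_forms \<equiv> (dR_forms n M n)\<lparr>carrier := dR_cocycles n M n\<rparr>"

lemma top_forms_carrier: "carrier top_forms = top_form ` carrier M"
proof -
  have "dR_diff n M n \<omega> = \<zero>\<^bsub>dR_forms n M (Suc n)\<^esub>" for \<omega>
    by (simp add: dR_diff_def dR_forms_def form_index_beyond restrict_def)
  then have "carrier top_forms = {{..<n}} \<rightarrow>\<^sub>E carrier M"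
    by (auto simp: dR_cocycles_def a_kernel_def kernel_def dR_forms_def form_index_top)
  also have "\<dots> = top_form ` carrier M"
  proof (intro equalityI subsetI)
    fix \<omega> assume "\<omega> \<in> {{..<n}} \<rightarrow>\<^sub>E carrier M"
    then show "\<omega> \<in> top_form ` carrier M"
      by (intro image_eqI[of _ _ "\<omega> {..<n}"])
         (auto simp: top_form_def form_index_top PiE_iff extensional_def fun_eq_iff)
  next
    fix \<omega> assume "\<omega> \<in> top_form ` carrier M"
    then show "\<omega> \<in> {{..<n}} \<rightarrow>\<^sub>E carrier M"
      by (elim imageE) (simp add: top_form_def form_index_top restrict_PiE_iff)
  qed
  finally show ?thesis .
qed

lemma top_forms_simps:
  "top_form x \<oplus>\<^bsub>top_forms\<^esub> top_form y = top_form (x \<oplus>\<^bsub>M\<^esub> y)"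
  "\<zero>\<^bsub>top_forms\<^esub> = top_form \<zero>\<^bsub>M\<^esub>"
  "c \<odot>\<^bsub>top_forms\<^esub> top_form x = top_form (const_op n c \<odot>\<^bsub>M\<^esub> x)"
  by (auto simp: dR_forms_def top_form_def form_index_top intro!: restrict_ext)

lemma top_form_apply: "top_form x {..<n} = x"
  by (simp add: top_form_def form_index_top)

lemma top_forms_module: "Module.module (class_ring :: 'k ring) top_forms"
proof -
  have ex: "\<exists>x\<in>carrier M. v = top_form x" if "v \<in> carrier top_forms" for v
    using that top_forms_carrier by blast
  have cl: "top_form x \<in> carrier top_forms" if "x \<in> carrier M" for x
    using that top_forms_carrier by blast
  show ?thesis
  proof (rule module_criteria; (intro allI impI ballI)?)
    fix v assume "v \<in> carrier top_forms"
    then obtain x where x: "x \<in> carrier M" "v = top_form x" using ex by meson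
    show "v \<oplus>\<^bsub>top_forms\<^esub> \<zero>\<^bsub>top_forms\<^esub> = v" "\<one>\<^bsub>class_ring\<^esub> \<odot>\<^bsub>top_forms\<^esub> v = v"
      using x by (simp_all only: top_forms_simps const_smult_simps M.r_zero monoid.simps)
    show "\<exists>w\<in>carrier top_forms. v \<oplus>\<^bsub>top_forms\<^esub> w = \<zero>\<^bsub>top_forms\<^esub>"
      using x by (intro bexI[of _ "top_form (\<ominus>\<^bsub>M\<^esub> x)"] cl M.a_inv_closed)
        (simp_all only: top_forms_simps M.r_neg)
  next
    fix u v w assume "u \<in> carrier top_forms \<and> v \<in> carrier top_forms \<and> w \<in> carrier top_forms"
    then obtain x y z where "x \<in> carrier M" "u = top_form x" "y \<in> carrier M" "v = top_form y"
      "z \<in> carrier M" "w = top_form z" using ex by meson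
    then show "u \<oplus>\<^bsub>top_forms\<^esub> v \<oplus>\<^bsub>top_forms\<^esub> w = u \<oplus>\<^bsub>top_forms\<^esub> (v \<oplus>\<^bsub>top_forms\<^esub> w)"
      by (simp only: top_forms_simps M.a_assoc)
  next
    fix v w assume "v \<in> carrier top_forms \<and> w \<in> carrier top_forms"
    then obtain x y where *: "x \<in> carrier M" "v = top_form x" "y \<in> carrier M" "w = top_form y"
      using ex by meson
    then show "v \<oplus>\<^bsub>top_forms\<^esub> w = w \<oplus>\<^bsub>top_forms\<^esub> v"
      by (simp only: top_forms_simps M.a_comm)
    show "v \<oplus>\<^bsub>top_forms\<^esub> w \<in> carrier top_forms"
      unfolding * top_forms_simps using * by (intro cl) auto
  next
    fix a :: 'k and v w assume "a \<in> carrier class_ring \<and> v \<in> carrier top_forms \<and> w \<in> carrier top_forms"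
    then obtain x y where "x \<in> carrier M" "v = top_form x" "y \<in> carrier M" "w = top_form y"
      using ex by meson
    then show "a \<odot>\<^bsub>top_forms\<^esub> (v \<oplus>\<^bsub>top_forms\<^esub> w) =
        a \<odot>\<^bsub>top_forms\<^esub> v \<oplus>\<^bsub>top_forms\<^esub> a \<odot>\<^bsub>top_forms\<^esub> w"
      by (simp only: top_forms_simps smult_r_distr ops_closed)
  next
    fix a b :: 'k and v
    assume "a \<in> carrier class_ring \<and> b \<in> carrier class_ring \<and> v \<in> carrier top_forms"
    then obtain x where x: "x \<in> carrier M" "v = top_form x" using ex by meson
    show "(a \<otimes>\<^bsub>class_ring\<^esub> b) \<odot>\<^bsub>top_forms\<^esub> v = a \<odot>\<^bsub>top_forms\<^esub> (b \<odot>\<^bsub>top_forms\<^esub> v)"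
      "(a \<oplus>\<^bsub>class_ring\<^esub> b) \<odot>\<^bsub>top_forms\<^esub> v = a \<odot>\<^bsub>top_forms\<^esub> v \<oplus>\<^bsub>top_forms\<^esub> b \<odot>\<^bsub>top_forms\<^esub> v"
      using x by (simp_all only: top_forms_simps const_smult_simps ring.simps monoid.simps)
  next
    fix c :: 'k and v assume "c \<in> carrier class_ring \<and> v \<in> carrier top_forms"
    then obtain x where x: "x \<in> carrier M" "v = top_form x" using ex by meson
    show "c \<odot>\<^bsub>top_forms\<^esub> v \<in> carrier top_forms"
      unfolding x top_forms_simps using x by (intro cl) auto
  next
    show "\<zero>\<^bsub>top_forms\<^esub> \<in> carrier top_forms"
      unfolding top_forms_simps by (intro cl) auto
    show "cring (class_ring :: 'k ring)" by (rule class_cring.is_cring)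
  qed
qed

abbreviation sgn_op :: "nat \<Rightarrow> 'k operator" where
  "sgn_op s \<equiv> const_op n ((-1) ^ card {j \<in> {..<n}. j < s})"

text \<open>A differential of top degree is the signed sum of derivatives of the coefficients at the
  complements of single indices. The signs commute with the derivations and are invertible, so they
  are absorbed by the arbitrary family \<open>u\<close>.\<close>

lemma top_coboundaries:
  "dR_coboundaries n M n =
     {top_form (\<Oplus>\<^bsub>M\<^esub>s\<in>{..<n}. partial_op n s \<odot>\<^bsub>M\<^esub> u s) | u. u \<in> {..<n} \<rightarrow> carrier M}"
    (is "?B = ?C")
proof (cases n)
  case 0
  \<comment> \<open>No differential arrives in degree 0; the coboundaries are zero by definition, in
    agreement with the empty sum.\<close>
  have B: "?B = {top_form \<zero>\<^bsub>M\<^esub>}"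
    using top_forms_simps(2) by (simp add: dR_coboundaries_def 0)
  have "(\<Oplus>\<^bsub>M\<^esub>s\<in>{..<n}. partial_op n s \<odot>\<^bsub>M\<^esub> u s) = \<zero>\<^bsub>M\<^esub>" for u
    using 0 by (metis M.finsum_empty lessThan_0)
  moreover have "\<exists>u. u \<in> {..<n} \<rightarrow> carrier M"
    by (rule exI[of _ "\<lambda>_. \<zero>\<^bsub>M\<^esub>"]) simp
  ultimately show ?thesis unfolding B by simp
next
  case (Suc n')
  have idx: "form_index n n' = (\<lambda>s. {..<n} - {s}) ` {..<n}"
  proof (intro equalityI subsetI)
    fix J assume "J \<in> form_index n n'"
    then have J: "J \<subseteq> {..<n}" "card J = n'" by (auto simp: form_index_def)
    then have "card ({..<n} - J) = 1" using Suc by (subst card_Diff_subset) (auto intro: finite_subset)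
    then obtain s where "{..<n} - J = {s}" by (auto simp: card_1_singleton_iff)
    then show "J \<in> (\<lambda>s. {..<n} - {s}) ` {..<n}" using J by (intro image_eqI[of _ _ s]) auto
  qed (use Suc in \<open>auto simp: form_index_def\<close>)
  have sgn2: "const_op n ((-1) ^ m) \<odot>\<^bsub>M\<^esub> (const_op n ((-1) ^ m) \<odot>\<^bsub>M\<^esub> x) = x"
    if "x \<in> carrier M" for m x
  proof -
    have "const_op n ((-1) ^ m * (-1) ^ m) \<odot>\<^bsub>M\<^esub> x = x"
      by (simp add: const_smult_simps(3) that flip: power_mult_distrib)
    then show ?thesis unfolding const_smult_simps(2)[OF that] .
  qed
  have diff: "dR_diff n M n' \<omega> =
      top_form (\<Oplus>\<^bsub>M\<^esub>s\<in>{..<n}. partial_op n s \<odot>\<^bsub>M\<^esub> (sgn_op s \<odot>\<^bsub>M\<^esub> \<omega> ({..<n} - {s})))"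
    if "\<omega> \<in> carrier (dR_forms n M n')" for \<omega>
  proof -
    have \<omega>: "\<omega> ({..<n} - {s}) \<in> carrier M" if "s < n" for s
      using \<open>\<omega> \<in> _\<close> that by (auto simp: dR_forms_def idx PiE_iff)
    have "(\<Oplus>\<^bsub>M\<^esub>s\<in>{..<n}. sgn_op s \<odot>\<^bsub>M\<^esub> (partial_op n s \<odot>\<^bsub>M\<^esub> \<omega> ({..<n} - {s}))) =
        (\<Oplus>\<^bsub>M\<^esub>s\<in>{..<n}. partial_op n s \<odot>\<^bsub>M\<^esub> (sgn_op s \<odot>\<^bsub>M\<^esub> \<omega> ({..<n} - {s})))"
      by (rule M.finsum_cong') (auto simp: const_smult_commute \<omega>)
    then show ?thesis
      unfolding dR_diff_def top_form_def Suc[symmetric] form_index_top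
      by (intro restrict_ext) auto
  qed
  have B: "?B = dR_diff n M n' ` carrier (dR_forms n M n')" by (simp add: dR_coboundaries_def Suc)
  show ?thesis
  proof (intro equalityI subsetI)
    fix \<eta> assume "\<eta> \<in> ?B"
    then obtain \<omega> where \<omega>: "\<omega> \<in> carrier (dR_forms n M n')" "\<eta> = dR_diff n M n' \<omega>" using B by blast
    have "(\<lambda>s. sgn_op s \<odot>\<^bsub>M\<^esub> \<omega> ({..<n} - {s})) \<in> {..<n} \<rightarrow> carrier M"
      using \<omega>(1) by (auto simp: dR_forms_def idx PiE_iff)
    then show "\<eta> \<in> ?C" unfolding \<omega>(2) diff[OF \<omega>(1)] by (intro CollectI exI conjI) (rule refl)
  next
    fix \<eta> assume "\<eta> \<in> ?C"
    then obtain u where u: "u \<in> {..<n} \<rightarrow> carrier M"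
      "\<eta> = top_form (\<Oplus>\<^bsub>M\<^esub>s\<in>{..<n}. partial_op n s \<odot>\<^bsub>M\<^esub> u s)" by blast
    \<comment> \<open>\<open>r\<close> recovers the omitted index. Placing \<open>u s\<close> with
      its sign at the complement of \<open>s\<close> makes each sign occur twice in the differential
      and cancel.\<close>
    define r where "r J = (THE s. s < n \<and> J = {..<n} - {s})" for J
    have r: "r ({..<n} - {s}) = s" if "s < n" for s
      unfolding r_def using that by (intro the_equality) auto
    define \<omega> where "\<omega> = (\<lambda>J\<in>form_index n n'. sgn_op (r J) \<odot>\<^bsub>M\<^esub> u (r J))"
    have \<omega>: "\<omega> \<in> carrier (dR_forms n M n')"
      using u(1) r by (auto simp: \<omega>_def dR_forms_def idx Pi_iff)
    have "dR_diff n M n' \<omega> = \<eta>"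
      unfolding diff[OF \<omega>] u(2)
      by (rule arg_cong[where f = top_form], rule M.finsum_cong')
         (use u(1) in \<open>auto simp: \<omega>_def idx r sgn2 Pi_iff\<close>)
    then show "\<eta> \<in> ?B" unfolding B using \<omega> by blast
  qed
qed

lemma coboundaries_submodule:
  "submodule (class_ring :: 'k ring) (dR_coboundaries n M n) top_forms"
proof (rule submodule.intro[OF top_forms_module])
  let ?S = "\<lambda>u. \<Oplus>\<^bsub>M\<^esub>s\<in>{..<n}. partial_op n s \<odot>\<^bsub>M\<^esub> u s"
  have S: "?S u \<in> carrier M" if "u \<in> {..<n} \<rightarrow> carrier M" for u
    using that by (intro M.finsum_closed) auto
  have I: "top_form (?S u) \<in> dR_coboundaries n M n" if "u \<in> {..<n} \<rightarrow> carrier M" for u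
    unfolding top_coboundaries using that by (intro CollectI exI[of _ u] conjI refl)
  show "dR_coboundaries n M n \<subseteq> carrier top_forms"
    unfolding top_coboundaries top_forms_carrier using S by blast
  have "?S (\<lambda>_. \<zero>\<^bsub>M\<^esub>) = \<zero>\<^bsub>M\<^esub>"
    by (rule M.add.finprod_one_eqI) (simp add: smult_r_null)
  then have "\<zero>\<^bsub>top_forms\<^esub> = top_form (?S (\<lambda>_. \<zero>\<^bsub>M\<^esub>))" by (simp only: top_forms_simps)
  then show "\<zero>\<^bsub>top_forms\<^esub> \<in> dR_coboundaries n M n"
    unfolding top_coboundaries by (intro CollectI exI[of _ "\<lambda>_. \<zero>\<^bsub>M\<^esub>"] conjI) auto
  fix v assume "v \<in> dR_coboundaries n M n"
  then obtain u where u: "u \<in> {..<n} \<rightarrow> carrier M" "v = top_form (?S u)"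
    unfolding top_coboundaries by blast
  show "v \<oplus>\<^bsub>top_forms\<^esub> w \<in> dR_coboundaries n M n" if w: "w \<in> dR_coboundaries n M n" for w
  proof -
    obtain u' where u': "u' \<in> {..<n} \<rightarrow> carrier M" "w = top_form (?S u')"
      using w unfolding top_coboundaries by blast
    have "?S (\<lambda>s. u s \<oplus>\<^bsub>M\<^esub> u' s) =
        (\<Oplus>\<^bsub>M\<^esub>s\<in>{..<n}. partial_op n s \<odot>\<^bsub>M\<^esub> u s \<oplus>\<^bsub>M\<^esub> partial_op n s \<odot>\<^bsub>M\<^esub> u' s)"
      using u(1) u'(1) by (intro M.finsum_cong') (auto simp: smult_r_distr Pi_iff)
    also have "\<dots> = ?S u \<oplus>\<^bsub>M\<^esub> ?S u'"
      using u(1) u'(1) by (intro M.finsum_addf) (auto simp: Pi_iff)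
    finally have "?S u \<oplus>\<^bsub>M\<^esub> ?S u' = ?S (\<lambda>s. u s \<oplus>\<^bsub>M\<^esub> u' s)" by simp
    then have "v \<oplus>\<^bsub>top_forms\<^esub> w = top_form (?S (\<lambda>s. u s \<oplus>\<^bsub>M\<^esub> u' s))"
      unfolding u u' top_forms_simps by simp
    moreover have "(\<lambda>s. u s \<oplus>\<^bsub>M\<^esub> u' s) \<in> {..<n} \<rightarrow> carrier M" using u(1) u'(1) by auto
    ultimately show ?thesis by (simp only: I)
  qed
  fix c :: 'k
  have "const_op n c \<odot>\<^bsub>M\<^esub> (\<Oplus>\<^bsub>M\<^esub>s\<in>A. partial_op n s \<odot>\<^bsub>M\<^esub> u s) =
      (\<Oplus>\<^bsub>M\<^esub>s\<in>A. partial_op n s \<odot>\<^bsub>M\<^esub> (const_op n c \<odot>\<^bsub>M\<^esub> u s))" if "finite A" "A \<subseteq> {..<n}" for A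
    using that
  proof (induction A rule: finite_induct)
    case (insert s A)
    then have "s < n" "u s \<in> carrier M" "\<And>t. t \<in> A \<Longrightarrow> t < n \<and> u t \<in> carrier M" using u(1) by auto
    with insert show ?case
      by (simp add: M.finsum_insert Pi_iff M.finsum_closed smult_r_distr const_smult_commute)
  qed (simp add: smult_r_null)
  from this[OF finite_lessThan subset_refl]
  have "c \<odot>\<^bsub>top_forms\<^esub> v = top_form (?S (\<lambda>s. const_op n c \<odot>\<^bsub>M\<^esub> u s))"
    unfolding u top_forms_simps by simp
  moreover have "(\<lambda>s. const_op n c \<odot>\<^bsub>M\<^esub> u s) \<in> {..<n} \<rightarrow> carrier M" using u(1) by auto
  ultimately show "c \<odot>\<^bsub>top_forms\<^esub> v \<in> dR_coboundaries n M n" by (simp only: I)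
qed

abbreviation top_cohomology :: "('k, (nat set \<Rightarrow> 'm) set) module" where
  "top_cohomology \<equiv> dR_cohomology n M n"

lemma top_cohomology_vectorspace: "vectorspace (class_ring :: 'k ring) top_cohomology"
  unfolding dR_cohomology_def
  by (intro vectorspace.intro quotient_module_is_module coboundaries_submodule class_field)

section \<open>Cohomology classes and descent of horizontal forms\<close>

definition coh_class :: "'m \<Rightarrow> (nat set \<Rightarrow> 'm) set" where
  "coh_class m = dR_coboundaries n M n +>\<^bsub>top_forms\<^esub> top_form m"

lemma top_form_in: "m \<in> carrier M \<Longrightarrow> top_form m \<in> carrier top_forms"
  using top_forms_carrier by blast

lemma coh_class_simps:
  "carrier top_cohomology = coh_class ` carrier M"
  "x \<in> carrier M \<Longrightarrow> y \<in> carrier M \<Longrightarrow>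
     coh_class x \<oplus>\<^bsub>top_cohomology\<^esub> coh_class y = coh_class (x \<oplus>\<^bsub>M\<^esub> y)"
  "x \<in> carrier M \<Longrightarrow> c \<odot>\<^bsub>top_cohomology\<^esub> coh_class x = coh_class (const_op n c \<odot>\<^bsub>M\<^esub> x)"
proof -
  note q = quotient_module_simps[OF coboundaries_submodule, folded dR_cohomology_def]
    and s = quotient_module_smult[OF coboundaries_submodule, folded dR_cohomology_def]
  show "carrier top_cohomology = coh_class ` carrier M"
    unfolding q(1) top_forms_carrier image_image coh_class_def ..
  show "x \<in> carrier M \<Longrightarrow> y \<in> carrier M \<Longrightarrow>
     coh_class x \<oplus>\<^bsub>top_cohomology\<^esub> coh_class y = coh_class (x \<oplus>\<^bsub>M\<^esub> y)"
    unfolding coh_class_def by (subst q(3)) (auto simp only: top_form_in top_forms_simps)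
  show "x \<in> carrier M \<Longrightarrow> c \<odot>\<^bsub>top_cohomology\<^esub> coh_class x = coh_class (const_op n c \<odot>\<^bsub>M\<^esub> x)"
    unfolding coh_class_def by (subst s) (auto simp only: top_form_in top_forms_simps partial_object.simps)
qed

lemma coh_class_eq_iff:
  assumes "x \<in> carrier M" "y \<in> carrier M"
  shows "coh_class x = coh_class y \<longleftrightarrow> top_form (x \<ominus>\<^bsub>M\<^esub> y) \<in> dR_coboundaries n M n"
proof -
  interpret T: Module.module "class_ring :: 'k ring" top_forms by (rule top_forms_module)
  have "\<ominus>\<^bsub>top_forms\<^esub> top_form y = top_form (\<ominus>\<^bsub>M\<^esub> y)"
    using assms by (intro T.minus_equality) (simp_all only: top_form_in top_forms_simps M.l_neg M.a_inv_closed)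
  then have "top_form x \<ominus>\<^bsub>top_forms\<^esub> top_form y = top_form (x \<ominus>\<^bsub>M\<^esub> y)"
    unfolding a_minus_def by (simp only: top_forms_simps)
  then show ?thesis
    unfolding coh_class_def
    using quotient_module_coset_eq_iff[OF coboundaries_submodule top_form_in[OF assms(1)] top_form_in[OF assms(2)]]
    by simp
qed

lemma additive_finsum:
  assumes f: "\<And>x y. x \<in> carrier M \<Longrightarrow> y \<in> carrier M \<Longrightarrow> f (x \<oplus>\<^bsub>M\<^esub> y) = f x + (f y :: 'k)"
    and A: "finite A" "g \<in> A \<rightarrow> carrier M"
  shows "f (\<Oplus>\<^bsub>M\<^esub>a\<in>A. g a) = (\<Sum>a\<in>A. f (g a))"
  using A
proof (induction A rule: finite_induct)
  case empty
  have "f \<zero>\<^bsub>M\<^esub> = f \<zero>\<^bsub>M\<^esub> + f \<zero>\<^bsub>M\<^esub>"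
    using f[OF M.zero_closed M.zero_closed] unfolding M.r_zero[OF M.zero_closed] .
  then have "f \<zero>\<^bsub>M\<^esub> = 0" by (rule add_cancel_right_right[THEN iffD1])
  then show ?case by simp
next
  case (insert a A)
  then show ?case by (simp add: M.finsum_insert Pi_iff f M.finsum_closed)
qed

text \<open>Two representatives of a class differ by a sum of derivatives, which \<open>f\<close>
  kills, so evaluating \<open>f\<close> at a chosen representative does not depend on the
  choice.\<close>

lemma horizontal_form_descends:
  assumes f: "horizontal_form f"
  obtains g where "linear_form top_cohomology g" "\<And>x. x \<in> carrier M \<Longrightarrow> g (coh_class x) = f x"
proof -
  have add: "f (x \<oplus>\<^bsub>M\<^esub> y) = f x + f y" if "x \<in> carrier M" "y \<in> carrier M" for x y
    using f that by (simp add: horizontal_form_def)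
  have eq: "f x = f y" if xy: "x \<in> carrier M" "y \<in> carrier M" "coh_class x = coh_class y" for x y
  proof -
    have "top_form (x \<ominus>\<^bsub>M\<^esub> y) \<in> dR_coboundaries n M n"
      using xy coh_class_eq_iff by blast
    then obtain u where u: "u \<in> {..<n} \<rightarrow> carrier M"
      "top_form (x \<ominus>\<^bsub>M\<^esub> y) = top_form (\<Oplus>\<^bsub>M\<^esub>s\<in>{..<n}. partial_op n s \<odot>\<^bsub>M\<^esub> u s)"
      unfolding top_coboundaries by blast
    then have d: "x \<ominus>\<^bsub>M\<^esub> y = (\<Oplus>\<^bsub>M\<^esub>s\<in>{..<n}. partial_op n s \<odot>\<^bsub>M\<^esub> u s)"
      by (metis top_form_apply)
    have "f (x \<ominus>\<^bsub>M\<^esub> y) = 0"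
      unfolding d using u(1) f
      by (subst additive_finsum[of f, OF add]) (auto simp: Pi_iff horizontal_form_def)
    moreover have "x = (x \<ominus>\<^bsub>M\<^esub> y) \<oplus>\<^bsub>M\<^esub> y" using xy by (simp add: M.minus_eq M.a_assoc M.l_neg)
    moreover have "f ((x \<ominus>\<^bsub>M\<^esub> y) \<oplus>\<^bsub>M\<^esub> y) = f (x \<ominus>\<^bsub>M\<^esub> y) + f y" using add xy by simp
    ultimately show "f x = f y" by (metis add_0)
  qed
  define g where "g A = f (SOME x. x \<in> carrier M \<and> coh_class x = A)" for A
  have g: "g (coh_class x) = f x" if "x \<in> carrier M" for x
    unfolding g_def
  proof (rule someI2[of _ x])
    fix y assume "y \<in> carrier M \<and> coh_class y = coh_class x"
    then show "f y = f x" using that eq by blast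
  qed (simp add: that)
  have "linear_form top_cohomology g"
    unfolding linear_form_def coh_class_simps(1)
    using f by (auto simp: coh_class_simps g horizontal_form_def)
  then show thesis using g that by blast
qed

lemma horizontal_form_of_class:
  assumes "linear_form top_cohomology g"
  shows "horizontal_form (\<lambda>x. g (coh_class x))"
  unfolding horizontal_form_def
proof (intro conjI ballI allI impI)
  fix x assume x: "x \<in> carrier M"
  then have cx: "coh_class x \<in> carrier top_cohomology" by (simp add: coh_class_simps)
  show "g (coh_class (x \<oplus>\<^bsub>M\<^esub> y)) = g (coh_class x) + g (coh_class y)" if "y \<in> carrier M" for y
    using assms x that unfolding linear_form_def
    by (auto simp: coh_class_simps(1) coh_class_simps(2)[symmetric])
  have sm: "g (coh_class (const_op n c \<odot>\<^bsub>M\<^esub> x)) = c * g (coh_class x)" if "x \<in> carrier M" for c x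
    using assms that unfolding linear_form_def
    by (auto simp: coh_class_simps(1) coh_class_simps(3)[symmetric])
  then show "g (coh_class (const_op n c \<odot>\<^bsub>M\<^esub> x)) = c * g (coh_class x)" for c using x by blast
  have z: "const_op n 0 \<odot>\<^bsub>M\<^esub> \<zero>\<^bsub>M\<^esub> = \<zero>\<^bsub>M\<^esub>" by (simp add: smult_r_null)
  have 0: "g (coh_class \<zero>\<^bsub>M\<^esub>) = 0" using sm[of "\<zero>\<^bsub>M\<^esub>" 0] z by simp
  have mz: "\<ominus>\<^bsub>M\<^esub> \<zero>\<^bsub>M\<^esub> = \<zero>\<^bsub>M\<^esub>" by (rule M.minus_equality) simp_all
  fix j assume j: "j < n"
  \<comment> \<open>A family concentrated at \<open>j\<close> exhibits a single derivative as a
    coboundary.\<close>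
  have "(\<Oplus>\<^bsub>M\<^esub>s\<in>{..<n}. partial_op n s \<odot>\<^bsub>M\<^esub> (if s = j then x else \<zero>\<^bsub>M\<^esub>)) =
      (\<Oplus>\<^bsub>M\<^esub>s\<in>{..<n}. if j = s then partial_op n s \<odot>\<^bsub>M\<^esub> x else \<zero>\<^bsub>M\<^esub>)"
    using x by (intro M.finsum_cong') (auto simp: smult_r_null)
  also have "\<dots> = partial_op n j \<odot>\<^bsub>M\<^esub> x"
    using M.add.finprod_singleton[of j "{..<n}" "\<lambda>s. partial_op n s \<odot>\<^bsub>M\<^esub> x"] j x by auto
  finally have "top_form (partial_op n j \<odot>\<^bsub>M\<^esub> x) \<in> dR_coboundaries n M n"
    unfolding top_coboundaries using x
    by (intro CollectI exI[of _ "\<lambda>s. if s = j then x else \<zero>\<^bsub>M\<^esub>"]) auto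
  moreover have "partial_op n j \<odot>\<^bsub>M\<^esub> x \<ominus>\<^bsub>M\<^esub> \<zero>\<^bsub>M\<^esub> = partial_op n j \<odot>\<^bsub>M\<^esub> x"
    unfolding a_minus_def mz by (rule M.r_zero) (use j x in auto)
  ultimately have "coh_class (partial_op n j \<odot>\<^bsub>M\<^esub> x) = coh_class \<zero>\<^bsub>M\<^esub>"
    using j x coh_class_eq_iff by simp
  then show "g (coh_class (partial_op n j \<odot>\<^bsub>M\<^esub> x)) = 0" using 0 by simp
qed

text \<open>Applied twice: to the residues of a surjection, bounding \<open>s\<close>, and to the
  homogeneous components of one form, bounding the number of degrees in which it is nonzero.\<close>

lemma horizontal_dual_system_le_dim:
  assumes "vectorspace.fin_dim class_ring top_cohomology"
    and v: "\<And>i. i < s \<Longrightarrow> v i \<in> carrier M"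
    and f: "\<And>j. j < s \<Longrightarrow> horizontal_form (f j)"
    and dual: "\<And>i j. i < s \<Longrightarrow> j < s \<Longrightarrow> f j (v i) = (if i = j then 1 else 0)"
  shows "s \<le> vectorspace.dim class_ring top_cohomology"
proof -
  have "\<forall>j. \<exists>g. j < s \<longrightarrow> linear_form top_cohomology g \<and> (\<forall>x\<in>carrier M. g (coh_class x) = f j x)"
    by (metis f horizontal_form_descends)
  then obtain g where "\<And>j. j < s \<Longrightarrow> linear_form top_cohomology (g j)"
    "\<And>j x. j < s \<Longrightarrow> x \<in> carrier M \<Longrightarrow> g j (coh_class x) = f j x" by metis
  then show ?thesis
    using v dual
    by (intro dual_system_card_le_dim[OF top_cohomology_vectorspace assms(1), of s "\<lambda>i. coh_class (v i)" g])
       (auto simp: coh_class_simps)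
qed

lemma horizontal_dual_basis:
  assumes "vectorspace.fin_dim class_ring top_cohomology"
  defines "d \<equiv> vectorspace.dim class_ring top_cohomology"
  obtains v f where "\<And>i. i < d \<Longrightarrow> v i \<in> carrier M" "\<And>j. j < d \<Longrightarrow> horizontal_form (f j)"
    "\<And>i j. i < d \<Longrightarrow> j < d \<Longrightarrow> f j (v i) = (if i = j then 1 else 0)"
proof (rule dual_basis_exists[OF top_cohomology_vectorspace assms(1), folded d_def])
  fix w g
  assume w: "\<And>i. i < d \<Longrightarrow> w i \<in> carrier top_cohomology"
    and g: "\<And>j. j < d \<Longrightarrow> linear_form top_cohomology (g j)"
    and dual: "\<And>i j. i < d \<Longrightarrow> j < d \<Longrightarrow> g j (w i) = (if i = j then 1 else 0)"
  have "\<forall>i. \<exists>x. i < d \<longrightarrow> x \<in> carrier M \<and> coh_class x = w i"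
    using w unfolding coh_class_simps(1) by (metis imageE)
  then obtain v where "\<And>i. i < d \<Longrightarrow> v i \<in> carrier M" "\<And>i. i < d \<Longrightarrow> coh_class (v i) = w i" by metis
  then show thesis
    using that[of v "\<lambda>j x. g j (coh_class x)"] g dual horizontal_form_of_class by simp
qed

end

section \<open>Inverse polynomials\<close>

lemma inv_exps_iff:
  "e \<in> inv_exps n \<longleftrightarrow>
     (\<forall>i<n. Poly_Mapping.lookup e i \<le> -1) \<and> (\<forall>i\<ge>n. Poly_Mapping.lookup e i = 0)"
  unfolding inv_exps_def by (auto simp: in_keys_iff subset_iff not_le)

lemma lookup_inv_polys:
  "e \<in> inv_polys n \<Longrightarrow> a \<notin> inv_exps n \<Longrightarrow> Poly_Mapping.lookup e a = 0"
  by (auto simp: inv_polys_def in_keys_iff)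

lemma lookup_trunc:
  "Poly_Mapping.lookup (trunc n f) e = (if e \<in> inv_exps n then Poly_Mapping.lookup f e else 0)"
proof (rule additive_eqI)
  fix a c
  show "Poly_Mapping.lookup (trunc n (Poly_Mapping.single a c)) e =
      (if e \<in> inv_exps n then Poly_Mapping.lookup (Poly_Mapping.single a c) e else 0)"
    by (auto simp: trunc_single lookup_single when_def)
qed (auto simp: trunc_add lookup_add)

lemma lookup_xL_mult:
  "Poly_Mapping.lookup (xL j * f) e = Poly_Mapping.lookup f (e - Poly_Mapping.single j 1)"
proof (rule additive_eqI)
  fix a :: "nat \<Rightarrow>\<^sub>0 int" and c :: 'a
  have "Poly_Mapping.single j 1 + a = e \<longleftrightarrow> a = e - Poly_Mapping.single j 1"
    by (auto simp: algebra_simps)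
  then show "Poly_Mapping.lookup (xL j * Poly_Mapping.single a c) e =
      Poly_Mapping.lookup (Poly_Mapping.single a c) (e - Poly_Mapping.single j 1)"
    by (simp add: xL_def mult_single lookup_single when_def)
qed (auto simp: lookup_add algebra_simps)

lemma lookup_dL:
  "Poly_Mapping.lookup (dL j f) e =
     of_int (Poly_Mapping.lookup e j + 1) * Poly_Mapping.lookup f (e + Poly_Mapping.single j 1)"
proof (rule additive_eqI)
  fix a :: "nat \<Rightarrow>\<^sub>0 int" and c :: 'a
  have "a - Poly_Mapping.single j 1 = e \<longleftrightarrow> a = e + Poly_Mapping.single j 1"
    by (auto simp: algebra_simps)
  then show "Poly_Mapping.lookup (dL j (Poly_Mapping.single a c)) e =
      of_int (Poly_Mapping.lookup e j + 1) *
        Poly_Mapping.lookup (Poly_Mapping.single a c) (e + Poly_Mapping.single j 1)"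
    by (simp add: dL_def msum_single lookup_single when_def lookup_add)
qed (auto simp: dL_linear lookup_add algebra_simps)

text \<open>The exponent of the residue monomial \<open>(x\<^sub>0 \<cdots> x\<^bsub>n-1\<^esub>)\<^sup>-\<^sup>1\<close>.\<close>

definition corner :: "nat \<Rightarrow> (nat \<Rightarrow>\<^sub>0 int)" where
  "corner n = (\<Sum>i<n. Poly_Mapping.single i (-1))"

lemma lookup_corner: "Poly_Mapping.lookup (corner n) i = (if i < n then -1 else 0)"
  by (simp add: corner_def lookup_sum lookup_single when_def)

lemma corner_in: "corner n \<in> inv_exps n"
  by (simp add: inv_exps_iff lookup_corner)

lemma inv_exps_not_corner:
  assumes "e \<in> inv_exps n" "e \<noteq> corner n"
  obtains j where "j < n" "Poly_Mapping.lookup e j < -1"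
proof -
  have "\<exists>j. Poly_Mapping.lookup e j \<noteq> Poly_Mapping.lookup (corner n) j"
    using assms(2) by (metis poly_mapping_eqI)
  then obtain j where j: "Poly_Mapping.lookup e j \<noteq> Poly_Mapping.lookup (corner n) j" ..
  then have "j < n" using assms(1) by (metis inv_exps_iff lookup_corner not_le)
  moreover then have "Poly_Mapping.lookup e j \<le> -1" using assms(1) by (simp add: inv_exps_iff)
  moreover have "Poly_Mapping.lookup e j \<noteq> -1" using j \<open>j < n\<close> by (simp add: lookup_corner)
  ultimately show thesis by (intro that[of j]) auto
qed

text \<open>The monomial x^e is an eigenvector with eigenvalue e_j + 1, so the exponent -1 at
  \<open>j\<close> is singled out by the eigenvalue 0.\<close>

definition residue_op :: "nat \<Rightarrow> nat \<Rightarrow> 'k::field laurent \<Rightarrow> 'k laurent" where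
  "residue_op n j f = dL j (trunc n (xL j * f))"

lemma lookup_residue_op:
  assumes j: "j < n" and f: "f \<in> inv_polys n"
  shows "Poly_Mapping.lookup (residue_op n j f) e =
    of_int (Poly_Mapping.lookup e j + 1) * Poly_Mapping.lookup f e"
\<comment> \<open>Under this condition both sides vanish: at exponent -1 by the factor e_j + 1,
  outside \<open>inv_exps n\<close> because raising an exponent does not lead back into it.\<close>
proof (cases "Poly_Mapping.lookup e j = -1 \<or> e \<notin> inv_exps n")
  case False
  then have "e + Poly_Mapping.single j 1 \<in> inv_exps n"
    by (auto simp: inv_exps_iff lookup_add lookup_single when_def) (force dest: spec[of _ j] simp: j)
  then show ?thesis by (simp add: residue_op_def lookup_dL lookup_trunc lookup_xL_mult)
next
  case True
  have "e + Poly_Mapping.single j 1 \<notin> inv_exps n" if "e \<notin> inv_exps n"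
  proof
    assume *: "e + Poly_Mapping.single j 1 \<in> inv_exps n"
    have "Poly_Mapping.lookup e i \<le> Poly_Mapping.lookup (e + Poly_Mapping.single j 1) i"
      "i \<ge> n \<Longrightarrow> Poly_Mapping.lookup e i = Poly_Mapping.lookup (e + Poly_Mapping.single j 1) i" for i
      using j by (auto simp: lookup_add lookup_single when_def)
    then have "e \<in> inv_exps n" using * unfolding inv_exps_iff by (metis order_trans)
    then show False using that by simp
  qed
  then show ?thesis using True lookup_inv_polys[OF f, of e]
    by (auto simp: residue_op_def lookup_dL lookup_trunc)
qed

text \<open>\<open>J\<close> stands for a submodule of the \<open>s\<close>-fold power of E, as a
  predicate on sequences of which only the entries below \<open>s\<close> count
  (\<open>J_cong\<close>). Closure is asked for constants, variables and derivations, which generate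
  the operators.\<close>

locale inv_poly_vectors =
  fixes n s :: nat and J :: "(nat \<Rightarrow> 'k::field_char_0 laurent) \<Rightarrow> bool"
  assumes J_inv_polys: "J u \<Longrightarrow> i < s \<Longrightarrow> u i \<in> inv_polys n"
    and J_cong: "J u \<Longrightarrow> (\<And>i. i < s \<Longrightarrow> u i = v i) \<Longrightarrow> J v"
    and J_zero: "J (\<lambda>_. 0)"
    and J_add: "J u \<Longrightarrow> J v \<Longrightarrow> J (\<lambda>i. u i + v i)"
    and J_scale: "J u \<Longrightarrow> J (\<lambda>i. scale c (u i))"
    and J_var: "J u \<Longrightarrow> j < n \<Longrightarrow> J (\<lambda>i. trunc n (xL j * u i))"
    and J_partial: "J u \<Longrightarrow> j < n \<Longrightarrow> J (\<lambda>i. dL j (u i))"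
begin

text \<open>
  The operator \<open>b\<^sup>-\<^sup>1 (\<partial>\<^sub>j x\<^sub>j + b)\<close> fixes the monomials whose exponent at \<open>j\<close> is \<open>-1\<close> and kills those
  whose exponent at \<open>j\<close> is \<open>-1 - b\<close>; applying such operators isolates the residue monomial.
\<close>

lemma residue_isolation:
  assumes "J u"
  shows "J (\<lambda>i. Poly_Mapping.single (corner n) (Poly_Mapping.lookup (u i) (corner n)))"
  using assms
\<comment> \<open>The measure counts the unwanted monomials of all components together, since one
  operator acts on every component at once.\<close>
proof (induction "card ((\<Union>i<s. Poly_Mapping.keys (u i)) - {corner n})" arbitrary: u
    rule: less_induct)
  case less
  let ?S = "\<lambda>u :: nat \<Rightarrow> 'k laurent. (\<Union>i<s. Poly_Mapping.keys (u i)) - {corner n}"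
  show ?case
  proof (cases "?S u = {}")
    case True
    show ?thesis
    proof (rule J_cong[OF less.prems])
      fix i assume "i < s"
      then have "e \<notin> Poly_Mapping.keys (u i)" if "e \<noteq> corner n" for e
        using True that by blast
      then have "Poly_Mapping.lookup (u i) e = 0" if "e \<noteq> corner n" for e
        using that by (simp add: in_keys_iff)
      then show "u i = Poly_Mapping.single (corner n) (Poly_Mapping.lookup (u i) (corner n))"
        by (intro poly_mapping_eqI) (simp add: lookup_single when_def)
    qed
  next
    case False
    then obtain e i where e: "e \<noteq> corner n" "i < s" "e \<in> Poly_Mapping.keys (u i)" by blast
    then have "e \<in> inv_exps n" using J_inv_polys[OF less.prems] by (auto simp: inv_polys_def)
    then obtain j where j: "j < n" "Poly_Mapping.lookup e j < -1"
      using inv_exps_not_corner e(1) by blast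
    define b :: 'k where "b = of_int (- Poly_Mapping.lookup e j - 1)"
    \<comment> \<open>The integer -e_j - 1 is positive, hence nonzero in characteristic
      zero.\<close>
    have b: "b \<noteq> 0" using j unfolding b_def of_int_eq_0_iff by simp
    define v where "v i = scale (1 / b) (residue_op n j (u i) + scale b (u i))" for i
    have "J v"
      unfolding v_def residue_op_def using less.prems j by (intro J_scale J_add J_partial J_var)
    have v: "Poly_Mapping.lookup (v i) a =
        (of_int (Poly_Mapping.lookup a j + 1) + b) / b * Poly_Mapping.lookup (u i) a"
      if "i < s" for i a
      using lookup_residue_op[OF j(1) J_inv_polys[OF less.prems that]] b
      by (simp add: v_def lookup_add field_simps)
    have vc: "Poly_Mapping.lookup (v i) (corner n) = Poly_Mapping.lookup (u i) (corner n)"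
      if "i < s" for i
      using j b by (simp add: v[OF that] lookup_corner)
    \<comment> \<open>Coefficients are only rescaled, so no new monomial appears, and the factor at
      \<open>e\<close> is zero.\<close>
    have "of_int (Poly_Mapping.lookup e j + 1) + b = 0" by (simp add: b_def)
    then have "e \<notin> ?S v" by (auto simp: in_keys_iff v)
    moreover have "?S v \<subseteq> ?S u" by (auto simp: in_keys_iff v)
    moreover have "e \<in> ?S u" using e by blast
    ultimately have "?S v \<subset> ?S u" by blast
    then have "card (?S v) < card (?S u)" by (intro psubset_card_mono) auto
    then have "J (\<lambda>i. Poly_Mapping.single (corner n) (Poly_Mapping.lookup (v i) (corner n)))"
      using less.hyps \<open>J v\<close> by blast
    then show ?thesis by (rule J_cong) (simp add: vc)
  qed
qed

section \<open>Generating the whole power from unit residue vectors\<close>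

context
  assumes residues: "\<And>k. k < s \<Longrightarrow> \<exists>u. J u \<and>
    (\<forall>i<s. Poly_Mapping.lookup (u i) (corner n) = (if i = k then 1 else 0))"
begin

text \<open>Induction on the total pole order. Away from the residue monomial some exponent e_j is
  below -1, and x^e is the derivative of the monomial with that exponent raised by one, divided by
  e_j + 1; this division is why \<open>c\<close> has to vary.\<close>

lemma J_monomial:
  assumes k: "k < s" and e: "e \<in> inv_exps n"
  shows "J (\<lambda>i. if i = k then Poly_Mapping.single e c else 0)"
  using e
proof (induction "\<Sum>j<n. nat (- Poly_Mapping.lookup e j)" arbitrary: e c rule: less_induct)
  case less
  show ?case
  proof (cases "e = corner n")
    case True
    obtain u where u: "J u"
      "\<And>i. i < s \<Longrightarrow> Poly_Mapping.lookup (u i) (corner n) = (if i = k then 1 else 0)"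
      using residues[OF k] by blast
    \<comment> \<open>By the choice of \<open>u\<close>, its residue part is the residue monomial in
      place \<open>k\<close> and zero elsewhere.\<close>
    have "J (\<lambda>i. scale c (Poly_Mapping.single (corner n) (Poly_Mapping.lookup (u i) (corner n))))"
      by (intro J_scale residue_isolation u)
    then show ?thesis by (rule J_cong) (simp add: u True scale_single)
  next
    case False
    obtain j where j: "j < n" "Poly_Mapping.lookup e j < -1"
      using inv_exps_not_corner[OF less.prems False] .
    define a where "a = e + Poly_Mapping.single j 1"
    have la: "Poly_Mapping.lookup a i =
        (if i = j then Poly_Mapping.lookup e i + 1 else Poly_Mapping.lookup e i)" for i
      by (simp add: a_def lookup_add lookup_single when_def)
    have "a \<in> inv_exps n" using less.prems j by (auto simp: inv_exps_iff la)
    moreover have "(\<Sum>i<n. nat (- Poly_Mapping.lookup a i)) < (\<Sum>i<n. nat (- Poly_Mapping.lookup e i))"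
      by (rule sum_strict_mono_ex1) (use j in \<open>auto simp: la intro!: bexI[of _ j]\<close>)
    ultimately have *: "J (\<lambda>i. if i = k then Poly_Mapping.single a d else 0)" for d
      using less.hyps by blast
    define l :: 'k where "l = of_int (Poly_Mapping.lookup a j)"
    \<comment> \<open>The integer e_j + 1 is negative, hence invertible in characteristic
      zero.\<close>
    have l: "l \<noteq> 0" using j unfolding l_def of_int_eq_0_iff la by simp
    have "dL j (Poly_Mapping.single a (c / l)) = Poly_Mapping.single e c"
      using l by (simp add: dL_def msum_single flip: l_def) (simp add: a_def)
    moreover have "dL j 0 = 0" by (simp add: dL_def)
    ultimately have "(\<lambda>i. dL j (if i = k then Poly_Mapping.single a (c / l) else 0)) =
        (\<lambda>i. if i = k then Poly_Mapping.single e c else 0)" by auto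
    then show ?thesis using J_partial[OF * j(1), of "c / l"] by simp
  qed
qed

lemma J_all:
  assumes v: "\<And>i. i < s \<Longrightarrow> v i \<in> inv_polys n"
  shows "J v"
proof -
  have *: "J (\<lambda>i. \<Sum>x\<in>X. if i = fst x then Poly_Mapping.single (snd x) (Poly_Mapping.lookup (v (fst x)) (snd x)) else 0)"
    if "finite X" "X \<subseteq> (SIGMA i:{..<s}. Poly_Mapping.keys (v i))" for X
    using that
  proof (induction X rule: finite_induct)
    case (insert x X)
    have x: "fst x < s" "snd x \<in> Poly_Mapping.keys (v (fst x))" using insert.prems by auto
    moreover have "snd x \<in> inv_exps n" using v[OF x(1)] x(2) by (auto simp: inv_polys_def)
    ultimately show ?case using insert J_add[OF J_monomial] by simp
  qed (simp add: J_zero)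
  let ?X = "SIGMA i:{..<s}. Poly_Mapping.keys (v i)"
  show ?thesis
  proof (rule J_cong[OF *[of ?X]])
    fix i assume i: "i < s"
    have "(\<Sum>x\<in>?X. if i = fst x then Poly_Mapping.single (snd x) (Poly_Mapping.lookup (v (fst x)) (snd x)) else 0) =
      (\<Sum>k<s. \<Sum>e\<in>Poly_Mapping.keys (v k). if i = k then Poly_Mapping.single e (Poly_Mapping.lookup (v k) e) else 0)"
      by (subst sum.Sigma) (auto simp: split_def)
    also have "\<dots> = (\<Sum>k<s. if i = k then v k else 0)"
      by (intro sum.cong refl) (simp add: sum_singles)
    also have "\<dots> = v i" using i by simp
    finally show "(\<Sum>x\<in>?X. if i = fst x then Poly_Mapping.single (snd x) (Poly_Mapping.lookup (v (fst x)) (snd x)) else 0) = v i" .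
  qed auto
qed

end

end

section \<open>Differential operators are generated by constants, variables and derivations\<close>

lemma diff_ops_uminus:
  assumes "P \<in> carrier (diff_ops n)"
  shows "\<ominus>\<^bsub>diff_ops n\<^esub> P = \<ominus>\<^bsub>End_k (polys n)\<^esub> P"
proof -
  interpret D: ring "diff_ops n :: 'a operator ring" by (rule diff_ops_ring)
  interpret S: ring "End_k (polys n) :: 'a operator ring" by (rule ring_polys)
  obtain Q where "(P, Q) \<in> E_graph n" using E_graph_ex[OF assms] by blast
  then have "P \<in> carrier (End_k (polys n))" using E_graph_carrier by blast
  then have "(\<ominus>\<^bsub>End_k (polys n)\<^esub> P) \<oplus>\<^bsub>diff_ops n\<^esub> P = \<zero>\<^bsub>diff_ops n\<^esub>"
    unfolding diff_ops_simps by (rule S.l_neg)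
  moreover have "\<ominus>\<^bsub>End_k (polys n)\<^esub> P \<in> carrier (diff_ops n)"
    using assms by (auto simp: diff_ops_def intro: generate_ring.a_inv)
  ultimately show ?thesis using assms by (intro D.minus_equality)
qed

text \<open>The definition of \<open>diff_ops\<close> generates from all polynomial multiplications.
  \<open>E_graph\<close> is generated over the constants, variables and derivations alone, and by
  \<open>E_graph_ex\<close> every operator is a first component of it, so the induction runs over
  the graph.\<close>

lemma diff_ops_induct [consumes 1, case_names const var partial uminus add mult]:
  assumes P: "P \<in> carrier (diff_ops n)"
    and const: "\<And>c. \<Phi> (const_op n c)"
    and var: "\<And>j. j < n \<Longrightarrow> \<Phi> (var_op n j)"
    and partial: "\<And>j. j < n \<Longrightarrow> \<Phi> (partial_op n j)"
    and uminus: "\<And>P. P \<in> carrier (diff_ops n) \<Longrightarrow> \<Phi> P \<Longrightarrow> \<Phi> (\<ominus>\<^bsub>diff_ops n\<^esub> P)"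
    and add: "\<And>P Q. P \<in> carrier (diff_ops n) \<Longrightarrow> Q \<in> carrier (diff_ops n) \<Longrightarrow> \<Phi> P \<Longrightarrow> \<Phi> Q \<Longrightarrow>
      \<Phi> (P \<oplus>\<^bsub>diff_ops n\<^esub> Q)"
    and mult: "\<And>P Q. P \<in> carrier (diff_ops n) \<Longrightarrow> Q \<in> carrier (diff_ops n) \<Longrightarrow> \<Phi> P \<Longrightarrow> \<Phi> Q \<Longrightarrow>
      \<Phi> (P \<otimes>\<^bsub>diff_ops n\<^esub> Q)"
  shows "\<Phi> P"
proof -
  interpret D: ring "diff_ops n :: 'a operator ring" by (rule diff_ops_ring)
  let ?R = "RDirProd (End_k (polys n)) (End_k (inv_polys n)) :: ('a operator \<times> ('a laurent \<Rightarrow> 'a laurent)) ring"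
  interpret R: ring ?R by (rule ring_prod)
  have "z \<in> carrier ?R \<and> fst z \<in> carrier (diff_ops n) \<and> \<Phi> (fst z)" if "z \<in> generate_ring ?R (E_gens n)" for z
    using that
  proof (induction rule: generate_ring.induct)
    case one
    have "\<Phi> \<one>\<^bsub>diff_ops n\<^esub>" using const[of 1] by (simp only: const_op_ring)
    then show ?case using R.one_closed D.one_closed by (simp add: RDirProd_simps diff_ops_simps)
  next
    case (incl h)
    then have "fst h \<in> carrier (diff_ops n) \<and> \<Phi> (fst h)"
      using const var partial by (auto intro: diff_ops_generators)
    then show ?case using E_gens_carrier incl by blast
  next
    case (a_inv h)
    then have c: "fst h \<in> carrier (End_k (polys n))" "snd h \<in> carrier (End_k (inv_polys n))"
      by (auto simp: RDirProd_simps)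
    have "fst (\<ominus>\<^bsub>?R\<^esub> h) = \<ominus>\<^bsub>diff_ops n\<^esub> (fst h)"
      using RDirProd_uminus[OF ring_polys ring_inv c] a_inv.IH by (simp add: diff_ops_uminus)
    then show ?case using a_inv.IH uminus[of "fst h"] by simp
  next
    case (eng_add g h)
    moreover have "fst (g \<oplus>\<^bsub>?R\<^esub> h) = fst g \<oplus>\<^bsub>diff_ops n\<^esub> fst h"
      by (simp add: RDirProd_simps diff_ops_simps)
    ultimately show ?case using add[of "fst g" "fst h"] R.a_closed D.a_closed by (metis (no_types, lifting))
  next
    case (eng_mult g h)
    moreover have "fst (g \<otimes>\<^bsub>?R\<^esub> h) = fst g \<otimes>\<^bsub>diff_ops n\<^esub> fst h"
      by (simp add: RDirProd_simps diff_ops_simps)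
    ultimately show ?case using mult[of "fst g" "fst h"] R.m_closed D.m_closed by (metis (no_types, lifting))
  qed
  moreover obtain Q where "(P, Q) \<in> E_graph n" using E_graph_ex[OF P] by blast
  ultimately show ?thesis unfolding E_graph_def by force
qed

section \<open>Homogeneous components\<close>

sublocale graded_D_module \<subseteq> D_module n M
  by (rule D_module.intro) (rule left_module_axioms)

context graded_D_module
begin

lemma gr_carrier: "x \<in> gr l \<Longrightarrow> x \<in> carrier M"
  using additive_subgroup.a_subset[OF gr_subgroup] by blast

lemma gr_zero: "\<zero>\<^bsub>M\<^esub> \<in> gr l"
  by (rule additive_subgroup.zero_closed[OF gr_subgroup])

definition component :: "'m \<Rightarrow> int \<Rightarrow> 'm" where
  "component x = (THE f. (\<forall>l. f l \<in> gr l) \<and> finite {l. f l \<noteq> \<zero>\<^bsub>M\<^esub>} \<and>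
     x = (\<Oplus>\<^bsub>M\<^esub>l\<in>{l. f l \<noteq> \<zero>\<^bsub>M\<^esub>}. f l))"

lemma component_props:
  assumes "x \<in> carrier M"
  shows component_gr: "component x l \<in> gr l"
    and finite_components: "finite {l. component x l \<noteq> \<zero>\<^bsub>M\<^esub>}"
    and sum_components: "(\<Oplus>\<^bsub>M\<^esub>l\<in>{l. component x l \<noteq> \<zero>\<^bsub>M\<^esub>}. component x l) = x"
  using theI'[OF gr_decomp[OF assms], folded component_def] by simp_all

lemma component_carrier: "x \<in> carrier M \<Longrightarrow> component x l \<in> carrier M"
  using component_gr gr_carrier by blast

lemma sum_components_superset:
  assumes x: "x \<in> carrier M" and A: "finite A" "{l. component x l \<noteq> \<zero>\<^bsub>M\<^esub>} \<subseteq> A"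
  shows "(\<Oplus>\<^bsub>M\<^esub>l\<in>A. component x l) = x"
proof -
  have "(\<Oplus>\<^bsub>M\<^esub>l\<in>{l. component x l \<noteq> \<zero>\<^bsub>M\<^esub>}. component x l) = (\<Oplus>\<^bsub>M\<^esub>l\<in>A. component x l)"
    using A component_carrier[OF x] by (intro M.add.finprod_mono_neutral_cong_left) auto
  then show ?thesis using sum_components[OF x] by simp
qed

text \<open>Uniqueness in \<open>gr_decomp\<close> refers to the exact support, whereas sums and
  shifts of decompositions supply only a finite superset \<open>A\<close>.\<close>

lemma component_eqI:
  assumes f: "\<And>l. f l \<in> gr l" and A: "finite A" "\<And>l. l \<notin> A \<Longrightarrow> f l = \<zero>\<^bsub>M\<^esub>"
    and x: "x = (\<Oplus>\<^bsub>M\<^esub>l\<in>A. f l)"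
  shows "component x = f"
proof -
  have fM: "f l \<in> carrier M" for l using f gr_carrier by blast
  have xM: "x \<in> carrier M" unfolding x using fM by (intro M.finsum_closed) auto
  have sub: "{l. f l \<noteq> \<zero>\<^bsub>M\<^esub>} \<subseteq> A" using A(2) by blast
  have "(\<Oplus>\<^bsub>M\<^esub>l\<in>{l. f l \<noteq> \<zero>\<^bsub>M\<^esub>}. f l) = (\<Oplus>\<^bsub>M\<^esub>l\<in>A. f l)"
    using A sub fM by (intro M.add.finprod_mono_neutral_cong_left) auto
  then have "x = (\<Oplus>\<^bsub>M\<^esub>l\<in>{l. f l \<noteq> \<zero>\<^bsub>M\<^esub>}. f l)" using x by simp
  moreover have "finite {l. f l \<noteq> \<zero>\<^bsub>M\<^esub>}" using sub A(1) by (rule finite_subset)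
  ultimately show ?thesis
    unfolding component_def using f by (intro the1_equality gr_decomp xM) auto
qed

lemma component_homogeneous:
  assumes "x \<in> gr l"
  shows "component x k = (if k = l then x else \<zero>\<^bsub>M\<^esub>)"
proof -
  have "component x = (\<lambda>k. if k = l then x else \<zero>\<^bsub>M\<^esub>)"
  proof (rule component_eqI[of _ "{l}"])
    show "(if k = l then x else \<zero>\<^bsub>M\<^esub>) \<in> gr k" for k using assms gr_zero by simp
    have "(\<Oplus>\<^bsub>M\<^esub>k\<in>{l}. if k = l then x else \<zero>\<^bsub>M\<^esub>) = (if l = l then x else \<zero>\<^bsub>M\<^esub>) \<oplus>\<^bsub>M\<^esub> (\<Oplus>\<^bsub>M\<^esub>k\<in>{}. if k = l then x else \<zero>\<^bsub>M\<^esub>)"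
      using gr_carrier[OF assms] by (intro M.finsum_insert) auto
    then show "x = (\<Oplus>\<^bsub>M\<^esub>k\<in>{l}. if k = l then x else \<zero>\<^bsub>M\<^esub>)"
      using gr_carrier[OF assms] by simp
  qed auto
  then show ?thesis by simp
qed

lemma component_add:
  assumes "x \<in> carrier M" "y \<in> carrier M"
  shows "component (x \<oplus>\<^bsub>M\<^esub> y) l = component x l \<oplus>\<^bsub>M\<^esub> component y l"
proof -
  let ?A = "{l. component x l \<noteq> \<zero>\<^bsub>M\<^esub>} \<union> {l. component y l \<noteq> \<zero>\<^bsub>M\<^esub>}"
  have A: "finite ?A" using finite_components assms by simp
  have "component (x \<oplus>\<^bsub>M\<^esub> y) = (\<lambda>l. component x l \<oplus>\<^bsub>M\<^esub> component y l)"
  proof (rule component_eqI[OF _ A])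
    show "component x l \<oplus>\<^bsub>M\<^esub> component y l \<in> gr l" for l
      using component_gr assms by (intro additive_subgroup.a_closed[OF gr_subgroup]) auto
    have "(\<Oplus>\<^bsub>M\<^esub>l\<in>?A. component x l \<oplus>\<^bsub>M\<^esub> component y l) =
        (\<Oplus>\<^bsub>M\<^esub>l\<in>?A. component x l) \<oplus>\<^bsub>M\<^esub> (\<Oplus>\<^bsub>M\<^esub>l\<in>?A. component y l)"
      using component_carrier assms by (intro M.finsum_addf) auto
    also have "\<dots> = x \<oplus>\<^bsub>M\<^esub> y"
      using sum_components_superset[OF assms(1) A] sum_components_superset[OF assms(2) A] by simp
    finally show "x \<oplus>\<^bsub>M\<^esub> y = (\<Oplus>\<^bsub>M\<^esub>l\<in>?A. component x l \<oplus>\<^bsub>M\<^esub> component y l)" by simp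
  qed auto
  then show ?thesis by simp
qed

lemma smult_finsum:
  assumes P: "P \<in> carrier (diff_ops n)" and A: "finite A" "g \<in> A \<rightarrow> carrier M"
  shows "P \<odot>\<^bsub>M\<^esub> (\<Oplus>\<^bsub>M\<^esub>a\<in>A. g a) = (\<Oplus>\<^bsub>M\<^esub>a\<in>A. P \<odot>\<^bsub>M\<^esub> g a)"
  using A
proof (induction A rule: finite_induct)
  case (insert a A)
  then show ?case using P by (simp add: Pi_iff smult_r_distr M.finsum_closed)
qed (simp add: smult_r_null P)

lemma component_smult:
  assumes P: "P \<in> carrier (diff_ops n)" and shift: "\<And>l x. x \<in> gr l \<Longrightarrow> P \<odot>\<^bsub>M\<^esub> x \<in> gr (l + d)"
    and x: "x \<in> carrier M"
  shows "component (P \<odot>\<^bsub>M\<^esub> x) (l + d) = P \<odot>\<^bsub>M\<^esub> component x l"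
proof -
  let ?A = "{l. component x l \<noteq> \<zero>\<^bsub>M\<^esub>}"
  have c: "component x l \<in> carrier M" for l using component_carrier[OF x] .
  have "component (P \<odot>\<^bsub>M\<^esub> x) = (\<lambda>l. P \<odot>\<^bsub>M\<^esub> component x (l - d))"
  proof (rule component_eqI[of _ "(\<lambda>l. l + d) ` ?A"])
    show "P \<odot>\<^bsub>M\<^esub> component x (l - d) \<in> gr l" for l
      using shift[OF component_gr[OF x], of "l - d"] by simp
    show "finite ((\<lambda>l. l + d) ` ?A)" using finite_components[OF x] by simp
    show "P \<odot>\<^bsub>M\<^esub> component x (l - d) = \<zero>\<^bsub>M\<^esub>" if "l \<notin> (\<lambda>l. l + d) ` ?A" for l
    proof -
      have "component x (l - d) = \<zero>\<^bsub>M\<^esub>" using that by (auto simp: image_iff dest: spec[of _ "l - d"])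
      then show ?thesis by (simp add: smult_r_null P)
    qed
    have "P \<odot>\<^bsub>M\<^esub> x = P \<odot>\<^bsub>M\<^esub> (\<Oplus>\<^bsub>M\<^esub>l\<in>?A. component x l)" by (simp add: sum_components[OF x])
    also have "\<dots> = (\<Oplus>\<^bsub>M\<^esub>l\<in>?A. P \<odot>\<^bsub>M\<^esub> component x l)"
      using c by (intro smult_finsum P finite_components x) auto
    also have "\<dots> = (\<Oplus>\<^bsub>M\<^esub>l\<in>?A. P \<odot>\<^bsub>M\<^esub> component x (l + d - d))" by simp
    also have "\<dots> = (\<Oplus>\<^bsub>M\<^esub>l\<in>(\<lambda>l. l + d) ` ?A. P \<odot>\<^bsub>M\<^esub> component x (l - d))"
      using c P by (intro M.add.finprod_reindex[symmetric]) auto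
    finally show "P \<odot>\<^bsub>M\<^esub> x = (\<Oplus>\<^bsub>M\<^esub>l\<in>(\<lambda>l. l + d) ` ?A. P \<odot>\<^bsub>M\<^esub> component x (l - d))" .
  qed
  then show ?thesis by simp
qed

text \<open>Constants preserve degrees and derivations lower them by one, so the degree
  \<open>l\<close> part of a derivative is the derivative of the degree \<open>l + 1\<close> part,
  which \<open>f\<close> kills. The factor \<open>c\<close> is for later normalisation.\<close>

lemma horizontal_form_component:
  assumes f: "horizontal_form f"
  shows "horizontal_form (\<lambda>x. c * f (component x l))"
  unfolding horizontal_form_def
proof (intro conjI ballI allI impI)
  fix x assume x: "x \<in> carrier M"
  note cx = component_carrier[OF x]
  show "c * f (component (x \<oplus>\<^bsub>M\<^esub> y) l) = c * f (component x l) + c * f (component y l)"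
    if y: "y \<in> carrier M" for y
    using f cx component_carrier[OF y]
    by (simp add: component_add[OF x y] horizontal_form_def distrib_left)
  fix a
  have "const_op n a \<odot>\<^bsub>M\<^esub> y \<in> gr (k + 0)" if "y \<in> gr k" for k y
    using gr_poly[of "Poly_Mapping.single 0 a" 0 y k] that
    by (auto simp: const_op_def const_polys split: if_splits)
  from component_smult[OF ops_closed(2) this x, of l]
  show "c * f (component (const_op n a \<odot>\<^bsub>M\<^esub> x) l) = a * (c * f (component x l))"
    using f cx by (simp add: horizontal_form_def)
next
  fix j x assume j: "j < n" and x: "x \<in> carrier M"
  have "partial_op n j \<odot>\<^bsub>M\<^esub> y \<in> gr (k + - 1)" if "y \<in> gr k" for k y
    using gr_partial[OF j that] by simp
  from component_smult[OF ops_closed(4)[OF j] this x, of "l + 1"]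
  show "c * f (component (partial_op n j \<odot>\<^bsub>M\<^esub> x) l) = 0"
    using f component_carrier[OF x] j by (simp add: horizontal_form_def)
qed

lemma horizontal_form_finite_degrees:
  assumes fd: "vectorspace.fin_dim class_ring top_cohomology" and f: "horizontal_form f"
  shows "finite {l. \<exists>x\<in>gr l. f x \<noteq> 0}"
proof (rule ccontr)
  let ?F = "{l. \<exists>x\<in>gr l. f x \<noteq> 0}"
  \<comment> \<open>One more than the dimension: the components of \<open>f\<close> in that many
    degrees, divided by \<open>f (m l)\<close>, form a dual system that is too large.\<close>
  define s where "s = Suc (vectorspace.dim class_ring top_cohomology)"
  assume "infinite ?F"
  then obtain B where B: "finite B" "card B = s" "B \<subseteq> ?F"
    using infinite_arbitrarily_large by blast
  then obtain e where e: "bij_betw e {..<s} B"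
    using ex_bij_betw_nat_finite[of B] by (auto simp: atLeast0LessThan)
  define m where "m l = (SOME x. x \<in> gr l \<and> f x \<noteq> 0)" for l
  have m: "m l \<in> gr l \<and> f (m l) \<noteq> 0" if l: "l \<in> ?F" for l
    unfolding m_def by (rule someI_ex) (use l in blast)
  have eF: "e i \<in> ?F" if "i < s" for i using e B(3) that by (auto simp: bij_betw_def)
  have inj: "e i = e j \<longleftrightarrow> i = j" if "i < s" "j < s" for i j
    using e that by (auto simp: bij_betw_def inj_on_eq_iff)
  have "f \<zero>\<^bsub>M\<^esub> = 0" using additive_finsum[of f "{}" "\<lambda>_. \<zero>\<^bsub>M\<^esub>"] f by (simp add: horizontal_form_def)
  have "s \<le> vectorspace.dim class_ring top_cohomology"
  proof (rule horizontal_dual_system_le_dim[OF fd])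
    show "m (e i) \<in> carrier M" if "i < s" for i using m[OF eF[OF that]] gr_carrier by blast
    show "horizontal_form (\<lambda>x. 1 / f (m (e j)) * f (component x (e j)))" if "j < s" for j
      by (rule horizontal_form_component[OF f])
    show "1 / f (m (e j)) * f (component (m (e i)) (e j)) = (if i = j then 1 else 0)"
      if "i < s" "j < s" for i j
      using m[OF eF[OF that(1)]] inj[OF that] \<open>f \<zero>\<^bsub>M\<^esub> = 0\<close>
      by (auto simp: component_homogeneous[OF conjunct1[OF m[OF eF[OF that(1)]]]])
  qed
  then show False by (simp add: s_def)
qed

section \<open>Finiteness of the moments of a horizontal form\<close>

lemma finite_bounded_exponents:
  "finite {a :: nat \<Rightarrow>\<^sub>0 nat. Poly_Mapping.keys a \<subseteq> {..<n} \<and> (\<Sum>j<n. Poly_Mapping.lookup a j) \<le> N}"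
    (is "finite ?S")
proof (rule finite_imageD[of Poly_Mapping.lookup])
  have 1: "Poly_Mapping.lookup a i \<in> {..N}" if "a \<in> ?S" "i \<in> {..<n}" for a i
    using that member_le_sum[of i "{..<n}" "Poly_Mapping.lookup a"] by auto
  have 2: "Poly_Mapping.lookup a i = 0" if "a \<in> ?S" "i \<notin> {..<n}" for a i
    using that by (auto simp: in_keys_iff subset_iff)
  have "Poly_Mapping.lookup ` ?S \<subseteq>
      {f. \<forall>i. (i \<in> {..<n} \<longrightarrow> f i \<in> {..N}) \<and> (i \<notin> {..<n} \<longrightarrow> f i = 0)}"
    by (intro image_subsetI, intro CollectI allI conjI impI) (rule 1 2; assumption)+
  then show "finite (Poly_Mapping.lookup ` ?S)"
    by (rule finite_subset) (intro finite_set_of_finite_funs finite_lessThan finite_atMost)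
  show "inj_on Poly_Mapping.lookup ?S" by (rule inj_onI) (simp add: poly_mapping_eqI)
qed

lemma monomial_smult_gr:
  assumes a: "Poly_Mapping.keys a \<subseteq> {..<n}" and x: "x \<in> gr l"
  shows "mult_op n (Poly_Mapping.single a 1) \<odot>\<^bsub>M\<^esub> x \<in> gr (l + int (\<Sum>j<n. Poly_Mapping.lookup a j))"
  by (rule gr_poly) (use assms in \<open>auto simp: polys_def split: if_splits\<close>)

text \<open>If \<open>f\<close> is nonzero on x^a x, it is nonzero on x^a times some component of
  \<open>x\<close>, of degree \<open>l\<close> say. Then \<open>l\<close> plus the degree of a lies
  in the finite set of degrees met by \<open>f\<close>, which bounds the degree of a.\<close>

lemma finite_moments:
  assumes fd: "vectorspace.fin_dim class_ring top_cohomology" and f: "horizontal_form f"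
    and x: "x \<in> carrier M"
  shows "finite {a. Poly_Mapping.keys a \<subseteq> {..<n} \<and> f (mult_op n (Poly_Mapping.single a 1) \<odot>\<^bsub>M\<^esub> x) \<noteq> 0}"
    (is "finite ?S")
proof -
  let ?F = "{l. \<exists>x\<in>gr l. f x \<noteq> 0}" and ?A = "{l. component x l \<noteq> \<zero>\<^bsub>M\<^esub>}"
  \<comment> \<open>For the pairs that matter, \<open>k - l\<close> is the degree of a monomial, so
    \<open>nat\<close> does not truncate.\<close>
  let ?G = "(\<lambda>(k, l). nat (k - l)) ` (?F \<times> ?A)"
  have G: "finite ?G"
    using horizontal_form_finite_degrees[OF fd f] finite_components[OF x] by simp
  have "(\<Sum>j<n. Poly_Mapping.lookup a j) \<in> ?G" if a: "a \<in> ?S" for a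
  proof -
    let ?m = "mult_op n (Poly_Mapping.single a 1)"
    have m: "?m \<in> carrier (diff_ops n)"
      using a by (intro ops_closed) (auto simp: polys_def split: if_splits)
    have "?m \<odot>\<^bsub>M\<^esub> x = (\<Oplus>\<^bsub>M\<^esub>l\<in>?A. ?m \<odot>\<^bsub>M\<^esub> component x l)"
      using smult_finsum[OF m finite_components[OF x], of "component x"] component_carrier[OF x]
      by (simp add: sum_components[OF x])
    moreover have "f (\<Oplus>\<^bsub>M\<^esub>l\<in>?A. ?m \<odot>\<^bsub>M\<^esub> component x l) = (\<Sum>l\<in>?A. f (?m \<odot>\<^bsub>M\<^esub> component x l))"
      using f m component_carrier[OF x]
      by (intro additive_finsum finite_components x) (auto simp: horizontal_form_def)
    ultimately have "(\<Sum>l\<in>?A. f (?m \<odot>\<^bsub>M\<^esub> component x l)) \<noteq> 0" using a by simp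
    then obtain l where l: "l \<in> ?A" "f (?m \<odot>\<^bsub>M\<^esub> component x l) \<noteq> 0"
      by (rule sum.not_neutral_contains_not_neutral)
    have "?m \<odot>\<^bsub>M\<^esub> component x l \<in> gr (l + int (\<Sum>j<n. Poly_Mapping.lookup a j))"
      using a component_gr[OF x] by (intro monomial_smult_gr) auto
    then have "l + int (\<Sum>j<n. Poly_Mapping.lookup a j) \<in> ?F" using l(2) by blast
    then show ?thesis using l(1)
      by (intro image_eqI[of _ _ "(l + int (\<Sum>j<n. Poly_Mapping.lookup a j), l)"]) (auto simp flip: of_nat_sum)
  qed
  \<comment> \<open>If \<open>?G\<close> is empty then so is \<open>?S\<close>, and the unspecified
    \<open>Max ?G\<close> does no harm.\<close>
  then have "?S \<subseteq> {a. Poly_Mapping.keys a \<subseteq> {..<n} \<and> (\<Sum>j<n. Poly_Mapping.lookup a j) \<le> Max ?G}"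
    using Max_ge[OF G] by blast
  then show ?thesis by (rule finite_subset) (rule finite_bounded_exponents)
qed

end

section \<open>Maps into the module of inverse polynomials\<close>

text \<open>For \<open>e\<close> in \<open>inv_exps n\<close>, the exponent \<open>a\<close> with \<open>x\<^sup>e = x\<^sup>-\<^sup>a\<^sup>-\<^sup>1\<close>.\<close>

definition nexp :: "nat \<Rightarrow> (nat \<Rightarrow>\<^sub>0 int) \<Rightarrow> (nat \<Rightarrow>\<^sub>0 nat)" where
  "nexp n e = Poly_Mapping.map nat (corner n - e)"

lemma lookup_nexp:
  "Poly_Mapping.lookup (nexp n e) i =
     nat ((if i < n then -1 else 0) - Poly_Mapping.lookup e i)"
  by (simp add: nexp_def Poly_Mapping.map.rep_eq when_def lookup_minus lookup_corner)

lemma keys_nexp: "e \<in> inv_exps n \<Longrightarrow> Poly_Mapping.keys (nexp n e) \<subseteq> {..<n}"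
  by (auto simp: in_keys_iff lookup_nexp inv_exps_iff split: if_splits)

lemma nexp_corner: "nexp n (corner n) = 0"
  by (rule poly_mapping_eqI) (simp add: lookup_nexp lookup_corner)

lemma inj_on_nexp: "inj_on (nexp n) (inv_exps n)"
proof (rule inj_onI, rule poly_mapping_eqI)
  fix e e' i assume e: "e \<in> inv_exps n" "e' \<in> inv_exps n" "nexp n e = nexp n e'"
  then have "Poly_Mapping.lookup (nexp n e) i = Poly_Mapping.lookup (nexp n e') i" by simp
  then show "Poly_Mapping.lookup e i = Poly_Mapping.lookup e' i"
  proof (cases "i < n")
    case True
    then have "Poly_Mapping.lookup e i \<le> -1" "Poly_Mapping.lookup e' i \<le> -1"
      using e(1,2) by (simp_all add: inv_exps_iff)
    then show ?thesis
      using True \<open>Poly_Mapping.lookup (nexp n e) i = _\<close> by (simp add: lookup_nexp)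
  qed (use e(1,2) in \<open>simp add: inv_exps_iff\<close>)
qed

lemma nexp_minus:
  assumes "e \<in> inv_exps n" "j < n"
  shows "nexp n (e - Poly_Mapping.single j 1) = nexp n e + Poly_Mapping.single j 1"
  using assms
  by (intro poly_mapping_eqI)
     (auto simp: lookup_nexp lookup_add lookup_minus lookup_single when_def inv_exps_iff)

lemma dP_monomial_mult:
  "dP j (Poly_Mapping.single a 1 * p) = Poly_Mapping.single a 1 * dP j p +
     scale (of_nat (Poly_Mapping.lookup a j)) (Poly_Mapping.single (a - Poly_Mapping.single j 1) 1 * p)"
proof (rule additive_eqI[where f = p])
  fix b and c :: 'a
  let ?e = "Poly_Mapping.single j (1::nat)"
  \<comment> \<open>Truncated subtraction moves past the sum when the exponent concerned is
    positive; when it is zero, so is the coefficient in front.\<close>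
  have 1: "a + b - ?e = a - ?e + b" if "Poly_Mapping.lookup a j \<noteq> 0"
    using that by (intro poly_mapping_eqI) (auto simp: lookup_add lookup_minus lookup_single when_def)
  have 2: "a + b - ?e = a + (b - ?e)" if "Poly_Mapping.lookup b j \<noteq> 0"
    using that by (intro poly_mapping_eqI) (auto simp: lookup_add lookup_minus lookup_single when_def)
  have "Poly_Mapping.single (a + b - ?e) (of_nat (Poly_Mapping.lookup a j) * c) =
      Poly_Mapping.single (a - ?e + b) (of_nat (Poly_Mapping.lookup a j) * c)"
  proof (cases "Poly_Mapping.lookup a j = 0")
    case False
    then show ?thesis by (simp only: 1[OF False])
  qed simp
  moreover have "Poly_Mapping.single (a + b - ?e) (of_nat (Poly_Mapping.lookup b j) * c) =
      Poly_Mapping.single (a + (b - ?e)) (of_nat (Poly_Mapping.lookup b j) * c)"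
  proof (cases "Poly_Mapping.lookup b j = 0")
    case False
    then show ?thesis by (simp only: 2[OF False])
  qed simp
  ultimately show "dP j (Poly_Mapping.single a 1 * Poly_Mapping.single b c) =
      Poly_Mapping.single a 1 * dP j (Poly_Mapping.single b c) +
      scale (of_nat (Poly_Mapping.lookup a j)) (Poly_Mapping.single (a - ?e) 1 * Poly_Mapping.single b c)"
    by (simp add: dP_def mult_single msum_single scale_single lookup_add distrib_right single_add)
qed (auto simp: dP_linear scale_simps algebra_simps)

abbreviation monomial_op :: "nat \<Rightarrow> (nat \<Rightarrow>\<^sub>0 nat) \<Rightarrow> 'k::field operator" where
  "monomial_op n a \<equiv> mult_op n (Poly_Mapping.single a 1)"

lemma monomial_polys: "Poly_Mapping.keys a \<subseteq> {..<n} \<Longrightarrow> Poly_Mapping.single a c \<in> polys n"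
  by (auto simp: polys_def split: if_splits)

lemma partial_monomial_op:
  assumes a: "Poly_Mapping.keys a \<subseteq> {..<n}"
  shows "partial_op n j \<otimes>\<^bsub>diff_ops n\<^esub> monomial_op n a =
    monomial_op n a \<otimes>\<^bsub>diff_ops n\<^esub> partial_op n j \<oplus>\<^bsub>diff_ops n\<^esub>
    const_op n (of_nat (Poly_Mapping.lookup a j)) \<otimes>\<^bsub>diff_ops n\<^esub> monomial_op n (a - Poly_Mapping.single j 1)"
proof -
  have "Poly_Mapping.keys (a - Poly_Mapping.single j 1) \<subseteq> {..<n}"
    using keys_nat_minus a by blast
  then have "Poly_Mapping.single a 1 * p \<in> polys n"
    "Poly_Mapping.single (a - Poly_Mapping.single j 1) 1 * p \<in> polys n"
    if "p \<in> polys n" for p :: "'a mpoly"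
    using a that by (auto intro!: polys_mult monomial_polys)
  then show ?thesis
    by (auto simp: diff_ops_simps End_k_simps mult_op_def partial_op_eq const_op_eq compose_def
        polys_d dP_monomial_mult intro!: restrict_ext)
qed

lemma monomial_op_var:
  assumes "Poly_Mapping.keys a \<subseteq> {..<n}" "j < n"
  shows "monomial_op n a \<otimes>\<^bsub>diff_ops n\<^esub> var_op n j = monomial_op n (a + Poly_Mapping.single j 1)"
  unfolding var_op_def diff_ops_simps using assms
  by (subst mult_op_mult[symmetric]) (auto simp: mult_single intro!: monomial_polys x_polys)

lemma E_mod_simps:
  "carrier (E_mod n) = inv_polys n" "x \<oplus>\<^bsub>E_mod n\<^esub> y = x + y" "\<zero>\<^bsub>E_mod n\<^esub> = 0"
  by (simp_all add: E_mod_def)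

lemma D_linear_if_generators:
  assumes N: "left_module (diff_ops n) N" and L: "left_module (diff_ops n) L"
    and T: "\<And>x. x \<in> carrier N \<Longrightarrow> T x \<in> carrier L"
      "\<And>x y. x \<in> carrier N \<Longrightarrow> y \<in> carrier N \<Longrightarrow> T (x \<oplus>\<^bsub>N\<^esub> y) = T x \<oplus>\<^bsub>L\<^esub> T y"
    and const: "\<And>c x. x \<in> carrier N \<Longrightarrow> T (const_op n c \<odot>\<^bsub>N\<^esub> x) = const_op n c \<odot>\<^bsub>L\<^esub> T x"
    and var: "\<And>j x. j < n \<Longrightarrow> x \<in> carrier N \<Longrightarrow> T (var_op n j \<odot>\<^bsub>N\<^esub> x) = var_op n j \<odot>\<^bsub>L\<^esub> T x"
    and partial: "\<And>j x. j < n \<Longrightarrow> x \<in> carrier N \<Longrightarrow>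
      T (partial_op n j \<odot>\<^bsub>N\<^esub> x) = partial_op n j \<odot>\<^bsub>L\<^esub> T x"
    and P: "P \<in> carrier (diff_ops n)" and x: "x \<in> carrier N"
  shows "T (P \<odot>\<^bsub>N\<^esub> x) = P \<odot>\<^bsub>L\<^esub> T x"
  using P x
proof (induction arbitrary: x rule: diff_ops_induct)
  interpret N: left_module "diff_ops n" N by (rule N)
  interpret L: left_module "diff_ops n" L by (rule L)
  {
    case (uminus P)
    have "T \<zero>\<^bsub>N\<^esub> \<oplus>\<^bsub>L\<^esub> T \<zero>\<^bsub>N\<^esub> = T \<zero>\<^bsub>N\<^esub>"
      using T(2)[of "\<zero>\<^bsub>N\<^esub>" "\<zero>\<^bsub>N\<^esub>"] by simp
    then have T0: "T \<zero>\<^bsub>N\<^esub> = \<zero>\<^bsub>L\<^esub>" using T(1)[of "\<zero>\<^bsub>N\<^esub>"] by simp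
    have Px: "P \<odot>\<^bsub>N\<^esub> x \<in> carrier N" using uminus by blast
    have "\<ominus>\<^bsub>L\<^esub> T (P \<odot>\<^bsub>N\<^esub> x) = T (\<ominus>\<^bsub>N\<^esub> (P \<odot>\<^bsub>N\<^esub> x))"
      using Px T by (intro L.M.minus_equality) (auto simp: N.M.l_neg T0 simp flip: T(2))
    then show ?case using uminus T(1) by (simp add: N.smult_l_minus L.smult_l_minus)
  next
    case (add P Q)
    then show ?case using T by (simp add: N.smult_l_distr L.smult_l_distr)
  next
    case (mult P Q)
    then show ?case using T by (simp add: N.smult_assoc1 L.smult_assoc1)
  }
qed (simp_all add: const var partial)

section \<open>The linear map attached to a horizontal form\<close>

context D_module
begin

lemma horizontal_formD:
  assumes "horizontal_form f" "x \<in> carrier M"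
  shows "y \<in> carrier M \<Longrightarrow> f (x \<oplus>\<^bsub>M\<^esub> y) = f x + f y"
    and "f (const_op n c \<odot>\<^bsub>M\<^esub> x) = c * f x"
    and "j < n \<Longrightarrow> f (partial_op n j \<odot>\<^bsub>M\<^esub> x) = 0"
  using assms by (auto simp: horizontal_form_def)

lemma monomial_op_closed: "Poly_Mapping.keys a \<subseteq> {..<n} \<Longrightarrow> monomial_op n a \<in> carrier (diff_ops n)"
  by (intro ops_closed(1) monomial_polys)

text \<open>Expand the derivative of x^a x by the product rule and apply \<open>f\<close>, which
  kills it.\<close>

lemma horizontal_form_integration_by_parts:
  assumes f: "horizontal_form f" and a: "Poly_Mapping.keys a \<subseteq> {..<n}" and j: "j < n"
    and x: "x \<in> carrier M"
  shows "f (monomial_op n a \<odot>\<^bsub>M\<^esub> (partial_op n j \<odot>\<^bsub>M\<^esub> x)) =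
    - of_nat (Poly_Mapping.lookup a j) * f (monomial_op n (a - Poly_Mapping.single j 1) \<odot>\<^bsub>M\<^esub> x)"
proof -
  have b: "Poly_Mapping.keys (a - Poly_Mapping.single j 1) \<subseteq> {..<n}"
    using keys_nat_minus a by blast
  note cl = monomial_op_closed[OF a] monomial_op_closed[OF b] ops_closed(2) ops_closed(4)[OF j]
  have "partial_op n j \<odot>\<^bsub>M\<^esub> (monomial_op n a \<odot>\<^bsub>M\<^esub> x) =
      monomial_op n a \<odot>\<^bsub>M\<^esub> (partial_op n j \<odot>\<^bsub>M\<^esub> x) \<oplus>\<^bsub>M\<^esub>
      const_op n (of_nat (Poly_Mapping.lookup a j)) \<odot>\<^bsub>M\<^esub> (monomial_op n (a - Poly_Mapping.single j 1) \<odot>\<^bsub>M\<^esub> x)"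
    unfolding smult_assoc1[OF cl(4) cl(1) x, symmetric] partial_monomial_op[OF a]
    by (simp only: smult_l_distr smult_assoc1 R.m_closed cl x)
  moreover have "f (partial_op n j \<odot>\<^bsub>M\<^esub> (monomial_op n a \<odot>\<^bsub>M\<^esub> x)) = 0"
    by (intro horizontal_formD(3) f j smult_closed cl x)
  ultimately have "0 = f (monomial_op n a \<odot>\<^bsub>M\<^esub> (partial_op n j \<odot>\<^bsub>M\<^esub> x)) +
      of_nat (Poly_Mapping.lookup a j) * f (monomial_op n (a - Poly_Mapping.single j 1) \<odot>\<^bsub>M\<^esub> x)"
    by (simp only: horizontal_formD[OF f] smult_closed cl x)
  then show ?thesis by (simp add: eq_neg_iff_add_eq_0)
qed

text \<open>
  \<open>moment_map f m = \<Sum>\<^sub>a f (x\<^sup>a m) x\<^sup>-\<^sup>a\<^sup>-\<^sup>1\<close>, the \<open>\<D>\<close>-linear map to \<open>E\<close> with residue \<open>f\<close>; it makes sense when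
  only finitely many of the moments \<open>f (x\<^sup>a m)\<close> are nonzero.
\<close>

definition moment_map :: "('m \<Rightarrow> 'k) \<Rightarrow> 'm \<Rightarrow> 'k laurent" where
  "moment_map f x = Abs_poly_mapping (\<lambda>e. if e \<in> inv_exps n then f (monomial_op n (nexp n e) \<odot>\<^bsub>M\<^esub> x) else 0)"

context
  fixes f
  assumes f: "horizontal_form f"
    and fin: "\<And>x. x \<in> carrier M \<Longrightarrow>
      finite {a. Poly_Mapping.keys a \<subseteq> {..<n} \<and> f (monomial_op n a \<odot>\<^bsub>M\<^esub> x) \<noteq> 0}"
begin

text \<open>\<open>Abs_poly_mapping\<close> needs finite support; \<open>nexp n\<close> embeds the
  support into the finite set of exponents with nonzero moment.\<close>

lemma lookup_moment_map:
  assumes x: "x \<in> carrier M"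
  shows "Poly_Mapping.lookup (moment_map f x) e =
    (if e \<in> inv_exps n then f (monomial_op n (nexp n e) \<odot>\<^bsub>M\<^esub> x) else 0)"
proof -
  let ?S = "{e \<in> inv_exps n. f (monomial_op n (nexp n e) \<odot>\<^bsub>M\<^esub> x) \<noteq> 0}"
  have "nexp n ` ?S \<subseteq> {a. Poly_Mapping.keys a \<subseteq> {..<n} \<and> f (monomial_op n a \<odot>\<^bsub>M\<^esub> x) \<noteq> 0}"
    using keys_nexp by blast
  then have "finite (nexp n ` ?S)" by (rule finite_subset) (rule fin[OF x])
  then have "finite ?S"
    by (rule finite_imageD) (rule inj_on_subset[OF inj_on_nexp], blast)
  moreover have "{e. (if e \<in> inv_exps n then f (monomial_op n (nexp n e) \<odot>\<^bsub>M\<^esub> x) else 0) \<noteq> 0} = ?S"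
    by auto
  ultimately show ?thesis
    unfolding moment_map_def by (subst Abs_poly_mapping_inverse) auto
qed

lemma moment_map_inv_polys: "x \<in> carrier M \<Longrightarrow> moment_map f x \<in> inv_polys n"
  by (auto simp: inv_polys_def in_keys_iff lookup_moment_map split: if_splits)

lemma moment_map_add:
  assumes "x \<in> carrier M" "y \<in> carrier M"
  shows "moment_map f (x \<oplus>\<^bsub>M\<^esub> y) = moment_map f x + moment_map f y"
proof (rule poly_mapping_eqI)
  fix e
  show "Poly_Mapping.lookup (moment_map f (x \<oplus>\<^bsub>M\<^esub> y)) e =
      Poly_Mapping.lookup (moment_map f x + moment_map f y) e"
  proof (cases "e \<in> inv_exps n")
    case True
    note m = monomial_op_closed[OF keys_nexp[OF True]]
    have "f (monomial_op n (nexp n e) \<odot>\<^bsub>M\<^esub> (x \<oplus>\<^bsub>M\<^esub> y)) =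
        f (monomial_op n (nexp n e) \<odot>\<^bsub>M\<^esub> x) + f (monomial_op n (nexp n e) \<odot>\<^bsub>M\<^esub> y)"
      unfolding smult_r_distr[OF m assms] by (intro horizontal_formD f smult_closed m assms)
    then show ?thesis using assms by (simp add: lookup_moment_map lookup_add)
  qed (use assms in \<open>simp add: lookup_moment_map lookup_add\<close>)
qed

lemma moment_map_smult:
  assumes P: "P \<in> carrier (diff_ops n)" and x: "x \<in> carrier M"
  shows "moment_map f (P \<odot>\<^bsub>M\<^esub> x) = P \<odot>\<^bsub>E_mod n\<^esub> moment_map f x"
proof -
  note mono = monomial_op_closed[OF keys_nexp]
  have const: "moment_map f (const_op n c \<odot>\<^bsub>M\<^esub> x) = const_op n c \<odot>\<^bsub>E_mod n\<^esub> moment_map f x"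
    if x: "x \<in> carrier M" for c x
    unfolding E_mod_const[OF moment_map_inv_polys[OF x]]
  proof (rule poly_mapping_eqI)
    fix e
    have "f (monomial_op n (nexp n e) \<odot>\<^bsub>M\<^esub> (const_op n c \<odot>\<^bsub>M\<^esub> x)) =
        c * f (monomial_op n (nexp n e) \<odot>\<^bsub>M\<^esub> x)" if e: "e \<in> inv_exps n"
      unfolding const_smult_commute[OF x mono[OF e], symmetric]
      by (intro horizontal_formD f smult_closed mono e x)
    then show "Poly_Mapping.lookup (moment_map f (const_op n c \<odot>\<^bsub>M\<^esub> x)) e =
        Poly_Mapping.lookup (scale c (moment_map f x)) e"
      using x by (simp add: lookup_moment_map)
  qed
  have var: "moment_map f (var_op n j \<odot>\<^bsub>M\<^esub> x) = var_op n j \<odot>\<^bsub>E_mod n\<^esub> moment_map f x"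
    if j: "j < n" and x: "x \<in> carrier M" for j x
  proof (rule poly_mapping_eqI)
    fix e
    \<comment> \<open>Lowering an exponent stays inside \<open>inv_exps n\<close>, so the shifted
      coefficient is again a moment.\<close>
    have "e - Poly_Mapping.single j 1 \<in> inv_exps n" if "e \<in> inv_exps n"
      using that j by (auto simp: inv_exps_iff lookup_minus lookup_single when_def) force?
    moreover have "monomial_op n (nexp n e) \<odot>\<^bsub>M\<^esub> (var_op n j \<odot>\<^bsub>M\<^esub> x) =
        monomial_op n (nexp n (e - Poly_Mapping.single j 1)) \<odot>\<^bsub>M\<^esub> x" if e: "e \<in> inv_exps n"
      unfolding smult_assoc1[OF mono[OF e] ops_closed(3)[OF j] x, symmetric]
        monomial_op_var[OF keys_nexp[OF e] j] nexp_minus[OF e j] ..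
    ultimately show "Poly_Mapping.lookup (moment_map f (var_op n j \<odot>\<^bsub>M\<^esub> x)) e =
        Poly_Mapping.lookup (var_op n j \<odot>\<^bsub>E_mod n\<^esub> moment_map f x) e"
      using j x
      by (simp add: E_mod_var inv_var_eq moment_map_inv_polys lookup_moment_map lookup_trunc
          lookup_xL_mult)
  qed
  have partial: "moment_map f (partial_op n j \<odot>\<^bsub>M\<^esub> x) = partial_op n j \<odot>\<^bsub>E_mod n\<^esub> moment_map f x"
    if j: "j < n" and x: "x \<in> carrier M" for j x
  proof (rule poly_mapping_eqI)
    fix e :: "nat \<Rightarrow>\<^sub>0 int"
    let ?e = "e + Poly_Mapping.single j 1"
    have "Poly_Mapping.lookup (moment_map f (partial_op n j \<odot>\<^bsub>M\<^esub> x)) e =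
        of_int (Poly_Mapping.lookup e j + 1) * Poly_Mapping.lookup (moment_map f x) ?e"
    proof (cases "e \<in> inv_exps n")
      case True
      have ej: "Poly_Mapping.lookup e j \<le> -1" using True j by (simp add: inv_exps_iff)
      \<comment> \<open>The exponent a = \<open>nexp n e\<close> has a_j = -1 - e_j, so the factor
        from integration by parts is that of the formal derivative.\<close>
      have n: "- of_nat (Poly_Mapping.lookup (nexp n e) j) = (of_int (Poly_Mapping.lookup e j + 1) :: 'k)"
        using j ej by (simp add: lookup_nexp of_nat_nat)
      have l: "Poly_Mapping.lookup (moment_map f (partial_op n j \<odot>\<^bsub>M\<^esub> x)) e =
          of_int (Poly_Mapping.lookup e j + 1) *
          f (monomial_op n (nexp n e - Poly_Mapping.single j 1) \<odot>\<^bsub>M\<^esub> x)"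
        using True j x horizontal_form_integration_by_parts[OF f keys_nexp[OF True] j x]
        unfolding n by (simp add: lookup_moment_map)
      show ?thesis
      \<comment> \<open>At exponent -1 the factor is zero; otherwise \<open>?e\<close> is still in
        \<open>inv_exps n\<close> and carries the required moment.\<close>
      proof (cases "Poly_Mapping.lookup e j = -1")
        case False
        then have e: "?e \<in> inv_exps n"
          using True j ej by (auto simp: inv_exps_iff lookup_add lookup_single when_def)
        from nexp_minus[OF e j] have "nexp n e - Poly_Mapping.single j 1 = nexp n ?e" by simp
        then show ?thesis using e x unfolding l by (simp add: lookup_moment_map)
      qed (simp add: l)
    next
      case False
      \<comment> \<open>Both sides are zero, because raising an exponent of \<open>e\<close> cannot
        lead into \<open>inv_exps n\<close>.\<close>
      have "?e \<notin> inv_exps n"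
      proof
        assume *: "?e \<in> inv_exps n"
        have "Poly_Mapping.lookup e i \<le> Poly_Mapping.lookup ?e i"
          "i \<ge> n \<Longrightarrow> Poly_Mapping.lookup e i = Poly_Mapping.lookup ?e i" for i
          using j by (auto simp: lookup_add lookup_single when_def)
        then have "e \<in> inv_exps n" using * unfolding inv_exps_iff by (metis order_trans)
        then show False using False by simp
      qed
      then show ?thesis using False j x by (simp add: lookup_moment_map)
    qed
    then show "Poly_Mapping.lookup (moment_map f (partial_op n j \<odot>\<^bsub>M\<^esub> x)) e =
        Poly_Mapping.lookup (partial_op n j \<odot>\<^bsub>E_mod n\<^esub> moment_map f x) e"
      using j x by (simp add: E_mod_partial inv_partial_eq moment_map_inv_polys lookup_dL)
  qed
  show "moment_map f (P \<odot>\<^bsub>M\<^esub> x) = P \<odot>\<^bsub>E_mod n\<^esub> moment_map f x"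
    by (rule D_linear_if_generators[OF left_module_axioms E_mod_left_module])
       (use P x in \<open>auto simp: E_mod_simps moment_map_inv_polys moment_map_add const var partial\<close>)
qed

lemma residue_moment_map:
  assumes "x \<in> carrier M"
  shows "Poly_Mapping.lookup (moment_map f x) (corner n) = f x"
  using assms const_smult_simps(3)[OF assms]
  by (simp add: lookup_moment_map corner_in nexp_corner const_op_def)

end

end

section \<open>Surjections onto powers of the module of inverse polynomials\<close>

lemma E_power_simps:
  "carrier (module_power s (E_mod n)) = {..<s} \<rightarrow>\<^sub>E inv_polys n"
  "u \<oplus>\<^bsub>module_power s (E_mod n)\<^esub> v = (\<lambda>i\<in>{..<s}. u i + v i)"
  "P \<odot>\<^bsub>module_power s (E_mod n)\<^esub> u = (\<lambda>i\<in>{..<s}. P \<odot>\<^bsub>E_mod n\<^esub> u i)"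
  by (simp_all add: module_power_def E_mod_simps)

text \<open>The joint image of the moment maps is a submodule. By duality the image of
  \<open>v k\<close> has the k-th unit vector as its residues, so \<open>J_all\<close>
  applies.\<close>

lemma surjection_of_dual_system:
  fixes M :: "('k::field_char_0 operator, 'm) module"
  assumes M: "D_module n M"
    and f: "\<And>j. j < s \<Longrightarrow> D_module.horizontal_form n M (f j)"
    and fin: "\<And>j x. j < s \<Longrightarrow> x \<in> carrier M \<Longrightarrow>
      finite {a. Poly_Mapping.keys a \<subseteq> {..<n} \<and> f j (monomial_op n a \<odot>\<^bsub>M\<^esub> x) \<noteq> 0}"
    and v: "\<And>i. i < s \<Longrightarrow> v i \<in> carrier M"
    and dual: "\<And>i j. i < s \<Longrightarrow> j < s \<Longrightarrow> f j (v i) = (if i = j then 1 else 0)"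
  shows "\<exists>\<phi> \<in> module_hom (diff_ops n) M (module_power s (E_mod n)).
    \<phi> ` carrier M = carrier (module_power s (E_mod n))"
proof -
  interpret D_module n M by (rule M)
  define \<phi> where "\<phi> x = (\<lambda>i\<in>{..<s}. moment_map (f i) x)" for x
  have props: "moment_map (f j) x \<in> inv_polys n"
    "y \<in> carrier M \<Longrightarrow> moment_map (f j) (x \<oplus>\<^bsub>M\<^esub> y) = moment_map (f j) x + moment_map (f j) y"
    "P \<in> carrier (diff_ops n) \<Longrightarrow> moment_map (f j) (P \<odot>\<^bsub>M\<^esub> x) = P \<odot>\<^bsub>E_mod n\<^esub> moment_map (f j) x"
    "Poly_Mapping.lookup (moment_map (f j) x) (corner n) = f j x"
    if j: "j < s" and x: "x \<in> carrier M" for j x y P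
    by (rule moment_map_inv_polys moment_map_add moment_map_smult residue_moment_map;
        (rule f fin j x | assumption)+)+
  have \<phi>_closed: "\<phi> x \<in> carrier (module_power s (E_mod n))" if "x \<in> carrier M" for x
    using that by (auto simp: \<phi>_def E_power_simps props)
  have hom: "\<phi> \<in> module_hom (diff_ops n) M (module_power s (E_mod n))"
    using \<phi>_closed by (auto simp: module_hom_def \<phi>_def E_power_simps props intro!: restrict_ext)
  \<comment> \<open>The joint image, leaving the entries from \<open>s\<close> on
    unconstrained.\<close>
  define J where "J u \<longleftrightarrow> (\<exists>x\<in>carrier M. \<forall>i<s. moment_map (f i) x = u i)" for u
  \<comment> \<open>Closure under an operator comes from applying it to a preimage in
    \<open>M\<close>.\<close>
  have J_op: "J w" if Ju: "J u" and P: "P \<in> carrier (diff_ops n)"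
    and w: "\<And>i. i < s \<Longrightarrow> u i \<in> inv_polys n \<Longrightarrow> P \<odot>\<^bsub>E_mod n\<^esub> u i = w i" for u w P
  proof -
    obtain x where x: "x \<in> carrier M" "\<And>i. i < s \<Longrightarrow> moment_map (f i) x = u i"
      using Ju unfolding J_def by blast
    have "moment_map (f i) (P \<odot>\<^bsub>M\<^esub> x) = w i" if "i < s" for i
    proof -
      have "u i \<in> inv_polys n" using props(1)[OF that x(1)] x(2)[OF that] by simp
      then show ?thesis
        using props(3)[OF that x(1) P] x(2)[OF that] w[OF that] by simp
    qed
    moreover have "P \<odot>\<^bsub>M\<^esub> x \<in> carrier M" using P x(1) by (rule smult_closed)
    ultimately show ?thesis unfolding J_def by blast
  qed
  interpret inv_poly_vectors n s J
  proof
    show "u i \<in> inv_polys n" if "J u" "i < s" for u i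
      using that props(1) unfolding J_def by metis
    show "J w" if "J u" "\<And>i. i < s \<Longrightarrow> u i = w i" for u w
      using that unfolding J_def by simp
    have "moment_map (f i) \<zero>\<^bsub>M\<^esub> = 0" if "i < s" for i
      using props(2)[OF that, of "\<zero>\<^bsub>M\<^esub>" "\<zero>\<^bsub>M\<^esub>"] by simp
    then show "J (\<lambda>_. 0)" unfolding J_def by blast
    show "J (\<lambda>i. u i + w i)" if Juw: "J u" "J w" for u w
    proof -
      obtain x y where "x \<in> carrier M" "\<And>i. i < s \<Longrightarrow> moment_map (f i) x = u i"
        "y \<in> carrier M" "\<And>i. i < s \<Longrightarrow> moment_map (f i) y = w i"
        using Juw unfolding J_def by blast
      then show ?thesis unfolding J_def by (intro bexI[of _ "x \<oplus>\<^bsub>M\<^esub> y"]) (auto simp: props)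
    qed
    show "J (\<lambda>i. scale c (u i))" if "J u" for c u
      by (rule J_op[OF that ops_closed(2)[of _ c]]) (simp add: E_mod_const)
    show "J (\<lambda>i. trunc n (xL j * u i))" if "J u" "j < n" for u j
      by (rule J_op[OF that(1) ops_closed(3)[OF that(2)]])
         (simp add: E_mod_var[OF that(2)] inv_var_eq)
    show "J (\<lambda>i. dL j (u i))" if "J u" "j < n" for u j
      by (rule J_op[OF that(1) ops_closed(4)[OF that(2)]])
         (simp add: E_mod_partial[OF that(2)] inv_partial_eq)
  qed
  have residues: "\<exists>u. J u \<and> (\<forall>i<s. Poly_Mapping.lookup (u i) (corner n) = (if i = k then 1 else 0))"
    if k: "k < s" for k
  proof (intro exI conjI allI impI)
    show "J (\<lambda>i. moment_map (f i) (v k))" using v[OF k] unfolding J_def by blast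
    show "Poly_Mapping.lookup (moment_map (f i) (v k)) (corner n) = (if i = k then 1 else 0)"
      if "i < s" for i
      using props(4)[OF that v[OF k]] dual[OF k that] by auto
  qed
  have "carrier (module_power s (E_mod n)) \<subseteq> \<phi> ` carrier M"
  proof
    fix u :: "nat \<Rightarrow> 'k laurent" assume u: "u \<in> carrier (module_power s (E_mod n))"
    then have "J u" by (intro J_all[OF residues]) (auto simp: E_power_simps)
    then obtain x where x: "x \<in> carrier M" "\<And>i. i < s \<Longrightarrow> moment_map (f i) x = u i"
      unfolding J_def by blast
    have "\<phi> x = u"
    proof (rule PiE_ext)
      show "\<phi> x \<in> {..<s} \<rightarrow>\<^sub>E inv_polys n" using \<phi>_closed[OF x(1)] by (simp only: E_power_simps)
      show "u \<in> {..<s} \<rightarrow>\<^sub>E inv_polys n" using u by (simp only: E_power_simps)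
      show "\<phi> x i = u i" if "i \<in> {..<s}" for i using that x(2) by (simp add: \<phi>_def)
    qed
    then show "u \<in> \<phi> ` carrier M" using x(1) by blast
  qed
  then have "\<phi> ` carrier M = carrier (module_power s (E_mod n))" using \<phi>_closed by blast
  then show ?thesis using hom by blast
qed

lemma dual_system_of_surjection:
  fixes M :: "('k::field operator, 'm) module"
  assumes M: "D_module n M"
    and \<phi>: "\<phi> \<in> module_hom (diff_ops n) M (module_power s (E_mod n))"
    and surj: "\<phi> ` carrier M = carrier (module_power s (E_mod n))"
  obtains v f where "\<And>i. i < s \<Longrightarrow> v i \<in> carrier M"
    "\<And>j. j < s \<Longrightarrow> D_module.horizontal_form n M (f j)"
    "\<And>i j. i < s \<Longrightarrow> j < s \<Longrightarrow> f j (v i) = (if i = j then 1 else 0)"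
proof -
  interpret D_module n M by (rule M)
  define f where "f j x = Poly_Mapping.lookup (\<phi> x j) (corner n)" for j x
  define w :: "nat \<Rightarrow> nat \<Rightarrow> 'k laurent"
    where "w i = (\<lambda>j\<in>{..<s}. if i = j then Poly_Mapping.single (corner n) 1 else 0)" for i
  have \<phi>_closed: "\<phi> x j \<in> inv_polys n" if "x \<in> carrier M" "j < s" for x j
    using module_hom_closed[OF \<phi>] that by (auto simp: E_power_simps Pi_iff PiE_iff)
  have "horizontal_form (f j)" if j: "j < s" for j
    unfolding horizontal_form_def
  proof (intro conjI ballI allI impI)
    fix x assume x: "x \<in> carrier M"
    show "f j (x \<oplus>\<^bsub>M\<^esub> y) = f j x + f j y" if "y \<in> carrier M" for y
      using module_hom_add[OF \<phi> x that] j by (simp add: f_def E_power_simps lookup_add)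
    show "f j (const_op n c \<odot>\<^bsub>M\<^esub> x) = c * f j x" for c
      using module_hom_smult[OF \<phi> ops_closed(2) x, of c] j \<phi>_closed[OF x j]
      by (simp add: f_def E_power_simps E_mod_const)
    \<comment> \<open>A derivative has no residue: its coefficient at exponent -1 carries the factor
      -1 + 1.\<close>
    show "f j (partial_op n k \<odot>\<^bsub>M\<^esub> x) = 0" if k: "k < n" for k
      using module_hom_smult[OF \<phi> ops_closed(4)[OF k] x] j \<phi>_closed[OF x j] k
      by (simp add: f_def E_power_simps E_mod_partial inv_partial_eq lookup_dL lookup_corner)
  qed
  \<comment> \<open>For \<open>i\<close> at least \<open>s\<close> the vector \<open>w i\<close> is
    zero and still in the image, so preimages can be chosen for all \<open>i\<close>.\<close>
  moreover have "w i \<in> \<phi> ` carrier M" for i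
    unfolding surj E_power_simps w_def by (auto simp: inv_polys_def corner_in)
  then have "\<forall>i. \<exists>x. x \<in> carrier M \<and> \<phi> x = w i" by (metis imageE)
  then obtain v where v: "\<And>i. v i \<in> carrier M" "\<And>i. \<phi> (v i) = w i" by metis
  moreover have "f j (v i) = (if i = j then 1 else 0)" if "i < s" "j < s" for i j
    using that by (simp add: f_def v w_def)
  ultimately show thesis by (intro that[of v f]) auto
qed

text \<open>\<open>Max\<close> has its meaning only on finite non-empty sets, so both properties are
  part of the claim.\<close>

theorem theorem2:
  fixes n :: nat
    and M :: "('k::field_char_0 operator, 'm) module"
    and gr :: "int \<Rightarrow> 'm set"
  assumes "graded_D_module n M gr"
    and "vectorspace.fin_dim class_ring (dR_cohomology n M n)"
  shows "let S = {s::nat. \<exists>\<phi> \<in> module_hom (diff_ops n) M (module_power s (E_mod n)).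
                    \<phi> ` carrier M = carrier (module_power s (E_mod n))}
         in finite S \<and> S \<noteq> {} \<and>
            vectorspace.dim class_ring (dR_cohomology n M n) = Max S"
proof -
  interpret graded_D_module n M gr by (rule assms(1))
  let ?d = "vectorspace.dim class_ring (dR_cohomology n M n)"
  define S where "S = {s::nat. \<exists>\<phi> \<in> module_hom (diff_ops n) M (module_power s (E_mod n)).
                    \<phi> ` carrier M = carrier (module_power s (E_mod n))}"
  have le: "s \<le> ?d" if s: "s \<in> S" for s
  proof -
    obtain \<phi> where \<phi>: "\<phi> \<in> module_hom (diff_ops n) M (module_power s (E_mod n))"
      "\<phi> ` carrier M = carrier (module_power s (E_mod n))"
      using s unfolding S_def by blast
    show ?thesis
    proof (rule dual_system_of_surjection[OF D_module_axioms \<phi>])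
      fix v f
      assume "\<And>i. i < s \<Longrightarrow> v i \<in> carrier M" "\<And>j. j < s \<Longrightarrow> horizontal_form (f j)"
        "\<And>i j. i < s \<Longrightarrow> j < s \<Longrightarrow> f j (v i) = (if i = j then 1 else 0)"
      then show "s \<le> ?d" by (rule horizontal_dual_system_le_dim[OF assms(2)])
    qed
  qed
  \<comment> \<open>The bound is attained by a full dual basis of horizontal forms; the grading
    enters here, through \<open>finite_moments\<close>.\<close>
  have "?d \<in> S"
  proof (rule horizontal_dual_basis[OF assms(2)])
    fix v f
    assume *: "\<And>i. i < ?d \<Longrightarrow> v i \<in> carrier M" "\<And>j. j < ?d \<Longrightarrow> horizontal_form (f j)"
      "\<And>i j. i < ?d \<Longrightarrow> j < ?d \<Longrightarrow> f j (v i) = (if i = j then 1 else 0)"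
    show "?d \<in> S"
      unfolding S_def mem_Collect_eq
      by (rule surjection_of_dual_system[OF D_module_axioms *(2) _ *(1,3)])
         (assumption | rule finite_moments[OF assms(2) *(2)])+
  qed
  moreover have "finite S" using le by (intro finite_subset[of S "{..?d}"]) auto
  ultimately have "finite S \<and> S \<noteq> {} \<and> ?d = Max S"
    using le by (auto intro!: Max_eqI[symmetric])
  then show ?thesis unfolding Let_def S_def .
qed

end
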